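(* If $\Phi$ is a contractive Schur idempotent on $\mathcal{B}(H)$ (that is, $\|\Phi\|\leq 1$), then $\Phi\in\mathfrak{H}$ and $\lambda(\Phi)\leq 2$.
   Context: $H$ is a separable Hilbert space, $\mathcal{B}(H)$ is the space of bounded linear operators on $H$ with the operator norm, and $\mathcal{D}\subseteq\mathcal{B}(H)$ is a fixed maximal abelian selfadjoint algebra (masa). For a subspace $\mathcal{X}\subseteq\mathcal{B}(H)$ and $T\in\mathcal{B}(H)$, put $\alpha(T,\mathcal{X})=\sup\{\inf_{X\in\mathcal{X}}\|T\xi-X\xi\| : \xi\in H,\ \|\xi\|=1\}$. A Schur multiplier is a weak* continuous $\mathcal{D}$-bimodule (linear) map on $\mathcal{B}(H)$; $\|\Phi\|$ denotes its norm as a linear map on the Banach space $\mathcal{B}(H)$. A Schur idempotent is a Schur multiplier $\Phi$ with $\Phi\circ\Phi=\Phi$; $\mathfrak{I}$ is the set of all Schur idempotents. Put $\Phi^\perp=\mathrm{id}-\Phi$ and let $\operatorname{Ran}\Phi$ be the range of $\Phi$. $\mathfrak{H}$ is the set of $\Phi\in\mathfrak{I}$ for which there is $\lambda>0$ with $\|\Phi^\perp(T)\|\leq\lambda\,\alpha(T,\operatorname{Ran}\Phi)$ for all $T\in\mathcal{B}(H)$; the least (infimal) such $\lambda$ is denoted $\lambda(\Phi)$. *)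

theory Defs
  imports "HOL-Analysis.Analysis"
begin

section \<open>Complex Hilbert spaces\<close>

class complex_vector = real_vector +
  fixes scaleC :: "complex \<Rightarrow> 'a \<Rightarrow> 'a"  (infixr \<open>*\<^sub>C\<close> 75)
  assumes scaleC_add_right: "a *\<^sub>C (x + y) = a *\<^sub>C x + a *\<^sub>C y"
    and scaleC_add_left: "(a + b) *\<^sub>C x = a *\<^sub>C x + b *\<^sub>C x"
    and scaleC_scaleC: "a *\<^sub>C (b *\<^sub>C x) = (a * b) *\<^sub>C x"
    and scaleC_of_real: "complex_of_real r *\<^sub>C x = r *\<^sub>R x"

class complex_normed_vector = complex_vector + real_normed_vector +
  assumes norm_scaleC: "norm (a *\<^sub>C x) = norm a * norm x"

text \<open>The inner product is linear in the first argument. Its real part is the real inner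
  product of the library, so that \<^class>\<open>real_inner\<close> supplies positive definiteness
  and \<open>norm x = sqrt (Re (cinner x x))\<close>.\<close>

class complex_inner = complex_normed_vector + real_inner +
  fixes cinner :: "'a \<Rightarrow> 'a \<Rightarrow> complex"
  assumes cinner_commute: "cinner x y = cnj (cinner y x)"
    and cinner_add_left: "cinner (x + y) z = cinner x z + cinner y z"
    and cinner_scaleC_left: "cinner (a *\<^sub>C x) y = a * cinner x y"
    and inner_eq_Re_cinner: "inner x y = Re (cinner x y)"

class complex_hilbert_space = complex_inner + complete_space


section \<open>Bounded operators\<close>

lemma bounded_linear_scaleC:
  "bounded_linear (\<lambda>x::'a::complex_normed_vector. a *\<^sub>C x)"
proof (rule bounded_linear_intro[where K = "norm a"])
  fix r :: real and x :: 'a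
  show "a *\<^sub>C (r *\<^sub>R x) = r *\<^sub>R (a *\<^sub>C x)"
    by (simp add: scaleC_of_real[symmetric] scaleC_scaleC mult.commute)
qed (simp_all add: scaleC_add_right norm_scaleC mult.commute)

instantiation blinfun :: (real_normed_vector, complex_normed_vector) complex_vector
begin

lift_definition scaleC_blinfun :: "complex \<Rightarrow> ('a \<Rightarrow>\<^sub>L 'b) \<Rightarrow> ('a \<Rightarrow>\<^sub>L 'b)"
  is "\<lambda>a f x. a *\<^sub>C f x"
  by (rule bounded_linear_compose[OF bounded_linear_scaleC])

instance
  by standard
    (transfer, simp add: scaleC_add_right scaleC_add_left scaleC_scaleC scaleC_of_real fun_eq_iff)+

end

text \<open>The type \<open>'a \<Rightarrow>\<^sub>L 'a\<close> consists of the bounded real-linear maps; \<open>BH\<close>, the space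
  of bounded operators on the Hilbert space, is its subset of complex-linear ones. On
  it, \<^const>\<open>norm\<close> is the operator norm.\<close>

definition BH :: "('a::complex_hilbert_space \<Rightarrow>\<^sub>L 'a) set" where
  "BH = {T. \<forall>c x. blinfun_apply T (c *\<^sub>C x) = c *\<^sub>C blinfun_apply T x}"

definition is_adjoint ::
    "('a::complex_hilbert_space \<Rightarrow>\<^sub>L 'a) \<Rightarrow> ('a \<Rightarrow>\<^sub>L 'a) \<Rightarrow> bool" where
  "is_adjoint A B \<longleftrightarrow>
     (\<forall>x y. cinner (blinfun_apply A x) y = cinner x (blinfun_apply B y))"

definition abelian_selfadjoint_algebra ::
    "('a::complex_hilbert_space \<Rightarrow>\<^sub>L 'a) set \<Rightarrow> bool" where
  "abelian_selfadjoint_algebra D \<longleftrightarrow>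
     D \<subseteq> BH \<and> 0 \<in> D \<and>
     (\<forall>A\<in>D. \<forall>B\<in>D. A + B \<in> D) \<and>
     (\<forall>c. \<forall>A\<in>D. c *\<^sub>C A \<in> D) \<and>
     (\<forall>A\<in>D. \<forall>B\<in>D. A o\<^sub>L B \<in> D) \<and>
     (\<forall>A\<in>D. \<exists>B\<in>D. is_adjoint A B) \<and>
     (\<forall>A\<in>D. \<forall>B\<in>D. A o\<^sub>L B = B o\<^sub>L A)"

definition masa :: "('a::complex_hilbert_space \<Rightarrow>\<^sub>L 'a) set \<Rightarrow> bool" where
  "masa D \<longleftrightarrow> abelian_selfadjoint_algebra D \<and>
     (\<forall>E. abelian_selfadjoint_algebra E \<and> D \<subseteq> E \<longrightarrow> E = D)"

text \<open>The functionals induced by the predual of \<open>BH\<close>, the trace class operators: the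
  functional \<open>T \<mapsto> tr (T K)\<close> with \<open>K = (\<Sum>n. cinner _ (y n) *\<^sub>C x n)\<close>. The weak*
  topology is the weakest topology on \<open>BH\<close> making all of them continuous.\<close>

definition predual_functionals ::
    "(('a::complex_hilbert_space \<Rightarrow>\<^sub>L 'a) \<Rightarrow> complex) set" where
  "predual_functionals =
     {(\<lambda>T. \<Sum>n. cinner (blinfun_apply T (x n)) (y n)) | x y :: nat \<Rightarrow> 'a.
        summable (\<lambda>n. (norm (x n))\<^sup>2) \<and> summable (\<lambda>n. (norm (y n))\<^sup>2)}"

definition weak_star :: "('a::complex_hilbert_space \<Rightarrow>\<^sub>L 'a) topology" where
  "weak_star = topology_generated_by
     {{T \<in> BH. f T \<in> U} | f U. f \<in> predual_functionals \<and> open U}"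

lemma topspace_weak_star: "topspace weak_star = BH"
proof -
  have "(\<lambda>T. \<Sum>n. cinner (blinfun_apply T ((\<lambda>_. 0) n)) ((\<lambda>_. 0) n))
          \<in> (predual_functionals :: (('a \<Rightarrow>\<^sub>L 'a) \<Rightarrow> complex) set)"
    unfolding predual_functionals_def
    by (rule CollectI, rule exI[of _ "\<lambda>_. 0"], rule exI[of _ "\<lambda>_. 0"]) simp
  then obtain f :: "('a \<Rightarrow>\<^sub>L 'a) \<Rightarrow> complex" where f: "f \<in> predual_functionals"
    by blast
  then have "{T \<in> BH. f T \<in> UNIV} \<in> {{T \<in> BH. f T \<in> U} | f U. f \<in> predual_functionals \<and> open U}"
    using open_UNIV by blast
  then have "\<Union> {{T \<in> BH. f T \<in> U} | f U. f \<in> predual_functionals \<and> open U}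
      = (BH :: ('a \<Rightarrow>\<^sub>L 'a) set)"
    by blast
  then show ?thesis
    by (simp add: weak_star_def topology_generated_by_topspace)
qed


section \<open>Schur idempotents\<close>

text \<open>Maps on \<open>BH\<close> are functions on \<open>'a \<Rightarrow>\<^sub>L 'a\<close> of which only the values on \<open>BH\<close> matter.
  Continuity includes \<open>\<Phi> ` BH \<subseteq> BH\<close>.\<close>

definition schur_multiplier ::
    "('a::complex_hilbert_space \<Rightarrow>\<^sub>L 'a) set \<Rightarrow> (('a \<Rightarrow>\<^sub>L 'a) \<Rightarrow> ('a \<Rightarrow>\<^sub>L 'a)) \<Rightarrow> bool" where
  "schur_multiplier D \<Phi> \<longleftrightarrow>
     continuous_map weak_star weak_star \<Phi> \<and>
     (\<forall>S\<in>BH. \<forall>T\<in>BH. \<Phi> (S + T) = \<Phi> S + \<Phi> T) \<and>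
     (\<forall>c. \<forall>T\<in>BH. \<Phi> (c *\<^sub>C T) = c *\<^sub>C \<Phi> T) \<and>
     (\<forall>A\<in>D. \<forall>B\<in>D. \<forall>T\<in>BH. \<Phi> (A o\<^sub>L T o\<^sub>L B) = A o\<^sub>L \<Phi> T o\<^sub>L B)"

definition schur_idempotents ::
    "('a::complex_hilbert_space \<Rightarrow>\<^sub>L 'a) set \<Rightarrow> (('a \<Rightarrow>\<^sub>L 'a) \<Rightarrow> ('a \<Rightarrow>\<^sub>L 'a)) set" where
  "schur_idempotents D = {\<Phi>. schur_multiplier D \<Phi> \<and> (\<forall>T\<in>BH. \<Phi> (\<Phi> T) = \<Phi> T)}"

definition map_norm ::
    "(('a::complex_hilbert_space \<Rightarrow>\<^sub>L 'a) \<Rightarrow> ('a \<Rightarrow>\<^sub>L 'a)) \<Rightarrow> ennreal" where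
  "map_norm \<Phi> = (SUP T \<in> {T \<in> BH. norm T \<le> 1}. ennreal (norm (\<Phi> T)))"

definition perp ::
    "(('a::complex_hilbert_space \<Rightarrow>\<^sub>L 'a) \<Rightarrow> ('a \<Rightarrow>\<^sub>L 'a)) \<Rightarrow> (('a \<Rightarrow>\<^sub>L 'a) \<Rightarrow> ('a \<Rightarrow>\<^sub>L 'a))" where
  "perp \<Phi> = (\<lambda>T. T - \<Phi> T)"

definition Ran ::
    "(('a::complex_hilbert_space \<Rightarrow>\<^sub>L 'a) \<Rightarrow> ('a \<Rightarrow>\<^sub>L 'a)) \<Rightarrow> ('a \<Rightarrow>\<^sub>L 'a) set" where
  "Ran \<Phi> = \<Phi> ` BH"

text \<open>With values in \<^typ>\<open>ennreal\<close>, the supremum over the empty unit sphere of the zero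
  space is \<open>0\<close>.\<close>

definition alpha ::
    "('a::complex_hilbert_space \<Rightarrow>\<^sub>L 'a) \<Rightarrow> ('a \<Rightarrow>\<^sub>L 'a) set \<Rightarrow> ennreal" where
  "alpha T \<X> =
     (SUP \<xi> \<in> {\<xi>. norm \<xi> = 1}. INF X \<in> \<X>. ennreal (norm (blinfun_apply T \<xi> - blinfun_apply X \<xi>)))"

definition hyperreflexivity_bounds ::
    "(('a::complex_hilbert_space \<Rightarrow>\<^sub>L 'a) \<Rightarrow> ('a \<Rightarrow>\<^sub>L 'a)) \<Rightarrow> real set" where
  "hyperreflexivity_bounds \<Phi> =
     {l. l > 0 \<and> (\<forall>T\<in>BH. ennreal (norm (perp \<Phi> T)) \<le> ennreal l * alpha T (Ran \<Phi>))}"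

definition hyperreflexive_idempotents ::
    "('a::complex_hilbert_space \<Rightarrow>\<^sub>L 'a) set \<Rightarrow> (('a \<Rightarrow>\<^sub>L 'a) \<Rightarrow> ('a \<Rightarrow>\<^sub>L 'a)) set" where
  "hyperreflexive_idempotents D =
     {\<Phi> \<in> schur_idempotents D. hyperreflexivity_bounds \<Phi> \<noteq> {}}"

definition hyperreflexivity_constant ::
    "(('a::complex_hilbert_space \<Rightarrow>\<^sub>L 'a) \<Rightarrow> ('a \<Rightarrow>\<^sub>L 'a)) \<Rightarrow> real" where
  "hyperreflexivity_constant \<Phi> = Inf (hyperreflexivity_bounds \<Phi>)"

end

theory Submission
  imports Defs
begin

text \<open>Let \<open>R\<close> be the range of \<open>\<Phi>\<close>. If \<open>\<Phi>\<close> acts on matrices by restriction to a pattern, contractivity forces the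
  pattern to be block diagonal, up to permutations of rows and columns. The proof establishes what is
  needed of this picture for an arbitrary masa, and then averages over the signs of the blocks.

  \<^bold>\<open>Averaging.\<close> A block becomes an atom: a pair \<open>(p, q)\<close> of projections in \<open>D\<close> with \<open>p X = X q\<close> for \<open>X \<in> R\<close>
  and \<open>p T q \<in> R\<close> for all \<open>T\<close>. The symmetries \<open>U = 2 p - 1\<close> and \<open>V = 2 q - 1\<close> satisfy \<open>U X V = X\<close> for \<open>X \<in> R\<close>, so
  \<open>\<Phi> (U T V) = \<Phi> T\<close>. Moreover \<open>\<parallel>T - U T V\<parallel> \<le> 2 \<alpha>(T, R)\<close>: on each eigenspace of \<open>V\<close> the operator \<open>U T - T V\<close> is,
  up to sign, \<open>2 r T\<close> for a projection \<open>r\<close> that annihilates the images of this eigenspace under \<open>R\<close>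
  (\<open>symmetry_displacement\<close>). Convex combinations of the operators \<open>U T V\<close>, for products of such
  symmetries, agree with \<open>\<Phi> T\<close> on the rows of any finitely many atoms (\<open>corrected_average\<close>). Since the
  rows of all atoms together are total in \<open>H\<close> (\<open>atoms_total\<close>), the combinations approach \<open>\<Phi> T\<close> weakly, and
  \<open>\<parallel>T - \<Phi> T\<parallel> \<le> 2 \<alpha>(T, R)\<close> follows (\<open>perp_bound\<close>).

  \<^bold>\<open>Atoms from rank one operators.\<close> Write \<open>x \<otimes> y\<close> for \<open>rank_one x y\<close>. If \<open>\<langle>\<Phi> (x \<otimes> y) y, x\<rangle>\<close>
  attains its bound \<open>\<parallel>x\<parallel>\<^sup>2 \<parallel>y\<parallel>\<^sup>2\<close>, then \<open>x \<otimes> y \<in> R\<close> (\<open>rank_one_mem_if_attained\<close>). If \<open>u \<otimes> v \<in> R\<close> and \<open>X \<in> R\<close>, then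
  \<open>X v \<otimes> v \<in> R\<close>, as is seen by adding a large multiple of \<open>u \<otimes> v\<close> to \<open>X\<close> (\<open>rank_one_step\<close>). Hence three corners
  of a rectangle in \<open>R\<close> force the fourth one (\<open>fourth_corner\<close>), and the largest rectangle through \<open>u \<otimes> v\<close> is
  an atom (\<open>rectangle\<close>).

  \<^bold>\<open>Existence of rank one operators.\<close> A nonzero \<open>R\<close> contains an operator of rank one; applied to the maps
  \<open>T \<mapsto> p \<Phi> T\<close> this makes the atoms total. Here weak* continuity is essential: coefficients of \<open>\<Phi>\<close> are
  trace class functionals, which are approximated in norm by step functionals, and \<open>\<Phi> \<circ> \<Phi> = \<Phi>\<close> then yields
  unit vectors with \<open>Re \<langle>\<Phi> (x \<otimes> y) y, x\<rangle> \<ge> 9/10\<close> (\<open>exists_dense_rank_one\<close>). Because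
  \<open>D\<close> is commutative, contractivity also bounds the sum of the first two singular values of
  \<open>V = \<Phi> (x \<otimes> y)\<close> by \<open>1\<close> (\<open>trace_bound\<close>), so the first one is simple and isolated. The norm is
  differentiable at \<open>V\<close>, and \<open>V\<close> has minimal norm in \<open>V + ker \<Phi>\<close>, which places
  the top singular rank one operator of \<open>V\<close> in \<open>R\<close> (\<open>exists_rank_one\<close>).\<close>

section \<open>Complex inner products and bounded operators\<close>

lemma scaleC_zero_right [simp]: "a *\<^sub>C (0::'a::complex_vector) = 0"
  using scaleC_add_right[of a 0 "0::'a"] by simp

lemma scaleC_zero_left [simp]: "0 *\<^sub>C (x::'a::complex_vector) = 0"
  using scaleC_of_real[of 0 x] by simp

lemma scaleC_one [simp]: "1 *\<^sub>C (x::'a::complex_vector) = x"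
  using scaleC_of_real[of 1 x] by simp

lemma scaleC_minus_one: "(-1) *\<^sub>C (x::'a::complex_vector) = - x"
  using scaleC_of_real[of "-1" x] by simp

lemma scaleC_minus_right [simp]: "a *\<^sub>C (- x) = - (a *\<^sub>C (x::'a::complex_vector))"
  using scaleC_add_right[of a x "- x"] by (simp add: eq_neg_iff_add_eq_0 add.commute)

lemma scaleC_minus_left [simp]: "(- a) *\<^sub>C x = - (a *\<^sub>C (x::'a::complex_vector))"
  using scaleC_add_left[of a "- a" x] by (simp add: eq_neg_iff_add_eq_0 add.commute)

lemma scaleC_diff_right: "a *\<^sub>C (x - y) = a *\<^sub>C x - a *\<^sub>C (y::'a::complex_vector)"
  using scaleC_add_right[of a x "- y"] by simp

lemma scaleR_scaleC: "r *\<^sub>R (x::'a::complex_vector) = complex_of_real r *\<^sub>C x"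
  by (simp add: scaleC_of_real)

lemma cinner_zero_left [simp]: "cinner 0 (y::'a::complex_inner) = 0"
  using cinner_add_left[of 0 "0::'a" y] by simp

lemma cinner_zero_right [simp]: "cinner (x::'a::complex_inner) 0 = 0"
  using cinner_commute[of x 0] by simp

lemma cinner_minus_left [simp]: "cinner (- x) (y::'a::complex_inner) = - cinner x y"
  using cinner_add_left[of x "- x" y] by (simp add: eq_neg_iff_add_eq_0 add.commute)

lemma cinner_diff_left: "cinner (x - y) (z::'a::complex_inner) = cinner x z - cinner y z"
  using cinner_add_left[of x "- y" z] by simp

lemma cinner_add_right: "cinner (x::'a::complex_inner) (y + z) = cinner x y + cinner x z"
  by (metis cinner_add_left cinner_commute complex_cnj_add)

lemma cinner_scaleC_right: "cinner (x::'a::complex_inner) (a *\<^sub>C y) = cnj a * cinner x y"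
  by (metis cinner_commute cinner_scaleC_left complex_cnj_mult)

lemma cinner_minus_right [simp]: "cinner (x::'a::complex_inner) (- y) = - cinner x y"
  by (metis cinner_commute cinner_minus_left complex_cnj_minus)

lemma cinner_diff_right: "cinner (x::'a::complex_inner) (y - z) = cinner x y - cinner x z"
  using cinner_add_right[of x y "- z"] by simp

lemma cinner_scaleR_left: "cinner (r *\<^sub>R x) (y::'a::complex_inner) = of_real r * cinner x y"
  by (simp add: scaleR_scaleC cinner_scaleC_left)

lemma cinner_scaleR_right: "cinner (x::'a::complex_inner) (r *\<^sub>R y) = of_real r * cinner x y"
  by (simp add: scaleR_scaleC cinner_scaleC_right)

lemma cinner_sum_left: "cinner (\<Sum>i\<in>I. f i) (y::'a::complex_inner) = (\<Sum>i\<in>I. cinner (f i) y)"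
  by (induction I rule: infinite_finite_induct) (simp_all add: cinner_add_left)

lemma cinner_sum_right: "cinner (y::'a::complex_inner) (\<Sum>i\<in>I. f i) = (\<Sum>i\<in>I. cinner y (f i))"
  by (induction I rule: infinite_finite_induct) (simp_all add: cinner_add_right)

lemmas cinner_simps = cinner_add_left cinner_add_right cinner_diff_left cinner_diff_right
  cinner_scaleC_left cinner_scaleC_right cinner_scaleR_left cinner_scaleR_right

lemma Re_cinner_self: "Re (cinner x (x::'a::complex_inner)) = (norm x)\<^sup>2"
  by (simp add: inner_eq_Re_cinner[symmetric] power2_norm_eq_inner)

lemma cinner_self: "cinner x (x::'a::complex_inner) = of_real ((norm x)\<^sup>2)"
proof -
  have "Im (cinner x x) = 0"
    using arg_cong[OF cinner_commute[of x x], of Im] by simp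
  then show ?thesis
    by (simp add: complex_eq_iff Re_cinner_self)
qed

lemma Re_cinner_commute: "Re (cinner (x::'a::complex_inner) y) = Re (cinner y x)"
  by (metis cinner_commute cnj.sel(1))

lemma norm_add_sq:
  "(norm (x + y))\<^sup>2 = (norm x)\<^sup>2 + 2 * Re (cinner x (y::'a::complex_inner)) + (norm y)\<^sup>2"
  unfolding Re_cinner_self[symmetric]
  by (simp add: cinner_simps Re_cinner_commute[of y x])

lemma norm_diff_sq:
  "(norm (x - y))\<^sup>2 = (norm x)\<^sup>2 - 2 * Re (cinner x (y::'a::complex_inner)) + (norm y)\<^sup>2"
  using norm_add_sq[of x "- y"] by simp

lemma parallelogram:
  "(norm (x + y))\<^sup>2 + (norm (x - (y::'a::complex_inner)))\<^sup>2 = 2 * (norm x)\<^sup>2 + 2 * (norm y)\<^sup>2"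
  by (simp add: norm_add_sq norm_diff_sq)

lemma pythagoras: "cinner x (y::'a::complex_inner) = 0 \<Longrightarrow> (norm (x + y))\<^sup>2 = (norm x)\<^sup>2 + (norm y)\<^sup>2"
  by (simp add: norm_add_sq)

lemma norm_cinner_le: "norm (cinner x (y::'a::complex_inner)) \<le> norm x * norm y"
proof (cases "cinner x y = 0")
  case False
  \<comment> \<open>Rotating \<open>x\<close> by the phase of the inner product reduces to the real inequality.\<close>
  define c where "c = cnj (sgn (cinner x y))"
  have "c * cinner x y = of_real (norm (cinner x y))"
  proof -
    have "cnj (sgn w) * w = of_real (norm w)" if "w \<noteq> 0" for w :: complex
    proof -
      have "cnj (sgn w) * w = (w * cnj w) / of_real (norm w)"
        by (simp add: sgn_eq mult.commute)
      also have "\<dots> = of_real (norm w)"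
        unfolding complex_norm_square[symmetric] using that by (simp add: power2_eq_square)
      finally show ?thesis .
    qed
    then show ?thesis using False by (simp add: c_def)
  qed
  then have "norm (cinner x y) = Re (cinner (c *\<^sub>C x) y)"
    by (simp add: cinner_scaleC_left)
  also have "\<dots> = inner (c *\<^sub>C x) y" by (simp add: inner_eq_Re_cinner)
  also have "\<dots> \<le> norm (c *\<^sub>C x) * norm y" by (rule norm_cauchy_schwarz)
  also have "norm (c *\<^sub>C x) = norm x"
    using False by (simp add: c_def norm_scaleC norm_sgn)
  finally show ?thesis .
qed auto

lemma bounded_bilinear_cinner: "bounded_bilinear (cinner :: 'a::complex_inner \<Rightarrow> 'a \<Rightarrow> complex)"
proof
  show "\<exists>K. \<forall>a b::'a. norm (cinner a b) \<le> norm a * norm b * K"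
  proof (intro exI allI)
    show "norm (cinner a b) \<le> norm a * norm b * 1" for a b :: 'a
      using norm_cinner_le[of a b] by simp
  qed
qed (simp_all only: cinner_simps scaleR_conv_of_real)

lemmas tendsto_cinner [tendsto_intros] = bounded_bilinear.tendsto[OF bounded_bilinear_cinner]

lemma bounded_bilinear_scaleC: "bounded_bilinear (scaleC :: complex \<Rightarrow> 'a::complex_normed_vector \<Rightarrow> 'a)"
proof
  show "\<exists>K. \<forall>a (b::'a). norm (a *\<^sub>C b) \<le> norm a * norm b * K"
    by (intro exI[of _ 1] allI) (simp add: norm_scaleC)
qed (simp_all add: scaleC_add_left scaleC_add_right scaleR_scaleC scaleC_scaleC
    scaleR_conv_of_real mult.commute)

lemmas tendsto_scaleC [tendsto_intros] = bounded_bilinear.tendsto[OF bounded_bilinear_scaleC]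
lemmas continuous_on_cinner [continuous_intros] = bounded_bilinear.continuous_on[OF bounded_bilinear_cinner]
lemmas continuous_on_scaleC [continuous_intros] = bounded_bilinear.continuous_on[OF bounded_bilinear_scaleC]

lemma cinner_right_eqI: "(\<And>z. cinner z x = cinner z y) \<Longrightarrow> x = (y::'a::complex_inner)"
proof -
  assume "\<And>z. cinner z x = cinner z y"
  then have "cinner (x - y) (x - y) = 0" by (simp add: cinner_diff_right)
  then show ?thesis by (simp add: cinner_self)
qed

lemma cinner_left_eqI: "(\<And>z. cinner x z = cinner y z) \<Longrightarrow> x = (y::'a::complex_inner)"
  by (rule cinner_right_eqI) (metis cinner_commute)

instance complex_hilbert_space \<subseteq> banach ..

subsection \<open>The operators in \<open>BH\<close>\<close>

lemma BH_scaleC: "T \<in> BH \<Longrightarrow> blinfun_apply T (c *\<^sub>C x) = c *\<^sub>C blinfun_apply T x"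
  by (simp add: BH_def)

lemma BH_0 [simp]: "0 \<in> BH" by (simp add: BH_def)
lemma BH_add [simp]: "S \<in> BH \<Longrightarrow> T \<in> BH \<Longrightarrow> S + T \<in> BH"
  by (simp add: BH_def blinfun.add_left scaleC_add_right)
lemma BH_minus [simp]: "S \<in> BH \<Longrightarrow> - S \<in> BH"
  by (simp add: BH_def blinfun.minus_left)
lemma BH_diff [simp]: "S \<in> BH \<Longrightarrow> T \<in> BH \<Longrightarrow> S - T \<in> BH"
  by (simp add: BH_def blinfun.diff_left scaleC_diff_right)
lemma BH_cscale [simp]: "S \<in> BH \<Longrightarrow> c *\<^sub>C S \<in> BH"
  by (simp add: BH_def scaleC_blinfun.rep_eq scaleC_scaleC mult.commute)
lemma BH_rscale [simp]: "S \<in> BH \<Longrightarrow> r *\<^sub>R S \<in> BH"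
  by (simp add: scaleR_scaleC)
lemma BH_comp [simp]: "S \<in> BH \<Longrightarrow> T \<in> BH \<Longrightarrow> S o\<^sub>L T \<in> BH"
  by (simp add: BH_def)
lemma BH_id [simp]: "id_blinfun \<in> BH" by (simp add: BH_def)
lemma BH_sum [simp]: "(\<And>i. i \<in> I \<Longrightarrow> f i \<in> BH) \<Longrightarrow> (\<Sum>i\<in>I. f i) \<in> BH"
  by (induction I rule: infinite_finite_induct) simp_all

lemmas apply_simps = blinfun.add_left blinfun.diff_left blinfun.minus_left blinfun.scaleR_left
  blinfun.zero_left blinfun.add_right blinfun.diff_right blinfun.minus_right
  blinfun.scaleR_right blinfun.zero_right scaleC_blinfun.rep_eq

lemma norm_scaleC_blinfun: "norm (c *\<^sub>C (T::'a::complex_hilbert_space \<Rightarrow>\<^sub>L 'a)) = norm c * norm T"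
proof (rule antisym)
  have le: "norm (d *\<^sub>C S) \<le> norm d * norm S" for d and S :: "'a \<Rightarrow>\<^sub>L 'a"
    by (rule norm_blinfun_bound)
       (auto simp: scaleC_blinfun.rep_eq norm_scaleC mult.assoc intro!: mult_left_mono norm_blinfun)
  show "norm (c *\<^sub>C T) \<le> norm c * norm T" by (rule le)
  show "norm c * norm T \<le> norm (c *\<^sub>C T)"
  proof (cases "c = 0")
    case False
    then show ?thesis
      using le[of "inverse c" "c *\<^sub>C T"]
      by (simp add: scaleC_scaleC norm_divide inverse_eq_divide pos_le_divide_eq mult.commute)
  qed simp
qed

lemma closed_BH: "closed (BH :: ('a::complex_hilbert_space \<Rightarrow>\<^sub>L 'a) set)"
proof -
  have "BH = (\<Inter>c. \<Inter>x. {T :: 'a \<Rightarrow>\<^sub>L 'a. blinfun_apply T (c *\<^sub>C x) = c *\<^sub>C blinfun_apply T x})"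
    by (auto simp: BH_def)
  also have "closed \<dots>"
    by (intro closed_INT ballI closed_Collect_eq continuous_intros)
  finally show ?thesis .
qed

definition rank_one :: "'a::complex_hilbert_space \<Rightarrow> 'a \<Rightarrow> ('a \<Rightarrow>\<^sub>L 'a)" where
  "rank_one x y = Blinfun (\<lambda>z. cinner z y *\<^sub>C x)"

lemma rank_one_apply: "rank_one x y z = cinner z y *\<^sub>C x"
proof -
  have "bounded_linear (\<lambda>z. cinner z y *\<^sub>C x)"
    by (intro bounded_linear_compose[OF bounded_bilinear.bounded_linear_left[OF bounded_bilinear_scaleC]]
        bounded_bilinear.bounded_linear_left[OF bounded_bilinear_cinner])
  then show ?thesis by (simp add: rank_one_def bounded_linear_Blinfun_apply)
qed

lemma rank_one_BH [simp]: "rank_one x y \<in> BH"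
  by (simp add: BH_def rank_one_apply cinner_scaleC_left scaleC_scaleC)

lemma rank_one_add_left: "rank_one (x + x') y = rank_one x y + rank_one x' y"
  by (rule blinfun_eqI) (simp add: rank_one_apply apply_simps scaleC_add_right)
lemma rank_one_add_right: "rank_one x (y + y') = rank_one x y + rank_one x y'"
  by (rule blinfun_eqI) (simp add: rank_one_apply apply_simps cinner_add_right scaleC_add_left)
lemma rank_one_diff_left: "rank_one (x - x') y = rank_one x y - rank_one x' y"
  by (rule blinfun_eqI) (simp add: rank_one_apply apply_simps scaleC_diff_right)
lemma rank_one_scaleC_left: "rank_one (c *\<^sub>C x) y = c *\<^sub>C rank_one x y"
  by (rule blinfun_eqI) (simp add: rank_one_apply apply_simps scaleC_scaleC mult.commute)
lemma rank_one_scaleC_right: "rank_one x (c *\<^sub>C y) = cnj c *\<^sub>C rank_one x y"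
  by (rule blinfun_eqI) (simp add: rank_one_apply apply_simps cinner_scaleC_right scaleC_scaleC)
lemma rank_one_zero_left [simp]: "rank_one 0 y = 0"
  by (rule blinfun_eqI) (simp add: rank_one_apply)
lemma rank_one_zero_right [simp]: "rank_one x 0 = 0"
  by (rule blinfun_eqI) (simp add: rank_one_apply)

lemma norm_rank_one_le: "norm (rank_one x y) \<le> norm x * norm y"
proof (rule norm_blinfun_bound)
  fix z
  show "norm (rank_one x y z) \<le> norm x * norm y * norm z"
    using mult_right_mono[OF norm_cinner_le[of z y], of "norm x"]
    by (simp add: rank_one_apply norm_scaleC ac_simps)
qed simp

lemma rank_one_eq_0_iff: "rank_one x y = 0 \<longleftrightarrow> x = 0 \<or> y = 0"
proof
  assume "rank_one x y = 0"
  then have "rank_one x y y = 0" by simp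
  then have "norm (cinner y y) * norm x = 0" by (simp add: rank_one_apply norm_scaleC[symmetric])
  then show "x = 0 \<or> y = 0" by (auto simp: cinner_self)
qed auto

lemma bounded_bilinear_rank_one: "bounded_bilinear rank_one"
proof
  show "\<exists>K. \<forall>x y::'a. norm (rank_one x y) \<le> norm x * norm y * K"
    by (intro exI[of _ 1] allI) (simp add: norm_rank_one_le)
qed (simp_all add: rank_one_add_left rank_one_add_right rank_one_scaleC_left rank_one_scaleC_right scaleR_scaleC)

lemmas tendsto_rank_one [tendsto_intros] = bounded_bilinear.tendsto[OF bounded_bilinear_rank_one]

lemma comp_rank_one: "A \<in> BH \<Longrightarrow> A o\<^sub>L rank_one x y = rank_one (A x) y"
  by (rule blinfun_eqI) (simp add: rank_one_apply BH_scaleC)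

subsection \<open>Closed subspaces and projections\<close>

definition complex_subspace :: "'a::complex_hilbert_space set \<Rightarrow> bool" where
  "complex_subspace M \<longleftrightarrow> 0 \<in> M \<and> (\<forall>x\<in>M. \<forall>y\<in>M. x + y \<in> M) \<and> (\<forall>c. \<forall>x\<in>M. c *\<^sub>C x \<in> M)"

lemma complex_subspaceD:
  assumes "complex_subspace M"
  shows "0 \<in> M" "x \<in> M \<Longrightarrow> y \<in> M \<Longrightarrow> x + y \<in> M" "x \<in> M \<Longrightarrow> c *\<^sub>C x \<in> M"
    "x \<in> M \<Longrightarrow> r *\<^sub>R x \<in> M" "x \<in> M \<Longrightarrow> y \<in> M \<Longrightarrow> x - y \<in> M"
proof -
  show *: "0 \<in> M" "x \<in> M \<Longrightarrow> y \<in> M \<Longrightarrow> x + y \<in> M" "x \<in> M \<Longrightarrow> c *\<^sub>C x \<in> M" for x y c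
    using assms by (auto simp: complex_subspace_def)
  show "x \<in> M \<Longrightarrow> r *\<^sub>R x \<in> M" by (simp add: scaleR_scaleC *)
  show "x \<in> M \<Longrightarrow> y \<in> M \<Longrightarrow> x - y \<in> M"
    using *(2)[of x "- y"] *(3)[of y "- 1"] by (simp add: scaleC_minus_one)
qed

lemma complex_subspace_sum: "complex_subspace M \<Longrightarrow> (\<And>i. i \<in> I \<Longrightarrow> f i \<in> M) \<Longrightarrow> sum f I \<in> M"
  by (induction I rule: infinite_finite_induct) (auto simp: complex_subspaceD)

lemma complex_subspace_UNIV [simp]: "complex_subspace UNIV" by (simp add: complex_subspace_def)

lemma complex_subspace_closure:
  assumes "complex_subspace M" shows "complex_subspace (closure M)"
  unfolding complex_subspace_def
proof (intro conjI ballI allI)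
  show "0 \<in> closure M" using complex_subspaceD(1)[OF assms] closure_subset by blast
next
  fix x y assume "x \<in> closure M" "y \<in> closure M"
  then obtain f g where "\<forall>n. f n \<in> M" "f \<longlonglongrightarrow> x" "\<forall>n. g n \<in> M" "g \<longlonglongrightarrow> y"
    by (auto simp: closure_sequential)
  then show "x + y \<in> closure M"
    using complex_subspaceD(2)[OF assms] by (auto simp: closure_sequential intro!: exI[of _ "\<lambda>n. f n + g n"] tendsto_add)
next
  fix c x assume "x \<in> closure M"
  then obtain f where "\<forall>n. f n \<in> M" "f \<longlonglongrightarrow> x" by (auto simp: closure_sequential)
  then show "c *\<^sub>C x \<in> closure M"
    using complex_subspaceD(3)[OF assms] tendsto_scaleC[OF tendsto_const[of c] \<open>f \<longlonglongrightarrow> x\<close>]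
    by (auto simp: closure_sequential intro!: exI[of _ "\<lambda>n. c *\<^sub>C f n"])
qed

text \<open>A minimising sequence for the distance to a closed subspace is Cauchy by the parallelogram
  law; its limit is the foot of the perpendicular, because moving away from it along the
  subspace cannot decrease the distance.\<close>

lemma projection_exists:
  fixes x :: "'a::complex_hilbert_space"
  assumes M: "complex_subspace M" "closed M"
  shows "\<exists>p\<in>M. \<forall>m\<in>M. cinner (x - p) m = 0"
proof -
  define d where "d = infdist x M"
  have ne: "M \<noteq> {}" using complex_subspaceD(1)[OF M(1)] by blast
  have d0: "0 \<le> d" by (simp add: d_def infdist_nonneg)
  have dle: "d \<le> norm (x - m)" if "m \<in> M" for m
    using infdist_le[OF that, of x] by (simp add: d_def dist_norm)
  have "\<exists>m\<in>M. norm (x - m) < d + 1 / Suc n" for n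
  proof (rule ccontr)
    assume "\<not> ?thesis"
    then have "d + 1 / Suc n \<le> dist x m" if "m \<in> M" for m
      using that by (force simp: dist_norm not_less)
    then have "d + 1 / Suc n \<le> d"
      unfolding d_def infdist_notempty[OF ne] by (intro cINF_greatest ne) (simp add: d_def infdist_notempty[OF ne])
    then show False by simp
  qed
  then obtain f where f: "\<And>n. f n \<in> M" "\<And>n. norm (x - f n) < d + 1 / Suc n" by metis
  have par: "(norm (f m - f n))\<^sup>2 \<le> 4 * (2 * d + 1) * (1 / Suc N)" if "m \<ge> N" "n \<ge> N" for m n N
  proof -
    let ?a = "x - f m" and ?b = "x - f n"
    have "(norm (?a + ?b))\<^sup>2 + (norm (?a - ?b))\<^sup>2 = 2 * (norm ?a)\<^sup>2 + 2 * (norm ?b)\<^sup>2"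
      by (rule parallelogram)
    moreover have "norm (?a + ?b) \<ge> 2 * d"
    proof -
      have "?a + ?b = 2 *\<^sub>R (x - (1/2) *\<^sub>R (f m + f n))" by (simp add: algebra_simps scaleR_2)
      then have "norm (?a + ?b) = 2 * norm (x - (1/2) *\<^sub>R (f m + f n))" by simp
      moreover have "(1/2) *\<^sub>R (f m + f n) \<in> M" using f(1) by (intro complex_subspaceD[OF M(1)])
      ultimately show ?thesis using dle by simp
    qed
    then have "(norm (?a + ?b))\<^sup>2 \<ge> (2 * d)\<^sup>2" using d0 by (intro power_mono) auto
    then have "(norm (?a + ?b))\<^sup>2 \<ge> 4 * d\<^sup>2" by (simp add: power_mult_distrib)
    moreover have sq: "(norm (x - f k))\<^sup>2 \<le> d\<^sup>2 + (2 * d + 1) * (1 / Suc N)" if "k \<ge> N" for k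
    proof -
      define e where "e = 1 / real (Suc N)"
      have e: "0 < e" "e \<le> 1" by (auto simp: e_def)
      have "1 / real (Suc k) \<le> e" using that by (simp add: e_def frac_le)
      then have "norm (x - f k) \<le> d + e" using f(2)[of k] by linarith
      then have "(norm (x - f k))\<^sup>2 \<le> (d + e)\<^sup>2" by (intro power_mono) auto
      also have "\<dots> = d\<^sup>2 + 2 * d * e + e * e" by (simp add: power2_eq_square algebra_simps)
      also have "\<dots> \<le> d\<^sup>2 + 2 * d * e + e * 1" using e by (intro add_left_mono mult_left_mono) auto
      also have "\<dots> = d\<^sup>2 + (2 * d + 1) * e" by (simp add: algebra_simps)
      finally show ?thesis by (simp add: e_def)
    qed
    ultimately have "(norm (?a - ?b))\<^sup>2 \<le> 4 * ((2 * d + 1) * (1 / Suc N))"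
      using sq[OF that(1)] sq[OF that(2)] by linarith
    then show ?thesis by (simp add: norm_minus_commute)
  qed
  have "Cauchy f"
  proof (rule CauchyI)
    fix e :: real assume e: "0 < e"
    obtain N where N: "4 * (2 * d + 1) / e\<^sup>2 < real (Suc N)"
      using reals_Archimedean2[of "4 * (2 * d + 1) / e\<^sup>2"] by (meson less_trans lessI of_nat_less_iff)
    have "norm (f m - f n) < e" if "m \<ge> N" "n \<ge> N" for m n
    proof -
      have "4 * (2 * d + 1) * (1 / Suc N) < e\<^sup>2" using N e by (simp add: field_simps)
      then have "(norm (f m - f n))\<^sup>2 < e\<^sup>2" using par[OF that] by linarith
      then show ?thesis using e by (simp add: power2_less_imp_less)
    qed
    then show "\<exists>N. \<forall>m\<ge>N. \<forall>n\<ge>N. norm (f m - f n) < e" by blast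
  qed
  then obtain p where p: "f \<longlonglongrightarrow> p" by (auto simp: Cauchy_convergent_iff convergent_def)
  have pM: "p \<in> M" using closed_sequentially[OF M(2) _ p] f(1) by blast
  have "norm (x - p) \<le> d"
  proof (rule LIMSEQ_le)
    show "(\<lambda>n. norm (x - f n)) \<longlonglongrightarrow> norm (x - p)" by (intro tendsto_intros p)
    show "(\<lambda>n. d + 1 / Suc n) \<longlonglongrightarrow> d"
      using tendsto_add[OF tendsto_const[of d] lim_1_over_n[THEN LIMSEQ_Suc]] by simp
    show "\<exists>N. \<forall>n\<ge>N. norm (x - f n) \<le> d + 1 / Suc n" using f(2) less_imp_le by blast
  qed
  then have pmin: "norm (x - p) \<le> norm (x - m)" if "m \<in> M" for m using dle[OF that] by linarith
  have "cinner (x - p) m = 0" if m: "m \<in> M" for m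
  proof (cases "m = 0")
    case False
    define c where "c = cinner (x - p) m / of_real ((norm m)\<^sup>2)"
    have "p + c *\<^sub>C m \<in> M" using pM m by (intro complex_subspaceD[OF M(1)])
    then have "norm (x - p) \<le> norm ((x - p) - c *\<^sub>C m)" using pmin by (simp add: algebra_simps)
    then have "(norm (x - p))\<^sup>2 \<le> (norm ((x - p) - c *\<^sub>C m))\<^sup>2" by (intro power_mono) auto
    moreover have "Re (cinner (x - p) (c *\<^sub>C m)) = (norm c)\<^sup>2 * (norm m)\<^sup>2"
    proof -
      have "cinner (x - p) m = c * of_real ((norm m)\<^sup>2)"
        using False by (simp add: c_def)
      then have "cinner (x - p) (c *\<^sub>C m) = (c * cnj c) * of_real ((norm m)\<^sup>2)"
        by (simp only: cinner_scaleC_right ac_simps)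
      also have "\<dots> = of_real ((norm c)\<^sup>2 * (norm m)\<^sup>2)"
        by (simp only: complex_norm_square[symmetric] of_real_mult)
      finally show ?thesis by (simp only: Re_complex_of_real)
    qed
    ultimately have "(norm c)\<^sup>2 * (norm m)\<^sup>2 \<le> 0"
      unfolding norm_diff_sq[of "x - p" "c *\<^sub>C m"] norm_scaleC power_mult_distrib by linarith
    then have "c = 0" using False by (simp add: mult_le_0_iff)
    then show ?thesis using False by (simp add: c_def)
  qed simp
  then show ?thesis using pM by blast
qed

definition foot :: "'a::complex_hilbert_space set \<Rightarrow> 'a \<Rightarrow> 'a" where
  "foot M x = (SOME p. p \<in> M \<and> (\<forall>m\<in>M. cinner (x - p) m = 0))"

definition proj :: "'a::complex_hilbert_space set \<Rightarrow> ('a \<Rightarrow>\<^sub>L 'a)" where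
  "proj M = Blinfun (foot M)"

locale closed_subspace =
  fixes M :: "'a::complex_hilbert_space set"
  assumes complex_subspace: "complex_subspace M" and closed: "closed M"
begin

lemma foot_unique:
  assumes "p \<in> M" "\<forall>m\<in>M. cinner (x - p) m = 0" "q \<in> M" "\<forall>m\<in>M. cinner (x - q) m = 0"
  shows "p = q"
proof -
  have d: "p - q \<in> M" using complex_subspaceD(5)[OF complex_subspace] assms by blast
  have "cinner (p - q) (p - q) = cinner (x - q) (p - q) - cinner (x - p) (p - q)"
    by (simp add: cinner_diff_left)
  also have "\<dots> = 0" using assms d by simp
  finally show ?thesis by (simp add: cinner_self)
qed

lemma foot: "foot M x \<in> M \<and> (\<forall>m\<in>M. cinner (x - foot M x) m = 0)"
  unfolding foot_def by (rule someI_ex) (use projection_exists[OF complex_subspace closed] in blast)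

lemma foot_eq: "p \<in> M \<Longrightarrow> \<forall>m\<in>M. cinner (x - p) m = 0 \<Longrightarrow> foot M x = p"
  using foot_unique foot by blast

lemma bounded_linear_foot: "bounded_linear (foot M)"
proof (rule bounded_linear_intro[where K = 1])
  fix x y :: 'a and r :: real
  show "foot M (x + y) = foot M x + foot M y"
  proof (rule foot_eq)
    show "foot M x + foot M y \<in> M" using foot complex_subspaceD(2)[OF complex_subspace] by blast
    have "x + y - (foot M x + foot M y) = (x - foot M x) + (y - foot M y)" by simp
    then show "\<forall>m\<in>M. cinner (x + y - (foot M x + foot M y)) m = 0"
      using foot by (simp only: cinner_add_left) simp
  qed
  show "foot M (r *\<^sub>R x) = r *\<^sub>R foot M x"
  proof (rule foot_eq)
    show "r *\<^sub>R foot M x \<in> M" using foot complex_subspaceD(4)[OF complex_subspace] by blast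
    show "\<forall>m\<in>M. cinner (r *\<^sub>R x - r *\<^sub>R foot M x) m = 0"
      using foot by (simp only: scaleR_diff_right[symmetric] cinner_scaleR_left) simp
  qed
  have "cinner (x - foot M x) (foot M x) = 0" using foot by blast
  from pythagoras[OF this] have "(norm x)\<^sup>2 = (norm (x - foot M x))\<^sup>2 + (norm (foot M x))\<^sup>2"
    by (simp only: diff_add_cancel)
  then have "(norm (foot M x))\<^sup>2 \<le> (norm x)\<^sup>2"
    using zero_le_power2[of "norm (x - foot M x)"] by linarith
  then show "norm (foot M x) \<le> norm x * 1"
    unfolding mult_1_right by (rule power2_le_imp_le) (rule norm_ge_zero)
qed

lemma proj_apply: "blinfun_apply (proj M) = foot M"
  by (simp add: proj_def bounded_linear_Blinfun_apply[OF bounded_linear_foot])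

lemma proj_in: "proj M x \<in> M"
  and proj_orth: "m \<in> M \<Longrightarrow> cinner (x - proj M x) m = 0"
  unfolding proj_apply using foot by blast+

lemma proj_eqI: "p \<in> M \<Longrightarrow> (\<And>m. m \<in> M \<Longrightarrow> cinner (x - p) m = 0) \<Longrightarrow> proj M x = p"
  using foot_unique proj_in proj_orth by blast

lemma proj_id: "x \<in> M \<Longrightarrow> proj M x = x"
  by (rule proj_eqI) auto

lemma proj_id_iff: "proj M x = x \<longleftrightarrow> x \<in> M"
  using proj_id proj_in by metis

lemma proj_eq_0: "(\<And>m. m \<in> M \<Longrightarrow> cinner x m = 0) \<Longrightarrow> proj M x = 0"
  by (rule proj_eqI) (use complex_subspaceD(1)[OF complex_subspace] in auto)

lemma proj_adjoint: "cinner (proj M x) y = cinner x (proj M y)"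
proof -
  have "cinner (x - proj M x) (proj M y) = 0" "cinner (y - proj M y) (proj M x) = 0"
    using proj_orth proj_in by blast+
  then have "cinner x (proj M y) = cinner (proj M x) (proj M y)"
    "cinner y (proj M x) = cinner (proj M y) (proj M x)"
    by (simp_all add: cinner_diff_left)
  then show ?thesis by (metis cinner_commute)
qed

lemma proj_BH: "proj M \<in> BH"
  unfolding BH_def
proof (intro CollectI allI)
  fix c x
  show "proj M (c *\<^sub>C x) = c *\<^sub>C proj M x"
    by (rule proj_eqI)
       (auto simp: proj_in proj_orth complex_subspaceD(3)[OF complex_subspace] scaleC_diff_right[symmetric] cinner_scaleC_left)
qed

lemma proj_idem: "proj M o\<^sub>L proj M = proj M"
  by (rule blinfun_eqI) (simp add: proj_id proj_in)

end

subsection \<open>Adjoints\<close>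

lemma riesz:
  fixes f :: "'a::complex_hilbert_space \<Rightarrow> complex"
  assumes f: "bounded_linear f" and fC: "\<And>c x. f (c *\<^sub>C x) = c * f x"
  shows "\<exists>y. \<forall>x. f x = cinner x y"
proof (cases "\<forall>x. f x = 0")
  case False
  then obtain x0 where x0: "f x0 \<noteq> 0" by blast
  define K where "K = {x. f x = 0}"
  interpret bounded_linear f by fact
  interpret K: closed_subspace K
  proof
    show "complex_subspace K" by (simp add: K_def complex_subspace_def add zero fC)
    show "closed K"
      unfolding K_def by (rule closed_Collect_eq[OF linear_continuous_on[OF f] continuous_on_const])
  qed
  define z where "z = x0 - proj K x0"
  have z: "cinner z m = 0" if "f m = 0" for m
    using K.proj_orth[of m x0] that by (simp add: z_def K_def)
  have fz: "f z = f x0" using K.proj_in[of x0] by (simp add: z_def diff K_def)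
  then have z0: "z \<noteq> 0" using x0 zero by auto
  have "f x = cinner x ((cnj (f z) / of_real ((norm z)\<^sup>2)) *\<^sub>C z)" for x
  proof -
    have "f (x - (f x / f z) *\<^sub>C z) = 0" using x0 by (simp add: diff fC fz)
    then have "cinner (x - (f x / f z) *\<^sub>C z) z = 0" using z cinner_commute by (metis complex_cnj_zero)
    then have "cinner x z = (f x / f z) * of_real ((norm z)\<^sup>2)"
      by (simp add: cinner_diff_left cinner_scaleC_left cinner_self)
    then show ?thesis using x0 z0 fz by (simp add: cinner_scaleC_right)
  qed
  then show ?thesis by blast
next
  case True
  then show ?thesis by (intro exI[of _ 0]) simp
qed

definition adj :: "('a::complex_hilbert_space \<Rightarrow>\<^sub>L 'a) \<Rightarrow> ('a \<Rightarrow>\<^sub>L 'a)" where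
  "adj T = (SOME B. is_adjoint T B)"

lemma is_adjoint_adj:
  fixes T :: "'a::complex_hilbert_space \<Rightarrow>\<^sub>L 'a"
  assumes T: "T \<in> BH" shows "is_adjoint T (adj T)"
proof -
  have "\<exists>w. \<forall>x. cinner (T x) y = cinner x w" for y
  proof (rule riesz)
    show "bounded_linear (\<lambda>x. cinner (T x) y)"
      by (rule bounded_linear_compose[OF bounded_bilinear.bounded_linear_left[OF bounded_bilinear_cinner]
            blinfun.bounded_linear_right])
  qed (simp add: BH_scaleC[OF T] cinner_scaleC_left)
  then obtain g where g: "\<And>x y. cinner (T x) y = cinner x (g y)" by metis
  have "bounded_linear g"
  proof (rule bounded_linear_intro[where K = "norm T"])
    fix x y :: 'a and r :: real
    show "g (x + y) = g x + g y"
      by (rule cinner_right_eqI) (simp add: g[symmetric] cinner_add_right)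
    show "g (r *\<^sub>R x) = r *\<^sub>R g x"
      by (rule cinner_right_eqI) (simp add: g[symmetric] cinner_scaleR_right)
    have "(norm (g x))\<^sup>2 = norm (cinner (T (g x)) x)"
      by (simp add: g cinner_self norm_power)
    also have "\<dots> \<le> norm (T (g x)) * norm x" by (rule norm_cinner_le)
    also have "\<dots> \<le> (norm T * norm (g x)) * norm x" by (intro mult_right_mono norm_blinfun) simp
    finally have "norm (g x) * norm (g x) \<le> norm (g x) * (norm x * norm T)"
      by (simp add: power2_eq_square ac_simps)
    then show "norm (g x) \<le> norm x * norm T"
      by (cases "g x = 0") (auto simp: mult_le_cancel_left)
  qed
  then have "is_adjoint T (Blinfun g)"
    by (simp add: is_adjoint_def bounded_linear_Blinfun_apply g)
  then show ?thesis unfolding adj_def by (rule someI)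
qed

lemma cinner_adj: "T \<in> BH \<Longrightarrow> cinner (blinfun_apply T x) y = cinner x (adj T y)"
  using is_adjoint_adj[of T] unfolding is_adjoint_def by blast

lemma cinner_adj': "T \<in> BH \<Longrightarrow> cinner (adj T x) y = cinner x (blinfun_apply T y)"
  by (metis cinner_adj cinner_commute)

lemma adjI:
  assumes "T \<in> BH" and B: "\<And>x y. cinner (blinfun_apply T x) y = cinner x (blinfun_apply B y)"
  shows "adj T = B"
proof (rule blinfun_eqI, rule cinner_right_eqI)
  fix y z
  show "cinner z (adj T y) = cinner z (B y)"
    unfolding B[symmetric] by (rule cinner_adj[OF assms(1), symmetric])
qed

lemma adj_BH [simp]: "T \<in> BH \<Longrightarrow> adj T \<in> BH"
proof -
  assume T: "T \<in> BH"
  have "adj T (c *\<^sub>C x) = c *\<^sub>C adj T x" for c x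
    by (rule cinner_right_eqI) (simp add: cinner_adj[OF T, symmetric] cinner_scaleC_right)
  then show ?thesis by (simp add: BH_def)
qed

lemma adj_adj [simp]: "T \<in> BH \<Longrightarrow> adj (adj T) = T"
  by (rule adjI) (simp_all only: cinner_adj' adj_BH)

lemma adj_add: "S \<in> BH \<Longrightarrow> T \<in> BH \<Longrightarrow> adj (S + T) = adj S + adj T"
  by (rule adjI) (simp_all add: apply_simps cinner_add_left cinner_add_right cinner_adj)
lemma adj_diff: "S \<in> BH \<Longrightarrow> T \<in> BH \<Longrightarrow> adj (S - T) = adj S - adj T"
  by (rule adjI) (simp_all add: apply_simps cinner_diff_left cinner_diff_right cinner_adj)
lemma adj_cscale: "T \<in> BH \<Longrightarrow> adj (c *\<^sub>C T) = cnj c *\<^sub>C adj T"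
  by (rule adjI) (simp_all add: apply_simps cinner_scaleC_left cinner_scaleC_right cinner_adj)
lemma adj_comp: "S \<in> BH \<Longrightarrow> T \<in> BH \<Longrightarrow> adj (S o\<^sub>L T) = adj T o\<^sub>L adj S"
  by (rule adjI) (simp_all add: cinner_adj)
lemma adj_id: "adj id_blinfun = id_blinfun"
  by (rule adjI) simp_all
lemma adj_rank_one: "adj (rank_one x y) = rank_one y x"
  by (rule adjI) (simp_all add: rank_one_apply cinner_scaleC_left cinner_scaleC_right,
      metis cinner_commute mult.commute)

lemma (in closed_subspace) adj_proj: "adj (proj M) = proj M"
  by (rule adjI) (simp_all add: proj_BH proj_adjoint)

lemma norm_adj_le: "T \<in> BH \<Longrightarrow> norm (adj T) \<le> norm T"
proof (rule norm_blinfun_bound)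
  fix x assume T: "T \<in> BH"
  have "(norm (adj T x))\<^sup>2 = norm (cinner (T (adj T x)) x)"
    by (simp add: cinner_adj T cinner_self norm_power)
  also have "\<dots> \<le> norm (T (adj T x)) * norm x" by (rule norm_cinner_le)
  also have "\<dots> \<le> (norm T * norm (adj T x)) * norm x" by (intro mult_right_mono norm_blinfun) simp
  finally have "norm (adj T x) * norm (adj T x) \<le> norm (adj T x) * (norm T * norm x)"
    by (simp add: power2_eq_square ac_simps)
  then show "norm (adj T x) \<le> norm T * norm x"
    by (cases "adj T x = 0") (auto simp: mult_le_cancel_left)
qed simp

lemma norm_adj: "T \<in> BH \<Longrightarrow> norm (adj T) = norm T"
  using norm_adj_le[of T] norm_adj_le[of "adj T"] by simp

lemma rank_one_comp: "B \<in> BH \<Longrightarrow> rank_one x y o\<^sub>L B = rank_one x (adj B y)"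
  by (rule blinfun_eqI) (simp add: rank_one_apply cinner_adj)

section \<open>Maximal abelian selfadjoint algebras\<close>

definition commutant :: "('a::complex_hilbert_space \<Rightarrow>\<^sub>L 'a) set \<Rightarrow> ('a \<Rightarrow>\<^sub>L 'a) set" where
  "commutant S = {B\<in>BH. \<forall>A\<in>S. A o\<^sub>L B = B o\<^sub>L A}"

lemma commutant_adj:
  assumes S: "S \<subseteq> BH" "\<And>A. A \<in> S \<Longrightarrow> adj A \<in> S" and B: "B \<in> commutant S"
  shows "adj B \<in> commutant S"
  unfolding commutant_def
proof (intro CollectI conjI ballI)
  have BB: "B \<in> BH" using B by (simp add: commutant_def)
  then show "adj B \<in> BH" by simp
  fix A assume A: "A \<in> S"
  then have AB: "A \<in> BH" using S(1) by blast
  have "adj A o\<^sub>L B = B o\<^sub>L adj A" using B S(2)[OF A] by (simp add: commutant_def)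
  then have "adj (adj A o\<^sub>L B) = adj (B o\<^sub>L adj A)" by simp
  then show "A o\<^sub>L adj B = adj B o\<^sub>L A" by (simp add: adj_comp AB BB)
qed

lemma blinfun_comp_bilin:
  "(A + B) o\<^sub>L C = (A o\<^sub>L C) + (B o\<^sub>L C)" "A o\<^sub>L (B + C) = (A o\<^sub>L B) + (A o\<^sub>L C)"
  "(A - B) o\<^sub>L C = (A o\<^sub>L C) - (B o\<^sub>L C)" "A o\<^sub>L (B - C) = (A o\<^sub>L B) - (A o\<^sub>L C)"
  "(- A) o\<^sub>L C = - (A o\<^sub>L C)" "A o\<^sub>L (- C) = - (A o\<^sub>L C)"
  "(r *\<^sub>R A) o\<^sub>L C = r *\<^sub>R (A o\<^sub>L C)" "A o\<^sub>L (r *\<^sub>R C) = r *\<^sub>R (A o\<^sub>L C)"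
  by (rule blinfun_eqI, simp add: apply_simps)+

lemma comp_assoc: "(A o\<^sub>L B) o\<^sub>L C = A o\<^sub>L (B o\<^sub>L C)"
  by (rule blinfun_eqI) simp

lemma id_comp [simp]: "id_blinfun o\<^sub>L A = A" "A o\<^sub>L id_blinfun = A"
  by (rule blinfun_eqI, simp)+

lemma scaleC_comp: "(c *\<^sub>C A) o\<^sub>L B = c *\<^sub>C (A o\<^sub>L B)"
  by (rule blinfun_eqI) (simp add: apply_simps)

lemma comp_scaleC: "A \<in> BH \<Longrightarrow> A o\<^sub>L (c *\<^sub>C B) = c *\<^sub>C (A o\<^sub>L B)"
  by (rule blinfun_eqI) (simp add: apply_simps BH_scaleC)

locale masa_algebra =
  fixes D :: "('a::complex_hilbert_space \<Rightarrow>\<^sub>L 'a) set"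
  assumes masa: "masa D"
begin

lemma
  shows D_BH: "A \<in> D \<Longrightarrow> A \<in> BH"
    and D_zero: "0 \<in> D"
    and D_add: "A \<in> D \<Longrightarrow> B \<in> D \<Longrightarrow> A + B \<in> D"
    and D_cscale: "A \<in> D \<Longrightarrow> c *\<^sub>C A \<in> D"
    and D_comp: "A \<in> D \<Longrightarrow> B \<in> D \<Longrightarrow> A o\<^sub>L B \<in> D"
    and D_commute: "A \<in> D \<Longrightarrow> B \<in> D \<Longrightarrow> A o\<^sub>L B = B o\<^sub>L A"
    and D_maximal: "abelian_selfadjoint_algebra E \<Longrightarrow> D \<subseteq> E \<Longrightarrow> E = D"
  using masa unfolding masa_def abelian_selfadjoint_algebra_def by blast+

lemma D_adj: "A \<in> D \<Longrightarrow> adj A \<in> D"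
proof -
  assume A: "A \<in> D"
  then obtain B where B: "B \<in> D" "is_adjoint A B"
    using masa unfolding masa_def abelian_selfadjoint_algebra_def by blast
  have "adj A = B"
    by (rule adjI) (use A B D_BH in \<open>auto simp: is_adjoint_def\<close>)
  then show ?thesis using B by simp
qed

lemma D_minus: "A \<in> D \<Longrightarrow> - A \<in> D"
proof -
  assume "A \<in> D"
  moreover have "- A = (-1) *\<^sub>C A" by (rule blinfun_eqI) (simp add: apply_simps scaleC_minus_one)
  ultimately show ?thesis using D_cscale[of A "-1"] by simp
qed

lemma D_diff: "A \<in> D \<Longrightarrow> B \<in> D \<Longrightarrow> A - B \<in> D"
  using D_add[of A "- B"] D_minus[of B] by simp

lemma D_rscale: "A \<in> D \<Longrightarrow> r *\<^sub>R A \<in> D"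
  by (simp add: scaleR_scaleC D_cscale)

text \<open>The bicommutant of a commuting selfadjoint set is abelian, so adjoining to \<open>D\<close> a
  selfadjoint operator that commutes with it stays inside an abelian selfadjoint algebra.\<close>

lemma selfadjoint_commuting_mem:
  assumes T: "T \<in> BH" "adj T = T" and c: "\<And>A. A \<in> D \<Longrightarrow> A o\<^sub>L T = T o\<^sub>L A"
  shows "T \<in> D"
proof -
  define S where "S = insert T D"
  have S: "S \<subseteq> BH" "\<And>A. A \<in> S \<Longrightarrow> adj A \<in> S"
    using T D_BH D_adj by (auto simp: S_def)
  have S2: "commutant S \<subseteq> BH" "\<And>A. A \<in> commutant S \<Longrightarrow> adj A \<in> commutant S"
    using commutant_adj[OF S] by (auto simp: commutant_def)
  have comm: "A o\<^sub>L B = B o\<^sub>L A" if "A \<in> S" "B \<in> S" for A B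
    using that c D_commute by (auto simp: S_def)
  define E where "E = commutant (commutant S)"
  have SE: "S \<subseteq> E" using S(1) by (auto simp: E_def commutant_def)
  have "S \<subseteq> commutant S" using S(1) comm by (auto simp: commutant_def)
  then have EC: "E \<subseteq> commutant S" unfolding E_def by (auto simp: commutant_def)
  have "abelian_selfadjoint_algebra E"
    unfolding abelian_selfadjoint_algebra_def
  proof (intro conjI ballI allI)
    show "E \<subseteq> BH" by (auto simp: E_def commutant_def)
    show "0 \<in> E" by (simp add: E_def commutant_def)
    fix A assume A: "A \<in> E"
    then have AB: "A \<in> BH" by (simp add: E_def commutant_def)
    have "adj A \<in> E" unfolding E_def by (rule commutant_adj[OF S2]) (use A in \<open>simp_all add: E_def\<close>)
    then show "\<exists>B\<in>E. is_adjoint A B" using is_adjoint_adj[OF AB] by blast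
    show "c *\<^sub>C A \<in> E" for c
      using A S2(1) by (auto simp: E_def commutant_def scaleC_comp comp_scaleC)
    fix B assume B: "B \<in> E"
    show "A + B \<in> E" using A B by (auto simp: E_def commutant_def blinfun_comp_bilin)
    show "A o\<^sub>L B \<in> E"
      using A B by (auto simp: E_def commutant_def) (metis comp_assoc)
    have "B \<in> commutant S" using B EC by blast
    then show "A o\<^sub>L B = B o\<^sub>L A" using A by (simp add: E_def commutant_def)
  qed
  moreover have "D \<subseteq> E" using SE by (auto simp: S_def)
  ultimately have "E = D" by (rule D_maximal)
  then show ?thesis using SE by (auto simp: S_def)
qed

lemma D_id: "id_blinfun \<in> D"
  by (rule selfadjoint_commuting_mem) (simp_all only: adj_id BH_id id_comp)

lemma D_selfadjoint_limit:
  assumes A: "\<And>n. A n \<in> D" "\<And>n. adj (A n) = A n" and lim: "A \<longlonglongrightarrow> L"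
  shows "L \<in> D \<and> adj L = L"
proof -
  have LB: "L \<in> BH"
    by (rule closed_sequentially[OF closed_BH _ lim]) (simp add: A D_BH)
  have lim': "(\<lambda>n. blinfun_apply (A n) x) \<longlonglongrightarrow> blinfun_apply L x" for x
    by (intro tendsto_intros lim)
  have ad: "adj L = L"
  proof (rule adjI[OF LB])
    fix x y
    have "(\<lambda>n. cinner (A n x) y) \<longlonglongrightarrow> cinner (L x) y" by (intro tendsto_intros lim')
    moreover have "(\<lambda>n. cinner (A n x) y) = (\<lambda>n. cinner x (A n y))"
      using A by (simp add: cinner_adj D_BH)
    moreover have "(\<lambda>n. cinner x (A n y)) \<longlonglongrightarrow> cinner x (L y)" by (intro tendsto_intros lim')
    ultimately show "cinner (L x) y = cinner x (L y)" using LIMSEQ_unique by metis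
  qed
  have "L \<in> D"
  proof (rule selfadjoint_commuting_mem[OF LB ad])
    fix B assume B: "B \<in> D"
    have "B (L x) = L (B x)" for x
    proof -
      have "(\<lambda>n. blinfun_apply B (A n x)) \<longlonglongrightarrow> B (L x)" by (intro tendsto_intros lim')
      moreover have "(\<lambda>n. blinfun_apply B (A n x)) = (\<lambda>n. A n (B x))"
      proof
        fix n
        have "(B o\<^sub>L A n) x = (A n o\<^sub>L B) x" using D_commute[OF B A(1)[of n]] by simp
        then show "B (A n x) = A n (B x)" by simp
      qed
      ultimately show ?thesis using LIMSEQ_unique lim' by metis
    qed
    then show "B o\<^sub>L L = L o\<^sub>L B" by (intro blinfun_eqI) simp
  qed
  then show ?thesis using ad by simp
qed

lemma proj_mem:
  assumes "closed_subspace M" and inv: "\<And>A x. A \<in> D \<Longrightarrow> x \<in> M \<Longrightarrow> blinfun_apply A x \<in> M"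
  shows "proj M \<in> D"
proof -
  interpret closed_subspace M by fact
  let ?P = "proj M"
  have 1: "?P o\<^sub>L (A o\<^sub>L ?P) = A o\<^sub>L ?P" if "A \<in> D" for A
    by (rule blinfun_eqI) (simp add: proj_id proj_in inv that)
  show ?thesis
  proof (rule selfadjoint_commuting_mem[OF proj_BH adj_proj])
    fix A assume A: "A \<in> D"
    have "adj (?P o\<^sub>L (adj A o\<^sub>L ?P)) = adj (adj A o\<^sub>L ?P)" using 1[OF D_adj[OF A]] by simp
    then have "?P o\<^sub>L (A o\<^sub>L ?P) = ?P o\<^sub>L A"
      by (simp add: adj_comp D_BH[OF A] proj_BH adj_proj comp_assoc)
    then show "A o\<^sub>L ?P = ?P o\<^sub>L A" using 1[OF A] by simp
  qed
qed

definition cyc :: "'a \<Rightarrow> 'a set" where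
  "cyc x = closure ((\<lambda>A. blinfun_apply A x) ` D)"

lemma closed_subspace_cyc: "closed_subspace (cyc x)"
proof
  have "complex_subspace ((\<lambda>A. blinfun_apply A x) ` D)"
    unfolding complex_subspace_def
  proof (intro conjI ballI allI)
    show "0 \<in> (\<lambda>A. blinfun_apply A x) ` D" using D_zero by (intro image_eqI[of _ _ 0]) simp_all
  next
    fix y z assume "y \<in> (\<lambda>A. blinfun_apply A x) ` D" "z \<in> (\<lambda>A. blinfun_apply A x) ` D"
    then obtain A B where "y = blinfun_apply A x" "z = blinfun_apply B x" "A \<in> D" "B \<in> D" by blast
    then show "y + z \<in> (\<lambda>A. blinfun_apply A x) ` D"
      using D_add[of A B] by (intro image_eqI[of _ _ "A + B"]) (simp_all add: apply_simps)
  next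
    fix c y assume "y \<in> (\<lambda>A. blinfun_apply A x) ` D"
    then obtain A where "y = blinfun_apply A x" "A \<in> D" by blast
    then show "c *\<^sub>C y \<in> (\<lambda>A. blinfun_apply A x) ` D"
      using D_cscale[of A c] by (intro image_eqI[of _ _ "c *\<^sub>C A"]) (simp_all add: apply_simps)
  qed
  then show "complex_subspace (cyc x)" unfolding cyc_def by (rule complex_subspace_closure)
qed (simp add: cyc_def)

lemma cyc_base: "A \<in> D \<Longrightarrow> blinfun_apply A x \<in> cyc x"
  unfolding cyc_def by (rule subsetD[OF closure_subset]) (rule imageI)

lemma cyc_self: "x \<in> cyc x"
  using cyc_base[OF D_id, of x] by simp

lemma cyc_inv: "A \<in> D \<Longrightarrow> y \<in> cyc x \<Longrightarrow> blinfun_apply A y \<in> cyc x"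
proof -
  assume A: "A \<in> D" and "y \<in> cyc x"
  then obtain f where f: "\<forall>n. f n \<in> (\<lambda>A. blinfun_apply A x) ` D" "f \<longlonglongrightarrow> y"
    unfolding cyc_def closure_sequential by blast
  have "blinfun_apply A (f n) \<in> (\<lambda>A. blinfun_apply A x) ` D" for n
  proof -
    obtain B where "f n = blinfun_apply B x" "B \<in> D" using f(1) by blast
    then show ?thesis using D_comp[OF A] by (intro image_eqI[of _ _ "A o\<^sub>L B"]) simp_all
  qed
  moreover have "(\<lambda>n. blinfun_apply A (f n)) \<longlonglongrightarrow> A y" by (intro tendsto_intros f(2))
  ultimately show ?thesis
    unfolding cyc_def closure_sequential by (intro exI[of _ "\<lambda>n. blinfun_apply A (f n)"]) simp
qed

lemma cyc_minimal:
  assumes "closed M" "\<And>A. A \<in> D \<Longrightarrow> blinfun_apply A x \<in> M"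
  shows "cyc x \<subseteq> M"
  unfolding cyc_def by (rule closure_minimal) (use assms in auto)

abbreviation "cyc_proj x \<equiv> proj (cyc x)"

lemma cyc_proj_mem: "cyc_proj x \<in> D"
  by (rule proj_mem[OF closed_subspace_cyc]) (rule cyc_inv)

lemmas cyc_proj_in = closed_subspace.proj_in[OF closed_subspace_cyc]
  and cyc_proj_id = closed_subspace.proj_id[OF closed_subspace_cyc]
  and cyc_proj_eq_0 = closed_subspace.proj_eq_0[OF closed_subspace_cyc]
  and cyc_proj_adjoint = closed_subspace.proj_adjoint[OF closed_subspace_cyc]
  and cyc_proj_adj = closed_subspace.adj_proj[OF closed_subspace_cyc]

lemma cyc_proj_self [simp]: "cyc_proj x x = x"
  by (simp add: cyc_proj_id cyc_self)

lemma orth_cyc: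
  assumes "\<And>A. A \<in> D \<Longrightarrow> cinner (blinfun_apply A x) y = 0" "z \<in> cyc x"
  shows "cinner z y = 0"
proof -
  have "cyc x \<subseteq> {z. cinner z y = 0}"
    by (rule cyc_minimal) (auto intro!: closed_Collect_eq continuous_intros assms(1))
  then show ?thesis using assms(2) by blast
qed

end

section \<open>Contractive Schur idempotents\<close>

text \<open>Weak* continuity enters only through \<open>normal\<close>: matrix coefficients of \<open>\<Phi>\<close> are norm limits of
  functionals of finite rank. In this form all the assumptions pass on to the maps \<open>T \<mapsto> \<Phi> (T\<^sup>*)\<^sup>*\<close> and
  \<open>T \<mapsto> p \<Phi> T\<close>, to which the lemmas of this locale are applied as well.\<close>

locale schur_projection = masa_algebra D for D :: "('a::complex_hilbert_space \<Rightarrow>\<^sub>L 'a) set" +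
  fixes \<Phi> :: "('a \<Rightarrow>\<^sub>L 'a) \<Rightarrow> ('a \<Rightarrow>\<^sub>L 'a)"
  assumes maps: "T \<in> BH \<Longrightarrow> \<Phi> T \<in> BH"
    and add: "S \<in> BH \<Longrightarrow> T \<in> BH \<Longrightarrow> \<Phi> (S + T) = \<Phi> S + \<Phi> T"
    and cscale: "T \<in> BH \<Longrightarrow> \<Phi> (c *\<^sub>C T) = c *\<^sub>C \<Phi> T"
    and module: "A \<in> D \<Longrightarrow> B \<in> D \<Longrightarrow> T \<in> BH \<Longrightarrow> \<Phi> (A o\<^sub>L T o\<^sub>L B) = A o\<^sub>L \<Phi> T o\<^sub>L B"
    and idem: "T \<in> BH \<Longrightarrow> \<Phi> (\<Phi> T) = \<Phi> T"
    and contractive: "T \<in> BH \<Longrightarrow> norm (\<Phi> T) \<le> norm T"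
    and normal: "\<eta> > 0 \<Longrightarrow> \<exists>(n::nat) u v. \<forall>T\<in>BH.
      norm (cinner (blinfun_apply (\<Phi> T) y) x - (\<Sum>k<n. cinner (blinfun_apply T (u k)) (v k))) \<le> \<eta> * norm T"
begin

lemma rscale: "T \<in> BH \<Longrightarrow> \<Phi> (r *\<^sub>R T) = r *\<^sub>R \<Phi> T"
  by (simp add: scaleR_scaleC cscale)

lemma Phi_minus: "T \<in> BH \<Longrightarrow> \<Phi> (- T) = - \<Phi> T"
  using rscale[of T "-1"] by simp

lemma diff: "S \<in> BH \<Longrightarrow> T \<in> BH \<Longrightarrow> \<Phi> (S - T) = \<Phi> S - \<Phi> T"
  using add[of S "- T"] by (simp add: Phi_minus)

lemma Phi_zero [simp]: "\<Phi> 0 = 0"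
  using rscale[of 0 0] by simp

lemma Phi_sum: "(\<And>i. i \<in> I \<Longrightarrow> f i \<in> BH) \<Longrightarrow> \<Phi> (\<Sum>i\<in>I. f i) = (\<Sum>i\<in>I. \<Phi> (f i))"
  by (induction I rule: infinite_finite_induct) (simp_all add: add)

lemma left_module: "A \<in> D \<Longrightarrow> T \<in> BH \<Longrightarrow> \<Phi> (A o\<^sub>L T) = A o\<^sub>L \<Phi> T"
  using module[of A id_blinfun T] D_id by simp

lemma right_module: "B \<in> D \<Longrightarrow> T \<in> BH \<Longrightarrow> \<Phi> (T o\<^sub>L B) = \<Phi> T o\<^sub>L B"
  using module[of id_blinfun B T] D_id by simp

definition R :: "('a \<Rightarrow>\<^sub>L 'a) set" where
  "R = {T\<in>BH. \<Phi> T = T}"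

lemma R_BH: "T \<in> R \<Longrightarrow> T \<in> BH" by (simp add: R_def)
lemma R_fix: "T \<in> R \<Longrightarrow> \<Phi> T = T" by (simp add: R_def)
lemma Phi_R: "T \<in> BH \<Longrightarrow> \<Phi> T \<in> R" by (simp add: R_def maps idem)
lemma R_zero [simp]: "0 \<in> R" by (simp add: R_def)
lemma R_add: "S \<in> R \<Longrightarrow> T \<in> R \<Longrightarrow> S + T \<in> R" by (simp add: R_def add)
lemma R_diff: "S \<in> R \<Longrightarrow> T \<in> R \<Longrightarrow> S - T \<in> R" by (simp add: R_def diff)
lemma R_cscale: "T \<in> R \<Longrightarrow> c *\<^sub>C T \<in> R" by (simp add: R_def cscale)
lemma R_rscale: "T \<in> R \<Longrightarrow> r *\<^sub>R T \<in> R" by (simp add: R_def rscale)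
lemma R_left: "A \<in> D \<Longrightarrow> T \<in> R \<Longrightarrow> A o\<^sub>L T \<in> R" by (simp add: R_def left_module D_BH)
lemma R_right: "A \<in> D \<Longrightarrow> T \<in> R \<Longrightarrow> T o\<^sub>L A \<in> R" by (simp add: R_def right_module D_BH)

lemma Ran_eq: "Ran \<Phi> = R"
  by (auto simp: Ran_def R_def maps idem intro: image_eqI[OF sym])

lemma tendsto_Phi:
  assumes "\<And>n. X n \<in> BH" "L \<in> BH" "X \<longlonglongrightarrow> L" shows "(\<lambda>n. \<Phi> (X n)) \<longlonglongrightarrow> \<Phi> L"
proof (rule LIM_zero_cancel, rule Lim_null_comparison)
  show "\<forall>\<^sub>F n in sequentially. norm (\<Phi> (X n) - \<Phi> L) \<le> norm (X n - L)"
    using contractive[of "X n - L" for n] assms by (simp add: diff)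
  show "(\<lambda>n. norm (X n - L)) \<longlonglongrightarrow> 0"
    using assms(3) by (intro tendsto_norm_zero LIM_zero)
qed

lemma R_limit: "(\<And>n. X n \<in> R) \<Longrightarrow> X \<longlonglongrightarrow> L \<Longrightarrow> L \<in> R"
proof -
  assume X: "\<And>n. X n \<in> R" and lim: "X \<longlonglongrightarrow> L"
  have L: "L \<in> BH" by (rule closed_sequentially[OF closed_BH _ lim]) (simp add: X R_BH)
  have "(\<lambda>n. \<Phi> (X n)) \<longlonglongrightarrow> \<Phi> L" by (rule tendsto_Phi) (simp_all add: X R_BH L lim)
  then have "\<Phi> L = L" using lim X by (simp add: R_fix LIMSEQ_unique)
  then show ?thesis by (simp add: R_def L)
qed

lemma closed_subspace_rows: "closed_subspace {a. rank_one a v \<in> R}"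
proof
  show "complex_subspace {a. rank_one a v \<in> R}"
    by (simp add: complex_subspace_def rank_one_add_left rank_one_scaleC_left R_add R_cscale)
  show "closed {a. rank_one a v \<in> R}"
    unfolding closed_sequential_limits
  proof (intro allI impI, elim conjE)
    fix f l assume "\<forall>n. f n \<in> {a. rank_one a v \<in> R}" and "f \<longlonglongrightarrow> l"
    then show "l \<in> {a. rank_one a v \<in> R}"
      using R_limit[of "\<lambda>n. rank_one (f n) v" "rank_one l v"] by (simp add: tendsto_rank_one)
  qed
qed

lemma closed_subspace_columns: "closed_subspace {b. rank_one u b \<in> R}"
proof
  show "complex_subspace {b. rank_one u b \<in> R}"
    by (simp add: complex_subspace_def rank_one_add_right rank_one_scaleC_right R_add R_cscale)
  show "closed {b. rank_one u b \<in> R}"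
    unfolding closed_sequential_limits
  proof (intro allI impI, elim conjE)
    fix f l assume "\<forall>n. f n \<in> {b. rank_one u b \<in> R}" and "f \<longlonglongrightarrow> l"
    then show "l \<in> {b. rank_one u b \<in> R}"
      using R_limit[of "\<lambda>n. rank_one u (f n)" "rank_one u l"] by (simp add: tendsto_rank_one)
  qed
qed

lemma rows_inv: "A \<in> D \<Longrightarrow> a \<in> {a. rank_one a v \<in> R} \<Longrightarrow> blinfun_apply A a \<in> {a. rank_one a v \<in> R}"
  using R_left[of A "rank_one a v"] by (simp add: comp_rank_one D_BH)

lemma columns_inv: "A \<in> D \<Longrightarrow> b \<in> {b. rank_one u b \<in> R} \<Longrightarrow> blinfun_apply A b \<in> {b. rank_one u b \<in> R}"
  using R_right[of "adj A" "rank_one u b"] by (simp add: rank_one_comp D_BH D_adj)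

subsection \<open>Rank one operators on which the contraction is attained\<close>

text \<open>Let \<open>G = \<Phi> (rank_one x y)\<close>. Equality in the Cauchy-Schwarz inequality gives \<open>G y = \<parallel>y\<parallel>\<^sup>2 x\<close> and
  \<open>G\<^sup>* x = \<parallel>x\<parallel>\<^sup>2 y\<close>. The second identity shows that the bound is also attained for \<open>x\<close> and \<open>e y\<close>, where
  \<open>e \<in> D\<close>, so the first one holds there, too: \<open>G (e\<^sup>* e y) = \<langle>e\<^sup>* e y, y\<rangle> x\<close>. Polarisation determines \<open>G\<close>
  on \<open>cyc y\<close>, and \<open>G\<close> vanishes on the orthogonal complement because \<open>rank_one x y\<close> does.\<close>

lemma rank_one_mem_if_attained:
  assumes ge: "(norm x)\<^sup>2 * (norm y)\<^sup>2 \<le> Re (cinner (blinfun_apply (\<Phi> (rank_one x y)) y) x)"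
  shows "rank_one x y \<in> R"
proof -
  have eq: "g = c *\<^sub>R w" if "norm g \<le> c * norm w" "c * (norm w)\<^sup>2 \<le> Re (cinner g w)" "0 \<le> c" for g w :: 'a and c
  proof -
    have "(norm (g - c *\<^sub>R w))\<^sup>2 = (norm g)\<^sup>2 - 2 * c * Re (cinner g w) + c\<^sup>2 * (norm w)\<^sup>2"
      by (simp add: norm_diff_sq cinner_scaleR_right power_mult_distrib)
    also have "\<dots> \<le> (c * norm w)\<^sup>2 - 2 * c * (c * (norm w)\<^sup>2) + c\<^sup>2 * (norm w)\<^sup>2"
      using that by (intro add_right_mono diff_mono power_mono mult_left_mono) auto
    also have "\<dots> = 0" by (simp add: power2_eq_square)
    finally show ?thesis by simp
  qed
  define G where "G = \<Phi> (rank_one x y)"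
  have GB: "G \<in> BH" by (simp add: G_def maps)
  have nG: "norm G \<le> norm x * norm y"
    unfolding G_def using contractive[OF rank_one_BH] norm_rank_one_le order_trans by blast
  have Gadj: "adj G x = (norm x)\<^sup>2 *\<^sub>R y"
  proof (rule eq)
    have "norm (adj G x) \<le> norm G * norm x" using norm_blinfun[of "adj G" x] by (simp add: norm_adj GB)
    also have "\<dots> \<le> (norm x * norm y) * norm x" by (intro mult_right_mono nG) simp
    finally show "norm (adj G x) \<le> (norm x)\<^sup>2 * norm y" by (simp add: power2_eq_square ac_simps)
    show "(norm x)\<^sup>2 * (norm y)\<^sup>2 \<le> Re (cinner (adj G x) y)"
      unfolding cinner_adj'[OF GB] Re_cinner_commute[of x] using ge by (simp only: G_def)
  qed simp
  have quad: "G (adj e (blinfun_apply e y)) = (norm (blinfun_apply e y))\<^sup>2 *\<^sub>R x" if e: "e \<in> D" for e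
  proof (rule eq)
    let ?z = "blinfun_apply e y"
    have "rank_one x ?z = rank_one x y o\<^sub>L adj e" using e by (simp add: rank_one_comp D_BH D_adj)
    then have G': "\<Phi> (rank_one x ?z) = G o\<^sub>L adj e" by (simp add: right_module D_adj e G_def)
    have "norm (\<Phi> (rank_one x ?z) ?z) \<le> norm (\<Phi> (rank_one x ?z)) * norm ?z" by (rule norm_blinfun)
    also have "\<dots> \<le> (norm x * norm ?z) * norm ?z"
      using contractive[OF rank_one_BH, of x ?z] norm_rank_one_le[of x ?z] by (intro mult_right_mono) auto
    finally show "norm (G (adj e ?z)) \<le> (norm ?z)\<^sup>2 * norm x"
      by (simp add: G' power2_eq_square ac_simps)
    have "cinner (G (adj e ?z)) x = of_real ((norm x)\<^sup>2) * cinner (adj e ?z) y"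
      by (simp add: cinner_adj GB Gadj cinner_scaleR_right)
    also have "cinner (adj e ?z) y = of_real ((norm ?z)\<^sup>2)"
      by (simp only: cinner_adj'[OF D_BH[OF e]] cinner_self)
    finally have "Re (cinner (G (adj e ?z)) x) = (norm x)\<^sup>2 * (norm ?z)\<^sup>2"
      by (simp only: of_real_mult[symmetric] Re_complex_of_real)
    then show "(norm ?z)\<^sup>2 * (norm x)\<^sup>2 \<le> Re (cinner (G (adj e ?z)) x)" by (simp add: mult.commute)
  qed simp
  define L where "L f = blinfun_apply G (blinfun_apply f y) - cinner (blinfun_apply f y) y *\<^sub>C x" for f
  have Lquad: "L (adj e o\<^sub>L e) = 0" if "e \<in> D" for e
    using quad[OF that] that
    by (simp add: L_def cinner_adj' D_BH cinner_self scaleR_scaleC)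
  have Ladd: "L (f + g) = L f + L g" for f g
    by (simp add: L_def apply_simps cinner_add_left scaleC_add_left)
  have Lscale: "L (c *\<^sub>C f) = c *\<^sub>C L f" for c f
    by (simp add: L_def apply_simps BH_scaleC[OF GB] cinner_scaleC_left scaleC_diff_right scaleC_scaleC)
  have Lsym: "L f + L (adj f) = 0" if f: "f \<in> D" for f
  proof -
    let ?e = "id_blinfun + f"
    have "adj ?e o\<^sub>L ?e = (id_blinfun + f) + (adj f + (adj f o\<^sub>L f))"
      using f by (simp add: adj_add D_BH adj_id blinfun_comp_bilin algebra_simps)
    then have "L (adj ?e o\<^sub>L ?e) = (L id_blinfun + L f) + (L (adj f) + L (adj f o\<^sub>L f))"
      by (simp only: Ladd)
    moreover have "L (adj ?e o\<^sub>L ?e) = 0" "L (adj f o\<^sub>L f) = 0" "L id_blinfun = 0"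
      using Lquad[OF D_add[OF D_id f]] Lquad[OF f] Lquad[OF D_id] by (simp_all add: adj_id)
    ultimately show ?thesis by simp
  qed
  have L0: "L f = 0" if f: "f \<in> D" for f
  proof -
    have "L (\<i> *\<^sub>C f) + L (adj (\<i> *\<^sub>C f)) = 0" by (rule Lsym) (rule D_cscale[OF f])
    then have "\<i> *\<^sub>C L f + (- \<i>) *\<^sub>C L (adj f) = 0"
      by (simp add: adj_cscale D_BH[OF f] Lscale del: scaleC_minus_left)
    then have "\<i> *\<^sub>C (L f - L (adj f)) = 0" by (simp add: scaleC_diff_right)
    then have "(- \<i>) *\<^sub>C \<i> *\<^sub>C (L f - L (adj f)) = 0" by simp
    then have "L f - L (adj f) = 0" by (simp add: scaleC_scaleC del: scaleC_minus_left)
    moreover have "L (adj f) = - L f" using Lsym[OF f] by (simp add: eq_neg_iff_add_eq_0 add.commute)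
    ultimately have "2 *\<^sub>R L f = 0" by (simp add: scaleR_2)
    then show ?thesis by simp
  qed
  have Gcyc: "G w = cinner w y *\<^sub>C x" if "w \<in> cyc y" for w
  proof -
    have "cyc y \<subseteq> {w. blinfun_apply G w = cinner w y *\<^sub>C x}"
    proof (rule cyc_minimal)
      show "closed {w. blinfun_apply G w = cinner w y *\<^sub>C x}"
        by (intro closed_Collect_eq continuous_intros)
      show "blinfun_apply A y \<in> {w. blinfun_apply G w = cinner w y *\<^sub>C x}" if "A \<in> D" for A
        using L0[OF that] by (simp add: L_def)
    qed
    then show ?thesis using that by blast
  qed
  have "G = rank_one x y"
  proof (rule blinfun_eqI)
    fix z
    have "rank_one x y = rank_one x y o\<^sub>L cyc_proj y" by (simp add: rank_one_comp D_BH cyc_proj_mem cyc_proj_adj)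
    then have "G = G o\<^sub>L cyc_proj y" unfolding G_def using right_module[OF cyc_proj_mem rank_one_BH] by metis
    then have "G z = G (cyc_proj y z)" by (metis blinfun_apply_blinfun_compose)
    also have "\<dots> = cinner (cyc_proj y z) y *\<^sub>C x" by (rule Gcyc[OF cyc_proj_in])
    also have "\<dots> = rank_one x y z" by (simp add: rank_one_apply cyc_proj_adjoint)
    finally show "G z = rank_one x y z" .
  qed
  then show ?thesis by (simp add: R_def G_def)
qed

text \<open>If \<open>a = X v\<close> and \<open>N = rank_one a v - \<Phi> (rank_one a v)\<close> had \<open>Re \<langle>N v, a\<rangle> > 0\<close>, then subtracting a small
  multiple of \<open>N\<close> from \<open>l rank_one u v + X\<close> would shorten the image of \<open>v\<close>, and for large \<open>l\<close> the image of
  \<open>v\<close> decides the operator norm. But \<open>\<Phi>\<close> kills \<open>N\<close>, so it undoes the subtraction, and it does not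
  increase norms.\<close>

lemma rank_one_step_orth:
  assumes uv: "rank_one u v \<in> R" and u: "u \<noteq> 0" and v: "norm v = 1" and X: "X \<in> R"
    and PX: "cyc_proj u o\<^sub>L X = 0"
  shows "rank_one (blinfun_apply X v) v \<in> R"
proof (rule rank_one_mem_if_attained, rule ccontr)
  define a where "a = blinfun_apply X v"
  define N where "N = rank_one a v - \<Phi> (rank_one a v)"
  define \<delta> where "\<delta> = Re (cinner (N v) a)"
  have XB: "X \<in> BH" and NB: "N \<in> BH" using X by (simp_all add: R_BH N_def maps)
  have vv: "cinner v v = 1" by (simp add: cinner_self v)
  assume "\<not> (norm (X v))\<^sup>2 * (norm v)\<^sup>2 \<le> Re (cinner (\<Phi> (rank_one (X v) v) v) (X v))"
  then have \<delta>: "\<delta> > 0"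
    by (simp add: \<delta>_def N_def apply_simps rank_one_apply vv cinner_diff_left Re_cinner_self v a_def)
  have PhiN: "\<Phi> N = 0" by (simp add: N_def diff maps idem)
  have PN: "cyc_proj u o\<^sub>L N = 0"
  proof -
    have "cyc_proj u a = 0" using PX unfolding a_def by (metis blinfun_apply_blinfun_compose blinfun.zero_left)
    then have 0: "cyc_proj u o\<^sub>L rank_one a v = 0" by (simp add: comp_rank_one D_BH cyc_proj_mem)
    then have "cyc_proj u o\<^sub>L \<Phi> (rank_one a v) = 0" using left_module[OF cyc_proj_mem rank_one_BH, of u a v] by simp
    then show ?thesis using 0 by (simp add: N_def blinfun_comp_bilin)
  qed
  define n where "n = norm (N v)"
  have n: "n > 0" using \<delta> by (auto simp: \<delta>_def n_def)
  define s where "s = \<delta> / n\<^sup>2"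
  define Y where "Y = X - s *\<^sub>R N"
  have PY: "cyc_proj u o\<^sub>L Y = 0" by (simp add: Y_def blinfun_comp_bilin PX PN)
  define \<beta> where "\<beta> = norm (Y v)"
  define K where "K = norm Y"
  have \<beta>: "\<beta>\<^sup>2 < (norm a)\<^sup>2"
  proof -
    have "\<beta>\<^sup>2 = (norm (a - s *\<^sub>R N v))\<^sup>2" by (simp add: \<beta>_def Y_def apply_simps a_def)
    also have "\<dots> = (norm a)\<^sup>2 - 2 * s * \<delta> + s\<^sup>2 * n\<^sup>2"
      by (simp add: norm_diff_sq cinner_scaleR_right \<delta>_def n_def power_mult_distrib Re_cinner_commute[of a])
    also have "\<dots> = (norm a)\<^sup>2 - \<delta>\<^sup>2 / n\<^sup>2"
      using n by (simp add: s_def power2_eq_square field_simps)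
    finally show ?thesis using \<delta> n by simp
  qed
  \<comment> \<open>With half of the gain in \<open>g\<close>, the weight \<open>\<Lambda>\<close> is chosen to complete a square below.\<close>
  define g where "g = ((norm a)\<^sup>2 - \<beta>\<^sup>2) / 2"
  have g: "g > 0" using \<beta> by (simp add: g_def)
  define \<Lambda> where "\<Lambda> = K\<^sup>2 + K\<^sup>2 * \<beta>\<^sup>2 / g"
  have \<Lambda>: "\<Lambda> \<ge> 0" using g by (simp add: \<Lambda>_def)
  define l where "l = sqrt \<Lambda> / norm u"
  have lu: "(l * norm u)\<^sup>2 = \<Lambda>" using u \<Lambda> by (simp add: l_def)
  define T where "T = l *\<^sub>R rank_one u v + Y"
  have TB: "T \<in> BH" by (simp add: T_def Y_def XB NB)
  have PhiT: "\<Phi> T = l *\<^sub>R rank_one u v + X"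
    by (simp add: T_def Y_def add diff rscale XB NB PhiN R_fix[OF uv] R_fix[OF X])
  have orth: "cinner (c *\<^sub>C u) (Z x) = 0" if "cyc_proj u o\<^sub>L Z = 0" for c x and Z :: "'a \<Rightarrow>\<^sub>L 'a"
  proof -
    have "cinner u (Z x) = cinner (cyc_proj u u) (Z x)" by simp
    also have "\<dots> = cinner u (cyc_proj u (Z x))" by (rule cyc_proj_adjoint)
    also have "cyc_proj u (Z x) = 0" using that by (metis blinfun_apply_blinfun_compose blinfun.zero_left)
    finally show ?thesis by (simp add: cinner_scaleC_left)
  qed
  have upper: "norm T \<le> sqrt (\<Lambda> + (\<beta>\<^sup>2 + g))"
  proof (rule norm_blinfun_bound)
    fix x
    define \<alpha> where "\<alpha> = cinner x v"
    define w where "w = x - \<alpha> *\<^sub>C v"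
    have wv: "cinner (\<alpha> *\<^sub>C v) w = 0"
      by (simp add: w_def cinner_simps vv \<alpha>_def) (metis cinner_commute)
    have x: "x = \<alpha> *\<^sub>C v + w" by (simp add: w_def)
    have nx: "(norm x)\<^sup>2 = (norm \<alpha>)\<^sup>2 + (norm w)\<^sup>2"
      by (subst x, subst pythagoras[OF wv]) (simp add: norm_scaleC v)
    have "norm (Y x) \<le> norm \<alpha> * \<beta> + K * norm w"
    proof -
      have "Y x = \<alpha> *\<^sub>C Y v + Y w"
        by (subst x) (simp add: blinfun.add_right BH_scaleC Y_def XB NB)
      then have "norm (Y x) \<le> norm (\<alpha> *\<^sub>C Y v) + norm (Y w)" by (simp add: norm_triangle_ineq)
      also have "\<dots> \<le> norm \<alpha> * \<beta> + K * norm w"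
        unfolding \<beta>_def K_def norm_scaleC by (intro add_left_mono norm_blinfun)
      finally show ?thesis .
    qed
    then have "(norm (Y x))\<^sup>2 \<le> (norm \<alpha> * \<beta> + K * norm w)\<^sup>2" by (intro power_mono) auto
    also have "\<dots> \<le> (\<beta>\<^sup>2 + g) * (norm \<alpha>)\<^sup>2 + \<Lambda> * (norm w)\<^sup>2"
    proof -
      have "0 \<le> (norm \<alpha> * g - norm w * K * \<beta>)\<^sup>2 / g" using g by simp
      also have "\<dots> = g * (norm \<alpha>)\<^sup>2 - 2 * norm \<alpha> * \<beta> * K * norm w + K\<^sup>2 * \<beta>\<^sup>2 / g * (norm w)\<^sup>2"
        using g by (simp add: power2_eq_square field_simps)
      finally show ?thesis by (simp add: \<Lambda>_def power2_eq_square algebra_simps)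
    qed
    finally have Yx: "(norm (Y x))\<^sup>2 \<le> (\<beta>\<^sup>2 + g) * (norm \<alpha>)\<^sup>2 + \<Lambda> * (norm w)\<^sup>2" .
    have "T x = (of_real l * \<alpha>) *\<^sub>C u + Y x"
      by (simp add: T_def apply_simps rank_one_apply \<alpha>_def scaleR_scaleC scaleC_scaleC)
    then have "(norm (T x))\<^sup>2 = (norm ((of_real l * \<alpha>) *\<^sub>C u))\<^sup>2 + (norm (Y x))\<^sup>2"
      by (simp only: pythagoras[OF orth[OF PY]])
    also have "(norm ((of_real l * \<alpha>) *\<^sub>C u))\<^sup>2 = (l * norm u)\<^sup>2 * (norm \<alpha>)\<^sup>2"
      by (simp add: norm_scaleC norm_mult power_mult_distrib)
    also have "\<dots> = \<Lambda> * (norm \<alpha>)\<^sup>2" by (simp only: lu)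
    finally have "(norm (T x))\<^sup>2 \<le> (\<Lambda> + (\<beta>\<^sup>2 + g)) * (norm \<alpha>)\<^sup>2 + \<Lambda> * (norm w)\<^sup>2"
      using Yx by (simp add: algebra_simps)
    also have "\<dots> \<le> (\<Lambda> + (\<beta>\<^sup>2 + g)) * (norm \<alpha>)\<^sup>2 + (\<Lambda> + (\<beta>\<^sup>2 + g)) * (norm w)\<^sup>2"
      using g by (intro add_left_mono mult_right_mono) auto
    also have "\<dots> = (\<Lambda> + (\<beta>\<^sup>2 + g)) * (norm x)\<^sup>2" by (simp add: nx distrib_left)
    finally have "sqrt ((norm (T x))\<^sup>2) \<le> sqrt ((\<Lambda> + (\<beta>\<^sup>2 + g)) * (norm x)\<^sup>2)"
      by (rule real_sqrt_le_mono)
    then show "norm (T x) \<le> sqrt (\<Lambda> + (\<beta>\<^sup>2 + g)) * norm x" by (simp add: real_sqrt_mult)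
  qed (use \<Lambda> g in simp)
  have "\<Phi> T v = (of_real l) *\<^sub>C u + X v"
    by (simp add: PhiT apply_simps rank_one_apply vv scaleR_scaleC)
  then have "(norm (\<Phi> T v))\<^sup>2 = (norm (of_real l *\<^sub>C u))\<^sup>2 + (norm (X v))\<^sup>2"
    by (simp only: pythagoras[OF orth[OF PX]])
  also have "\<dots> = \<Lambda> + (norm a)\<^sup>2"
    by (simp add: norm_scaleC a_def lu[symmetric] power_mult_distrib)
  finally have "\<Lambda> + (norm a)\<^sup>2 = (norm (\<Phi> T v))\<^sup>2" by simp
  also have "\<dots> \<le> (norm T)\<^sup>2"
  proof (rule power_mono)
    have "norm (\<Phi> T v) \<le> norm (\<Phi> T) * norm v" by (rule norm_blinfun)
    then show "norm (\<Phi> T v) \<le> norm T" using contractive[OF TB] by (simp add: v)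
  qed simp
  also have "\<dots> \<le> (sqrt (\<Lambda> + (\<beta>\<^sup>2 + g)))\<^sup>2" using upper by (intro power_mono) auto
  also have "\<dots> = \<Lambda> + (\<beta>\<^sup>2 + g)" using \<Lambda> g by simp
  finally have "(norm a)\<^sup>2 - \<beta>\<^sup>2 \<le> g" by linarith
  moreover have "(norm a)\<^sup>2 - \<beta>\<^sup>2 = g + g" by (simp add: g_def)
  ultimately show False using g by linarith
qed

lemma rank_one_step:
  assumes uv: "rank_one u v \<in> R" and u: "u \<noteq> 0" and X: "X \<in> R"
  shows "rank_one (blinfun_apply X v) v \<in> R"
proof (cases "v = 0")
  case False
  define w where "w = sgn v"
  have w: "norm w = 1" using False by (simp add: w_def norm_sgn)
  have vw: "v = complex_of_real (norm v) *\<^sub>C w" by (simp add: w_def sgn_div_norm scaleC_of_real False)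
  have "w = complex_of_real (inverse (norm v)) *\<^sub>C v"
    by (simp only: w_def sgn_div_norm scaleR_scaleC)
  then have uw: "rank_one u w \<in> R" using R_cscale[OF uv] by (simp add: rank_one_scaleC_right)
  have XB: "X \<in> BH" by (rule R_BH[OF X])
  define X' where "X' = X - (cyc_proj u o\<^sub>L X)"
  have X': "X' \<in> R" unfolding X'_def by (intro R_diff R_left cyc_proj_mem X)
  have "cyc_proj u o\<^sub>L X' = 0"
    by (rule blinfun_eqI) (simp add: X'_def apply_simps cyc_proj_id cyc_proj_in)
  then have 1: "rank_one (X' w) w \<in> R" using rank_one_step_orth[OF uw u w X'] by simp
  have "cyc u \<subseteq> {a. rank_one a w \<in> R}"
    using cyc_minimal[of "{a. rank_one a w \<in> R}" u] closed_subspace_rows[of w] uw rows_inv[of _ u w]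
    by (simp add: closed_subspace_def)
  then have 2: "rank_one (cyc_proj u (X w)) w \<in> R" using cyc_proj_in by blast
  have "X' w + cyc_proj u (X w) = X w" by (simp add: X'_def apply_simps)
  then have 3: "rank_one (X w) w \<in> R" using R_add[OF 1 2] by (simp only: rank_one_add_left[symmetric])
  have "rank_one (X v) v = (complex_of_real (norm v) * complex_of_real (norm v)) *\<^sub>C rank_one (X w) w"
    by (subst vw, subst vw) (simp only: BH_scaleC[OF XB] rank_one_scaleC_left rank_one_scaleC_right scaleC_scaleC complex_cnj_complex_of_real)
  then show ?thesis using R_cscale[OF 3] by simp
qed simp

text \<open>Through this map every statement about left factors yields one about right factors.\<close>

lemma adjoint_projection: "schur_projection D (\<lambda>T. adj (\<Phi> (adj T)))"
proof
  fix T :: "'a \<Rightarrow>\<^sub>L 'a" assume T: "T \<in> BH"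
  show "adj (\<Phi> (adj T)) \<in> BH" by (simp add: maps T)
  show "adj (\<Phi> (adj (c *\<^sub>C T))) = c *\<^sub>C adj (\<Phi> (adj T))" for c
    by (simp add: adj_cscale T cscale maps)
  show "adj (\<Phi> (adj (adj (\<Phi> (adj T))))) = adj (\<Phi> (adj T))" by (simp add: T maps idem)
  show "norm (adj (\<Phi> (adj T))) \<le> norm T"
    using contractive[of "adj T"] by (simp add: norm_adj T maps)
  fix S :: "'a \<Rightarrow>\<^sub>L 'a" assume "S \<in> BH"
  then show "adj (\<Phi> (adj (S + T))) = adj (\<Phi> (adj S)) + adj (\<Phi> (adj T))"
    by (simp add: adj_add T add maps)
next
  fix A B T :: "'a \<Rightarrow>\<^sub>L 'a" assume A: "A \<in> D" and B: "B \<in> D" and T: "T \<in> BH"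
  have "adj (A o\<^sub>L T o\<^sub>L B) = adj B o\<^sub>L adj T o\<^sub>L adj A"
    using A B T by (simp add: adj_comp D_BH comp_assoc)
  then have "\<Phi> (adj (A o\<^sub>L T o\<^sub>L B)) = adj B o\<^sub>L \<Phi> (adj T) o\<^sub>L adj A"
    using A B T by (simp add: module D_adj)
  then show "adj (\<Phi> (adj (A o\<^sub>L T o\<^sub>L B))) = A o\<^sub>L adj (\<Phi> (adj T)) o\<^sub>L B"
    using A B T by (simp add: adj_comp D_BH D_adj maps comp_assoc)
next
  fix \<eta> :: real and y x :: 'a assume "\<eta> > 0"
  from normal[OF this, of x y] obtain n :: nat and u v where uv: "\<And>T. T \<in> BH \<Longrightarrow>
    norm (cinner (\<Phi> T x) y - (\<Sum>k<n. cinner (blinfun_apply T (u k)) (v k))) \<le> \<eta> * norm T" by blast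
  have approx: "norm (cinner (adj (\<Phi> (adj T)) y) x - (\<Sum>k<n. cinner (blinfun_apply T (v k)) (u k))) \<le> \<eta> * norm T"
    if T: "T \<in> BH" for T
  proof -
    have "cinner (adj (\<Phi> (adj T)) y) x - (\<Sum>k<n. cinner (T (v k)) (u k))
      = cinner y (\<Phi> (adj T) x) - (\<Sum>k<n. cinner (v k) (adj T (u k)))"
      by (simp add: cinner_adj cinner_adj' T maps)
    also have "\<dots> = cnj (cinner (\<Phi> (adj T) x) y - (\<Sum>k<n. cinner (adj T (u k)) (v k)))"
      by (simp add: cinner_commute[symmetric])
    also have "norm \<dots> \<le> \<eta> * norm T"
      using uv[of "adj T"] unfolding complex_mod_cnj by (simp add: T norm_adj)
    finally show ?thesis .
  qed
  show "\<exists>(n::nat) u v. \<forall>T\<in>BH. norm (cinner (adj (\<Phi> (adj T)) y) x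
      - (\<Sum>k<n. cinner (blinfun_apply T (u k)) (v k))) \<le> \<eta> * norm T"
    by (rule exI[of _ n], rule exI[of _ v], rule exI[of _ u], rule ballI, rule approx)
qed

lemma rank_one_step_adj:
  assumes uv: "rank_one u v \<in> R" and v: "v \<noteq> 0" and X: "X \<in> R"
  shows "rank_one u (adj X u) \<in> R"
proof -
  interpret A: schur_projection D "\<lambda>T. adj (\<Phi> (adj T))" by (rule adjoint_projection)
  have AR: "adj T \<in> A.R" if "T \<in> R" for T
    using that by (simp add: A.R_def R_def)
  have RA: "T \<in> A.R \<Longrightarrow> adj T \<in> R" for T
    by (simp add: A.R_def R_def) (metis adj_adj adj_BH maps)
  have "rank_one v u \<in> A.R" using AR[OF uv] by (simp add: adj_rank_one)
  then have "rank_one (adj X u) u \<in> A.R" by (rule A.rank_one_step[OF _ v AR[OF X]])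
  then show ?thesis using RA adj_rank_one by metis
qed

text \<open>The operator \<open>X = rank_one a v\<close> of the range maps a suitable \<open>v + t b\<close> to a nonzero multiple of \<open>a\<close>,
  and \<open>rank_one u (v + t b)\<close> lies in the range.\<close>

lemma fourth_corner:
  assumes uv: "rank_one u v \<in> R" and av: "rank_one a v \<in> R" and ub: "rank_one u b \<in> R" and u: "u \<noteq> 0" and v: "v \<noteq> 0"
  shows "rank_one a b \<in> R"
proof -
  obtain t :: real where t: "t \<noteq> 0" "cinner (v + t *\<^sub>R b) v \<noteq> 0"
  proof (cases "cinner (v + 1 *\<^sub>R b) v = 0")
    case True
    then have "cinner b v = - cinner v v" by (simp add: cinner_add_left eq_neg_iff_add_eq_0 add.commute)
    then have "cinner (v + 2 *\<^sub>R b) v = - cinner v v" by (simp add: cinner_simps)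
    also have "\<dots> \<noteq> 0" using v by (simp add: cinner_self)
    finally show ?thesis by (intro that[of 2]) simp_all
  next
    case False
    then show ?thesis by (intro that[of 1]) simp_all
  qed
  define w where "w = v + t *\<^sub>R b"
  define k where "k = cinner w v"
  have k: "k \<noteq> 0" using t by (simp add: k_def w_def)
  have tb: "rank_one x w = rank_one x v + t *\<^sub>R rank_one x b" for x
    by (simp add: w_def rank_one_add_right scaleR_scaleC rank_one_scaleC_right)
  have "rank_one u w \<in> R" unfolding tb by (intro R_add R_rscale uv ub)
  then have "rank_one (rank_one a v w) w \<in> R" by (rule rank_one_step[OF _ u av])
  then have "rank_one (k *\<^sub>C a) w \<in> R" by (simp add: rank_one_apply k_def)
  then have "inverse k *\<^sub>C rank_one (k *\<^sub>C a) w \<in> R" by (rule R_cscale)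
  then have "rank_one a w \<in> R" using k by (simp add: rank_one_scaleC_left scaleC_scaleC)
  then have "rank_one a w - rank_one a v \<in> R" using av by (rule R_diff)
  then have "t *\<^sub>R rank_one a b \<in> R" unfolding tb by simp
  then have "inverse t *\<^sub>R (t *\<^sub>R rank_one a b) \<in> R" by (rule R_rscale)
  then show ?thesis using t by simp
qed

end

section \<open>Orthonormal families\<close>

definition orthonormal :: "'a::complex_hilbert_space set \<Rightarrow> bool" where
  "orthonormal B \<longleftrightarrow> finite B \<and> (\<forall>b\<in>B. norm b = 1) \<and> (\<forall>b\<in>B. \<forall>c\<in>B. b \<noteq> c \<longrightarrow> cinner b c = 0)"

lemma cinner_orthonormal:
  "orthonormal B \<Longrightarrow> b \<in> B \<Longrightarrow> c \<in> B \<Longrightarrow> cinner b c = (if b = c then 1 else 0)"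
  by (auto simp: orthonormal_def cinner_self)

lemma cinner_sum_orthonormal:
  assumes B: "orthonormal B" and c: "c \<in> B"
  shows "cinner (\<Sum>b\<in>B. f b *\<^sub>C b) c = f c"
proof -
  have "cinner (\<Sum>b\<in>B. f b *\<^sub>C b) c = (\<Sum>b\<in>B. f b * (if b = c then 1 else 0))"
    unfolding cinner_sum_left cinner_scaleC_left
    by (intro sum.cong refl) (simp add: cinner_orthonormal[OF B _ c])
  also have "\<dots> = f c" using B c by (simp add: orthonormal_def if_distrib cong: if_cong)
  finally show ?thesis .
qed

lemma norm_sum_orthonormal:
  assumes B: "orthonormal B"
  shows "(norm (\<Sum>b\<in>B. f b *\<^sub>C b))\<^sup>2 = (\<Sum>b\<in>B. (norm (f b))\<^sup>2)"
proof -
  let ?s = "\<Sum>b\<in>B. f b *\<^sub>C b"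
  have "complex_of_real ((norm ?s)\<^sup>2) = (\<Sum>b\<in>B. cnj (f b) * cinner ?s b)"
    unfolding cinner_self[symmetric] using cinner_sum_right[of ?s "\<lambda>b. f b *\<^sub>C b" B]
    by (simp only: cinner_scaleC_right)
  also have "\<dots> = (\<Sum>b\<in>B. of_real ((norm (f b))\<^sup>2))"
    by (intro sum.cong refl)
       (simp only: cinner_sum_orthonormal[OF B] complex_norm_square mult.commute)
  finally show ?thesis by (simp only: of_real_sum[symmetric] of_real_eq_iff)
qed

lemma bessel:
  assumes B: "orthonormal B"
  shows "(\<Sum>b\<in>B. (norm (cinner x b))\<^sup>2) \<le> (norm x)\<^sup>2"
proof -
  let ?s = "\<Sum>b\<in>B. cinner x b *\<^sub>C b"
  have "cinner (x - ?s) b = 0" if "b \<in> B" for b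
    by (simp add: cinner_diff_left cinner_sum_orthonormal[OF B that])
  then have "cinner (x - ?s) ?s = 0" by (simp add: cinner_sum_right cinner_scaleC_right)
  from pythagoras[OF this] have "(norm x)\<^sup>2 = (norm (x - ?s))\<^sup>2 + (norm ?s)\<^sup>2" by (simp only: diff_add_cancel)
  then have "(norm ?s)\<^sup>2 \<le> (norm x)\<^sup>2" using zero_le_power2[of "norm (x - ?s)"] by linarith
  then show ?thesis by (simp only: norm_sum_orthonormal[OF B])
qed

lemma gram_schmidt:
  assumes "finite U" "U \<subseteq> M" "complex_subspace M"
  shows "\<exists>B\<subseteq>M. orthonormal B \<and> (\<forall>u\<in>U. u = (\<Sum>b\<in>B. cinner u b *\<^sub>C b))"
  using assms(1,2)
proof (induction U rule: finite_induct)
  case empty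
  show ?case by (intro exI[of _ "{}"]) (simp add: orthonormal_def)
next
  case (insert u U)
  then obtain B where B: "B \<subseteq> M" "orthonormal B" and U: "\<forall>u\<in>U. u = (\<Sum>b\<in>B. cinner u b *\<^sub>C b)"
    by blast
  let ?s = "\<Sum>b\<in>B. cinner u b *\<^sub>C b"
  define r where "r = u - ?s"
  show ?case
  proof (cases "r = 0")
    case True
    then have "u = ?s" by (simp add: r_def)
    then show ?thesis using B U by blast
  next
    case False
    define c where "c = sgn r"
    have c1: "norm c = 1" using False by (simp add: c_def norm_sgn)
    have rc: "r = of_real (norm r) *\<^sub>C c" using False by (simp add: c_def sgn_div_norm scaleC_of_real)
    have cr: "c = of_real (inverse (norm r)) *\<^sub>C r" by (simp only: c_def sgn_div_norm scaleR_scaleC)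
    have rb: "cinner r b = 0" if "b \<in> B" for b
      by (simp add: r_def cinner_diff_left cinner_sum_orthonormal[OF B(2) that])
    then have cb: "cinner c b = 0" "cinner b c = 0" if "b \<in> B" for b
      using that cinner_commute[of b c] by (simp_all add: cr cinner_scaleC_left)
    have cB: "c \<notin> B" using cb(1)[of c] c1 by (auto simp: cinner_self)
    have sM: "?s \<in> M" by (intro complex_subspace_sum complex_subspaceD assms) (use B in blast)
    have "r \<in> M" unfolding r_def by (intro complex_subspaceD(5)[OF assms(3)] sM) (use insert.prems in blast)
    then have "c \<in> M" unfolding cr by (rule complex_subspaceD(3)[OF assms(3)])
    moreover have "orthonormal (insert c B)"
      using B(2) c1 cb by (auto simp: orthonormal_def)
    moreover have "w = (\<Sum>b\<in>insert c B. cinner w b *\<^sub>C b)" if w: "w \<in> insert u U" for w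
    proof -
      have fin: "finite B" using B(2) by (simp add: orthonormal_def)
      have sc: "cinner (\<Sum>b\<in>B. f b *\<^sub>C b) c = 0" for f
        by (simp add: cinner_sum_left cinner_scaleC_left cb)
      show ?thesis
      proof (cases "w \<in> U")
        case True
        then have e: "w = (\<Sum>b\<in>B. cinner w b *\<^sub>C b)" using U by blast
        then have "cinner w c = 0" using sc by metis
        then show ?thesis using e fin cB by simp
      next
        case False
        then have wu: "w = u" using w by simp
        have u: "u = ?s + r" by (simp add: r_def)
        have "cinner u c = cinner r c" by (subst u) (simp only: cinner_add_left sc add_0)
        also have "\<dots> = of_real (norm r)" by (subst rc) (simp add: cinner_scaleC_left cinner_self c1)
        finally have "cinner u c *\<^sub>C c = r" using rc by simp
        then show ?thesis using u fin cB by (simp add: wu add.commute)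
      qed
    qed
    ultimately show ?thesis using B(1) by (intro exI[of _ "insert c B"]) blast
  qed
qed

section \<open>Rectangles in the range\<close>

context schur_projection
begin

text \<open>Approximate the matrix coefficient of \<open>\<Phi>\<close> by a functional \<open>T \<mapsto> \<Sum> \<langle>T (u k), v k\<rangle>\<close> of finite rank, and let
  \<open>G\<close> be the projection onto a finite-dimensional subspace of \<open>M\<close> that contains the projections of
  the \<open>v k\<close> to \<open>M\<close>. This functional has the same value at \<open>T\<close> and at \<open>G T\<close>, which is the sum of the
  operators \<open>rank_one b (T\<^sup>* b)\<close> for an orthonormal basis of that subspace.\<close>

lemma finite_rank_approx:
  assumes T: "T \<in> BH" and M: "closed_subspace M" "\<And>z. blinfun_apply T z \<in> M" and \<eta>: "\<eta> > 0"
  shows "\<exists>B\<subseteq>M. finite B \<and> cinner (T y) x = cinner (blinfun_apply (\<Sum>b\<in>B. rank_one b (adj T b)) y) x \<and>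
    norm (cinner (\<Phi> T y) x - cinner (blinfun_apply (\<Phi> (\<Sum>b\<in>B. rank_one b (adj T b))) y) x) \<le> \<eta>"
proof -
  interpret M: closed_subspace M by fact
  define \<eta>' where "\<eta>' = \<eta> / (2 * (norm T + 1))"
  have \<eta>': "\<eta>' > 0" using \<eta> by (simp add: \<eta>'_def add_nonneg_pos)
  from normal[OF this, of y x] obtain n :: nat and u v where uv: "\<And>T. T \<in> BH \<Longrightarrow>
    norm (cinner (\<Phi> T y) x - (\<Sum>k<n. cinner (blinfun_apply T (u k)) (v k))) \<le> \<eta>' * norm T" by blast
  define V where "V = insert x (v ` {..<n})"
  have "finite (proj M ` V)" "proj M ` V \<subseteq> M" by (auto simp: V_def M.proj_in)
  from gram_schmidt[OF this M.complex_subspace] obtain B where B: "B \<subseteq> M" "orthonormal B"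
    and BV: "\<And>w. w \<in> V \<Longrightarrow> proj M w = (\<Sum>b\<in>B. cinner (proj M w) b *\<^sub>C b)" by blast
  define S where "S = (\<Sum>b\<in>B. rank_one b (adj T b))"
  have SB: "S \<in> BH" by (simp add: S_def)
  have S: "S z = (\<Sum>b\<in>B. cinner (T z) b *\<^sub>C b)" for z
    by (simp add: S_def blinfun.sum_left rank_one_apply cinner_adj[OF T])
  have eq: "cinner (T z) w = cinner (S z) w" if w: "w \<in> V" for z w
  proof -
    have "cinner (T z) w = cinner (proj M (T z)) w" by (simp add: M.proj_id M(2))
    also have "\<dots> = cinner (T z) (proj M w)" by (rule M.proj_adjoint)
    also have "\<dots> = (\<Sum>b\<in>B. cnj (cinner (proj M w) b) * cinner (T z) b)"
      by (subst BV[OF w]) (simp only: cinner_sum_right cinner_scaleC_right)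
    also have "\<dots> = (\<Sum>b\<in>B. cinner (T z) b * cinner b w)"
    proof (intro sum.cong refl)
      fix b assume "b \<in> B"
      then have "cinner (proj M w) b = cinner w b"
        using B(1) by (auto simp: M.proj_adjoint M.proj_id)
      then show "cnj (cinner (proj M w) b) * cinner (T z) b = cinner (T z) b * cinner b w"
        by (simp add: cinner_commute[of b w])
    qed
    also have "\<dots> = cinner (S z) w" by (simp only: S cinner_sum_left cinner_scaleC_left)
    finally show ?thesis .
  qed
  have nS: "norm S \<le> norm T"
  proof (rule norm_blinfun_bound)
    fix z
    have "(norm (S z))\<^sup>2 \<le> (norm (T z))\<^sup>2"
      unfolding S norm_sum_orthonormal[OF B(2)] by (rule bessel[OF B(2)])
    then have "norm (S z) \<le> norm (T z)" by (rule power2_le_imp_le) simp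
    then show "norm (S z) \<le> norm T * norm z" using norm_blinfun[of T z] by linarith
  qed simp
  define a where "a = (\<Sum>k<n. cinner (T (u k)) (v k))"
  have a': "a = (\<Sum>k<n. cinner (S (u k)) (v k))"
    unfolding a_def by (intro sum.cong refl eq) (simp add: V_def)
  have "norm (cinner (\<Phi> T y) x - cinner (\<Phi> S y) x)
    = norm ((cinner (\<Phi> T y) x - a) - (cinner (\<Phi> S y) x - a))" by simp
  also have "\<dots> \<le> norm (cinner (\<Phi> T y) x - a) + norm (cinner (\<Phi> S y) x - a)" by (rule norm_triangle_ineq4)
  also have "\<dots> \<le> \<eta>' * norm T + \<eta>' * norm S"
    using uv[OF T] uv[OF SB] by (intro add_mono) (simp_all add: a_def[symmetric] a'[symmetric])
  also have "\<dots> \<le> \<eta>' * (norm T + 1) + \<eta>' * (norm T + 1)"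
    using \<eta>' nS by (intro add_mono mult_left_mono) auto
  also have "\<dots> = \<eta>"
    using norm_ge_zero[of T] by (simp add: \<eta>'_def field_simps add_nonneg_eq_0_iff)
  finally show ?thesis
    using B eq[of x y] by (intro exI[of _ B]) (simp add: S_def V_def orthonormal_def)
qed

text \<open>The ranges of \<open>p\<close> and \<open>q\<close> consist of all \<open>a\<close> with \<open>rank_one a v\<close> in the range of \<open>\<Phi>\<close> and of all \<open>b\<close>
  with \<open>rank_one u b\<close> there. Completing corners shows that every \<open>rank_one a b\<close> is then in the range of
  \<open>\<Phi>\<close>, and that the operators in this range and their adjoints exchange the two subspaces.\<close>

lemma rectangle:
  assumes uv: "rank_one u v \<in> R" and u: "u \<noteq> 0" and v: "v \<noteq> 0"
  obtains p q where "p \<in> D" "q \<in> D" "adj p = p" "p o\<^sub>L p = p" "adj q = q" "q o\<^sub>L q = q" "p u = u"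
    "\<And>X. X \<in> R \<Longrightarrow> p o\<^sub>L X = X o\<^sub>L q" "\<And>T. T \<in> BH \<Longrightarrow> p o\<^sub>L T o\<^sub>L q \<in> R"
proof -
  define E where "E = {a. rank_one a v \<in> R}"
  define F where "F = {b. rank_one u b \<in> R}"
  interpret E: closed_subspace E unfolding E_def by (rule closed_subspace_rows)
  interpret F: closed_subspace F unfolding F_def by (rule closed_subspace_columns)
  have pD: "proj E \<in> D" "proj F \<in> D"
    using proj_mem[OF E.closed_subspace_axioms] proj_mem[OF F.closed_subspace_axioms]
      rows_inv columns_inv by (auto simp: E_def F_def)
  have EF: "rank_one a b \<in> R" if "a \<in> E" "b \<in> F" for a b
    by (rule fourth_corner[OF uv _ _ u v]) (use that in \<open>simp_all add: E_def F_def\<close>)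
  have XF: "X b \<in> E" if X: "X \<in> R" and b: "b \<in> F" for X b
  proof (cases "b = 0")
    case False
    have ub: "rank_one u b \<in> R" using b by (simp add: F_def)
    have "rank_one (X b) b \<in> R" by (rule rank_one_step[OF ub u X])
    then show ?thesis unfolding E_def using fourth_corner[OF ub _ uv u False] by simp
  qed (simp add: E_def)
  have XE: "adj X a \<in> F" if X: "X \<in> R" and a: "a \<in> E" for X a
  proof (cases "a = 0")
    case False
    have av: "rank_one a v \<in> R" using a by (simp add: E_def)
    have "rank_one a (adj X a) \<in> R" by (rule rank_one_step_adj[OF av v X])
    then show ?thesis unfolding F_def using fourth_corner[OF av uv _ False v] by simp
  qed (simp add: F_def)
  have PX: "proj E o\<^sub>L X = X o\<^sub>L proj F" if X: "X \<in> R" for X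
  proof -
    have XB: "X \<in> BH" by (rule R_BH[OF X])
    have 1: "proj E (X (proj F z)) = X (proj F z)" for z by (intro E.proj_id XF[OF X] F.proj_in)
    have 2: "proj F (adj X (proj E w)) = adj X (proj E w)" for w by (intro F.proj_id XE[OF X] E.proj_in)
    have "proj E (X z) = X (proj F z)" for z
    proof (rule cinner_left_eqI)
      fix w
      have "cinner (proj E (X z)) w = cinner z (adj X (proj E w))"
        by (simp add: E.proj_adjoint cinner_adj[OF XB])
      also have "\<dots> = cinner z (proj F (adj X (proj E w)))" by (simp only: 2)
      also have "\<dots> = cinner (proj E (X (proj F z))) w"
        by (simp only: F.proj_adjoint[symmetric] E.proj_adjoint cinner_adj[OF XB])
      finally show "cinner (proj E (X z)) w = cinner (X (proj F z)) w" by (simp only: 1)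
    qed
    then show ?thesis by (intro blinfun_eqI) simp
  qed
  have PTQ: "proj E o\<^sub>L T o\<^sub>L proj F \<in> R" if T: "T \<in> BH" for T
  proof -
    define S where "S = proj E o\<^sub>L T o\<^sub>L proj F"
    have SB: "S \<in> BH" by (simp add: S_def T E.proj_BH F.proj_BH)
    have "\<Phi> S = S"
    proof (rule blinfun_eqI, rule cinner_left_eqI)
      fix y x
      have "norm (cinner (\<Phi> S y) x - cinner (S y) x) \<le> \<eta>" if \<eta>: "\<eta> > 0" for \<eta>
      proof -
        from finite_rank_approx[OF SB E.closed_subspace_axioms _ \<eta>, of y x] obtain B where B: "B \<subseteq> E" "finite B"
          and B1: "cinner (S y) x = cinner ((\<Sum>b\<in>B. rank_one b (adj S b)) y) x"
          and B2: "norm (cinner (\<Phi> S y) x - cinner (\<Phi> (\<Sum>b\<in>B. rank_one b (adj S b)) y) x) \<le> \<eta>"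
          by (auto simp: S_def E.proj_in)
        have "rank_one b (adj S b) \<in> R" if "b \<in> B" for b
        proof (rule EF)
          show "b \<in> E" using that B by blast
          show "adj S b \<in> F"
            by (simp add: S_def adj_comp T E.proj_BH F.proj_BH F.adj_proj F.proj_in)
        qed
        then have "\<Phi> (\<Sum>b\<in>B. rank_one b (adj S b)) = (\<Sum>b\<in>B. rank_one b (adj S b))"
          by (simp add: Phi_sum R_fix)
        then show ?thesis using B1 B2 by simp
      qed
      then have "norm (cinner (\<Phi> S y) x - cinner (S y) x) \<le> 0" by (rule field_le_epsilon[of _ 0, simplified])
      then show "cinner (\<Phi> S y) x = cinner (S y) x" by simp
    qed
    then show ?thesis using SB by (simp add: R_def S_def)
  qed
  show ?thesis
  proof (rule that[OF pD E.adj_proj E.proj_idem F.adj_proj F.proj_idem])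
    show "proj E u = u" by (rule E.proj_id) (simp add: E_def uv)
  qed (rule PX PTQ, assumption)+
qed

end

section \<open>Conjugation and the trace norm\<close>

context masa_algebra
begin

text \<open>If \<open>p \<in> D\<close> is the projection onto \<open>cyc z\<close>, then \<open>w = z + (u - p u)\<close> recovers \<open>z = p w\<close> and hence \<open>u\<close>.\<close>

lemma finite_cyclic: "finite U \<Longrightarrow> \<exists>z. U \<subseteq> cyc z"
proof (induction U rule: finite_induct)
  case (insert u U)
  then obtain z where z: "U \<subseteq> cyc z" by blast
  define w where "w = z + (u - cyc_proj z u)"
  have 1: "cyc_proj z w = z" by (simp add: w_def apply_simps cyc_proj_id cyc_proj_in)
  have zw: "z \<in> cyc w" using cyc_base[OF cyc_proj_mem, of z w] by (simp add: 1)
  have sub: "cyc z \<subseteq> cyc w"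
    by (rule cyc_minimal) (use closed_subspace_cyc[of w] cyc_inv zw in \<open>auto simp: closed_subspace_def\<close>)
  have cs: "complex_subspace (cyc w)" using closed_subspace_cyc[of w] by (simp add: closed_subspace_def)
  have "w - z \<in> cyc w" "cyc_proj z u \<in> cyc w"
    using complex_subspaceD(5)[OF cs cyc_self zw] cyc_proj_in sub by blast+
  then have "(w - z) + cyc_proj z u \<in> cyc w" by (rule complex_subspaceD(2)[OF cs])
  then have "u \<in> cyc w" by (simp add: w_def)
  then show ?case using z sub by (intro exI[of _ w]) blast
qed simp

lemma cinner_adj_adj:
  assumes "a \<in> D" "b \<in> D"
  shows "cinner (adj a z) (adj b z) = cinner (blinfun_apply b z) (blinfun_apply a z)"
proof -
  have "cinner (adj a z) (adj b z) = cinner ((b o\<^sub>L adj a) z) z"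
    by (simp add: cinner_adj D_BH assms)
  also have "b o\<^sub>L adj a = adj a o\<^sub>L b" by (intro D_commute D_adj assms)
  also have "cinner ((adj a o\<^sub>L b) z) z = cinner (b z) (a z)"
    by (simp add: cinner_adj' D_BH assms)
  finally show ?thesis .
qed

text \<open>On \<open>cyc z\<close> the map \<open>a z \<mapsto> a\<^sup>* z\<close> extends to a conjugation, because \<open>D\<close> consists of normal
  operators. It is represented by its graph.\<close>

definition conj_pair :: "'a \<Rightarrow> 'a \<Rightarrow> 'a \<Rightarrow> bool" where
  "conj_pair z x x' \<longleftrightarrow> (\<exists>a. (\<forall>n. a n \<in> D) \<and> (\<lambda>n. blinfun_apply (a n) z) \<longlonglongrightarrow> x \<and>
     (\<lambda>n. blinfun_apply (adj (a n)) z) \<longlonglongrightarrow> x')"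

lemma conj_pair_exists:
  assumes "x \<in> cyc z" shows "\<exists>x'. conj_pair z x x'"
proof -
  obtain f where f: "\<forall>n. f n \<in> (\<lambda>A. blinfun_apply A z) ` D" "f \<longlonglongrightarrow> x"
    using assms unfolding cyc_def closure_sequential by blast
  then have "\<forall>n. \<exists>A. A \<in> D \<and> f n = blinfun_apply A z" by blast
  then obtain a where a: "\<And>n. a n \<in> D" "\<And>n. f n = blinfun_apply (a n) z" by metis
  have d: "dist (adj (a m) z) (adj (a n) z) = dist (f m) (f n)" for m n
  proof -
    let ?c = "a m - a n"
    have "adj ?c z = adj (a m) z - adj (a n) z" by (simp add: adj_diff a D_BH apply_simps)
    moreover have "cinner (adj ?c z) (adj ?c z) = cinner (?c z) (?c z)"
      by (intro cinner_adj_adj D_diff a)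
    then have "norm (adj ?c z) = norm (?c z)"
      by (simp only: cinner_self of_real_eq_iff power2_eq_iff_nonneg norm_ge_zero)
    ultimately show ?thesis by (simp add: dist_norm a apply_simps)
  qed
  have "Cauchy f" using f(2) by (rule LIMSEQ_imp_Cauchy)
  then have "Cauchy (\<lambda>n. adj (a n) z)" unfolding Cauchy_def d .
  then obtain x' where "(\<lambda>n. adj (a n) z) \<longlonglongrightarrow> x'"
    by (auto simp: Cauchy_convergent_iff convergent_def)
  moreover have "(\<lambda>n. a n z) \<longlonglongrightarrow> x" using f(2) by (simp add: a(2)[symmetric])
  ultimately show ?thesis unfolding conj_pair_def using a(1) by blast
qed

lemma conj_pair_cinner:
  assumes "conj_pair z x x'" "conj_pair z y y'"
  shows "cinner x' y' = cinner y x"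
proof -
  obtain a where a: "\<forall>n. a n \<in> D" "(\<lambda>n. blinfun_apply (a n) z) \<longlonglongrightarrow> x" "(\<lambda>n. adj (a n) z) \<longlonglongrightarrow> x'"
    using assms(1) by (auto simp: conj_pair_def)
  obtain b where b: "\<forall>n. b n \<in> D" "(\<lambda>n. blinfun_apply (b n) z) \<longlonglongrightarrow> y" "(\<lambda>n. adj (b n) z) \<longlonglongrightarrow> y'"
    using assms(2) by (auto simp: conj_pair_def)
  have "(\<lambda>n. cinner (adj (a n) z) (adj (b n) z)) \<longlonglongrightarrow> cinner x' y'" by (intro tendsto_intros a b)
  moreover have "(\<lambda>n. cinner (b n z) (a n z)) \<longlonglongrightarrow> cinner y x" by (intro tendsto_intros a b)
  moreover have "(\<lambda>n. cinner (adj (a n) z) (adj (b n) z)) = (\<lambda>n. cinner (b n z) (a n z))"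
    using cinner_adj_adj a(1) b(1) by blast
  ultimately show ?thesis using LIMSEQ_unique by metis
qed

end

context schur_projection
begin

text \<open>Both sides are matrix coefficients of \<open>\<Phi> (rank_one z t)\<close>, and they agree because \<open>D\<close> is
  commutative.\<close>

lemma flip:
  assumes "a \<in> D" "b \<in> D" "c \<in> D" "e \<in> D"
  shows "cinner (\<Phi> (rank_one (blinfun_apply a z) (blinfun_apply c t)) (blinfun_apply e t)) (blinfun_apply b z)
    = cinner (\<Phi> (rank_one (adj b z) (adj e t)) (adj c t)) (adj a z)"
proof -
  define W where "W = \<Phi> (rank_one z t)"
  have WB: "W \<in> BH" by (simp add: W_def maps)
  have *: "\<Phi> (rank_one (blinfun_apply f z) (blinfun_apply g t)) = f o\<^sub>L W o\<^sub>L adj g" if "f \<in> D" "g \<in> D" for f g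
  proof -
    have "rank_one (f z) (g t) = f o\<^sub>L rank_one z t o\<^sub>L adj g"
      using that by (simp add: comp_rank_one rank_one_comp D_BH D_adj)
    then show ?thesis using that by (simp add: module D_adj W_def)
  qed
  have "cinner (\<Phi> (rank_one (a z) (c t)) (e t)) (b z) = cinner (W ((adj c o\<^sub>L e) t)) ((adj a o\<^sub>L b) z)"
    using assms by (simp add: * cinner_adj D_BH)
  also have "\<dots> = cinner (W ((e o\<^sub>L adj c) t)) ((b o\<^sub>L adj a) z)"
    using assms by (simp only: D_commute[of "adj c" e] D_commute[of "adj a" b] D_adj)
  also have "\<dots> = cinner (\<Phi> (rank_one (adj b z) (adj e t)) (adj c t)) (adj a z)"
    using assms by (simp add: * D_adj cinner_adj' D_BH)
  finally show ?thesis .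
qed

lemma flip_conj:
  assumes "conj_pair z x x'" "conj_pair z w w'" "conj_pair t y y'" "conj_pair t v v'"
  shows "cinner (\<Phi> (rank_one x y) v) w = cinner (\<Phi> (rank_one w' v') y') x'"
proof -
  obtain a where a: "\<forall>n. a n \<in> D" "(\<lambda>n. blinfun_apply (a n) z) \<longlonglongrightarrow> x" "(\<lambda>n. adj (a n) z) \<longlonglongrightarrow> x'"
    using assms(1) by (auto simp: conj_pair_def)
  obtain b where b: "\<forall>n. b n \<in> D" "(\<lambda>n. blinfun_apply (b n) z) \<longlonglongrightarrow> w" "(\<lambda>n. adj (b n) z) \<longlonglongrightarrow> w'"
    using assms(2) by (auto simp: conj_pair_def)
  obtain c where c: "\<forall>n. c n \<in> D" "(\<lambda>n. blinfun_apply (c n) t) \<longlonglongrightarrow> y" "(\<lambda>n. adj (c n) t) \<longlonglongrightarrow> y'"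
    using assms(3) by (auto simp: conj_pair_def)
  obtain e where e: "\<forall>n. e n \<in> D" "(\<lambda>n. blinfun_apply (e n) t) \<longlonglongrightarrow> v" "(\<lambda>n. adj (e n) t) \<longlonglongrightarrow> v'"
    using assms(4) by (auto simp: conj_pair_def)
  have 1: "(\<lambda>n. \<Phi> (rank_one (a n z) (c n t))) \<longlonglongrightarrow> \<Phi> (rank_one x y)"
    by (intro tendsto_Phi rank_one_BH tendsto_rank_one a c)
  have 2: "(\<lambda>n. \<Phi> (rank_one (adj (b n) z) (adj (e n) t))) \<longlonglongrightarrow> \<Phi> (rank_one w' v')"
    by (intro tendsto_Phi rank_one_BH tendsto_rank_one b e)
  have lhs: "(\<lambda>n. cinner (\<Phi> (rank_one (a n z) (c n t)) (e n t)) (b n z)) \<longlonglongrightarrow> cinner (\<Phi> (rank_one x y) v) w"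
    by (intro tendsto_cinner blinfun.tendsto 1 b e)
  have rhs: "(\<lambda>n. cinner (\<Phi> (rank_one (adj (b n) z) (adj (e n) t)) (adj (c n) t)) (adj (a n) z))
      \<longlonglongrightarrow> cinner (\<Phi> (rank_one w' v') y') x'"
    by (intro tendsto_cinner blinfun.tendsto 2 a c)
  have "(\<lambda>n. cinner (\<Phi> (rank_one (a n z) (c n t)) (e n t)) (b n z))
    = (\<lambda>n. cinner (\<Phi> (rank_one (adj (b n) z) (adj (e n) t)) (adj (c n) t)) (adj (a n) z))"
    by (intro ext flip) (use a(1) b(1) c(1) e(1) in blast)+
  with lhs have "(\<lambda>n. cinner (\<Phi> (rank_one (adj (b n) z) (adj (e n) t)) (adj (c n) t)) (adj (a n) z))
      \<longlonglongrightarrow> cinner (\<Phi> (rank_one x y) v) w" by (simp only:)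
  then show ?thesis using rhs by (rule LIMSEQ_unique)
qed

text \<open>The conjugations exchange the roles of the four vectors in \<open>\<langle>\<Phi> (rank_one x y) z, w\<rangle>\<close>. So the
  contractivity of \<open>\<Phi>\<close> also bounds the sum of the first two singular values of \<open>\<Phi> (rank_one x y)\<close>.\<close>

lemma trace_bound:
  assumes nx: "norm x \<le> 1" and ny: "norm y \<le> 1"
    and z: "norm z\<^sub>1 = 1" "norm z\<^sub>2 = 1" "cinner z\<^sub>1 z\<^sub>2 = 0"
    and w: "norm w\<^sub>1 = 1" "norm w\<^sub>2 = 1" "cinner w\<^sub>1 w\<^sub>2 = 0"
  shows "norm (cinner (\<Phi> (rank_one x y) z\<^sub>1) w\<^sub>1 + cinner (\<Phi> (rank_one x y) z\<^sub>2) w\<^sub>2) \<le> 1"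
proof -
  obtain r where r: "{x, w\<^sub>1, w\<^sub>2} \<subseteq> cyc r" using finite_cyclic[of "{x, w\<^sub>1, w\<^sub>2}"] by auto
  obtain t where t: "{y, z\<^sub>1, z\<^sub>2} \<subseteq> cyc t" using finite_cyclic[of "{y, z\<^sub>1, z\<^sub>2}"] by auto
  obtain x' where x': "conj_pair r x x'" using r conj_pair_exists by blast
  obtain v\<^sub>1 where v1: "conj_pair r w\<^sub>1 v\<^sub>1" using r conj_pair_exists by blast
  obtain v\<^sub>2 where v2: "conj_pair r w\<^sub>2 v\<^sub>2" using r conj_pair_exists by blast
  obtain y' where y': "conj_pair t y y'" using t conj_pair_exists by blast
  obtain u\<^sub>1 where u1: "conj_pair t z\<^sub>1 u\<^sub>1" using t conj_pair_exists by blast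
  obtain u\<^sub>2 where u2: "conj_pair t z\<^sub>2 u\<^sub>2" using t conj_pair_exists by blast
  have nrm: "norm p' = norm p" if "conj_pair s p p'" for s p p'
    using conj_pair_cinner[OF that that]
    by (simp only: cinner_self of_real_eq_iff power2_eq_iff_nonneg norm_ge_zero)
  have v12: "cinner v\<^sub>1 v\<^sub>2 = 0" "cinner u\<^sub>2 u\<^sub>1 = 0"
    using conj_pair_cinner[OF v1 v2] conj_pair_cinner[OF u2 u1] w(3) z(3) cinner_commute[of w\<^sub>2 w\<^sub>1]
    by simp_all
  define S where "S = rank_one v\<^sub>1 u\<^sub>1 + rank_one v\<^sub>2 u\<^sub>2"
  have "norm S \<le> 1"
  proof (rule norm_blinfun_bound)
    fix p
    have ne: "u\<^sub>1 \<noteq> u\<^sub>2" using v12(2) nrm[OF u1] z(1) by (auto simp: cinner_self)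
    have ons: "orthonormal {u\<^sub>1, u\<^sub>2}"
      using v12(2) cinner_commute[of u\<^sub>1 u\<^sub>2] nrm[OF u1] nrm[OF u2] z by (auto simp: orthonormal_def)
    have "S p = cinner p u\<^sub>1 *\<^sub>C v\<^sub>1 + cinner p u\<^sub>2 *\<^sub>C v\<^sub>2" by (simp add: S_def apply_simps rank_one_apply)
    moreover have "cinner (cinner p u\<^sub>1 *\<^sub>C v\<^sub>1) (cinner p u\<^sub>2 *\<^sub>C v\<^sub>2) = 0"
      by (simp add: cinner_scaleC_left cinner_scaleC_right v12)
    ultimately have "(norm (S p))\<^sup>2 = (norm (cinner p u\<^sub>1 *\<^sub>C v\<^sub>1))\<^sup>2 + (norm (cinner p u\<^sub>2 *\<^sub>C v\<^sub>2))\<^sup>2"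
      by (simp only: pythagoras)
    also have "\<dots> = (\<Sum>b\<in>{u\<^sub>1, u\<^sub>2}. (norm (cinner p b))\<^sup>2)"
      using ne by (simp add: norm_scaleC nrm[OF v1] nrm[OF v2] w)
    also have "\<dots> \<le> (norm p)\<^sup>2" by (rule bessel[OF ons])
    finally have "norm (S p) \<le> norm p" by (rule power2_le_imp_le) simp
    then show "norm (S p) \<le> 1 * norm p" by simp
  qed simp
  have SB: "S \<in> BH" by (simp add: S_def)
  have "cinner (\<Phi> (rank_one x y) z\<^sub>1) w\<^sub>1 + cinner (\<Phi> (rank_one x y) z\<^sub>2) w\<^sub>2 = cinner (\<Phi> S y') x'"
    unfolding flip_conj[OF x' v1 y' u1] flip_conj[OF x' v2 y' u2]
    by (simp add: S_def add apply_simps cinner_add_left)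
  also have "norm \<dots> \<le> norm (\<Phi> S y') * norm x'" by (rule norm_cinner_le)
  also have "\<dots> \<le> 1 * 1"
  proof (rule mult_mono)
    have "norm (\<Phi> S y') \<le> norm (\<Phi> S) * norm y'" by (rule norm_blinfun)
    also have "\<dots> \<le> 1 * 1"
      using contractive[OF SB] \<open>norm S \<le> 1\<close> ny nrm[OF y'] by (intro mult_mono) auto
    finally show "norm (\<Phi> S y') \<le> 1" by simp
    show "norm x' \<le> 1" using nx nrm[OF x'] by simp
  qed simp_all
  finally show ?thesis by simp
qed

end

section \<open>Step vectors in a maximal abelian algebra\<close>

context masa_algebra
begin

text \<open>\<open>1 - Y\<close> is the square root of \<open>1 - B\<close>. The iteration \<open>Y \<mapsto> (B + Y\<^sup>2) / 2\<close> is dominated, step by step,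
  by the scalar iteration \<open>t \<mapsto> (1 + t\<^sup>2) / 2\<close> that increases to \<open>1\<close>.\<close>

lemma square_root:
  assumes B: "B \<in> D" "adj B = B" "norm B \<le> 1"
  obtains Y where "Y \<in> D" "adj Y = Y" "norm Y \<le> 1" "2 *\<^sub>R Y = B + (Y o\<^sub>L Y)"
proof -
  define Y where "Y = rec_nat 0 (\<lambda>_ Z. (1/2) *\<^sub>R (B + (Z o\<^sub>L Z)))"
  have Y0: "Y 0 = 0" and YS: "Y (Suc n) = (1/2) *\<^sub>R (B + (Y n o\<^sub>L Y n))" for n
    by (simp_all add: Y_def)
  define y where "y = rec_nat 0 (\<lambda>_ t. (1/2) * (1 + t\<^sup>2) :: real)"
  have y0: "y 0 = 0" and yS: "y (Suc n) = (1/2) * (1 + (y n)\<^sup>2)" for n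
    by (simp_all add: y_def)
  have YD: "Y n \<in> D \<and> adj (Y n) = Y n" for n
  proof (induction n)
    case 0
    show ?case by (simp add: Y0 D_zero) (rule adjI, simp_all)
  next
    case (Suc n)
    have "Y n o\<^sub>L Y n \<in> D" "adj (Y n o\<^sub>L Y n) = Y n o\<^sub>L Y n"
      using Suc by (simp_all add: D_comp adj_comp D_BH)
    then show ?case
      using B by (simp add: YS D_rscale D_add scaleR_scaleC adj_cscale adj_add D_BH D_cscale)
  qed
  have y_bd: "0 \<le> y n \<and> y n \<le> 1" for n
  proof (induction n)
    case (Suc n)
    then have "(y n)\<^sup>2 \<le> 1" by (simp add: power_le_one)
    then show ?case by (simp add: yS)
  qed (simp add: y0)
  have nY: "norm (Y n) \<le> y n" for n
  proof (induction n)
    case (Suc n)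
    have "norm (Y n o\<^sub>L Y n) \<le> norm (Y n) * norm (Y n)" by (rule norm_blinfun_compose)
    also have "\<dots> \<le> y n * y n" using Suc y_bd by (intro mult_mono) auto
    finally have "norm (B + (Y n o\<^sub>L Y n)) \<le> 1 + y n * y n"
      using B(3) norm_triangle_ineq[of B "Y n o\<^sub>L Y n"] by linarith
    then show ?case by (simp add: YS yS power2_eq_square)
  qed (simp add: Y0 y0)
  have step: "norm (Y (Suc n) - Y n) \<le> y (Suc n) - y n" for n
  proof (induction n)
    case 0
    then show ?case using B(3) by (simp add: YS yS Y0 y0)
  next
    case (Suc n)
    let ?a = "Y (Suc n)" and ?b = "Y n"
    have comm: "?a o\<^sub>L ?b = ?b o\<^sub>L ?a" using YD by (intro D_commute) blast+
    have "(?a o\<^sub>L ?a) - (?b o\<^sub>L ?b) = (?a - ?b) o\<^sub>L (?a + ?b)"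
      by (simp add: blinfun_comp_bilin comm)
    then have "Y (Suc (Suc n)) - ?a = (1/2) *\<^sub>R ((?a - ?b) o\<^sub>L (?a + ?b))"
      unfolding YS[of "Suc n"] by (subst (3) YS) (simp add: scaleR_diff_right[symmetric])
    then have "norm (Y (Suc (Suc n)) - ?a) = (1/2) * norm ((?a - ?b) o\<^sub>L (?a + ?b))" by simp
    also have "norm ((?a - ?b) o\<^sub>L (?a + ?b)) \<le> norm (?a - ?b) * norm (?a + ?b)"
      by (rule norm_blinfun_compose)
    also have "\<dots> \<le> (y (Suc n) - y n) * (y (Suc n) + y n)"
    proof (rule mult_mono[OF Suc])
      show "norm (?a + ?b) \<le> y (Suc n) + y n"
        using norm_triangle_ineq[of ?a ?b] nY[of n] nY[of "Suc n"] by linarith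
      show "0 \<le> y (Suc n) - y n" using Suc norm_ge_zero order_trans by blast
    qed simp
    also have "(1/2) * ((y (Suc n) - y n) * (y (Suc n) + y n)) = y (Suc (Suc n)) - y (Suc n)"
    proof -
      have "2 * y (Suc k) = 1 + (y k)\<^sup>2" for k by (simp add: yS)
      from this[of n] this[of "Suc n"]
      have "2 * (y (Suc (Suc n)) - y (Suc n)) = (y (Suc n))\<^sup>2 - (y n)\<^sup>2" by argo
      also have "(y (Suc n))\<^sup>2 - (y n)\<^sup>2 = (y (Suc n) - y n) * (y (Suc n) + y n)"
        by (simp add: power2_eq_square algebra_simps)
      finally show ?thesis by simp
    qed
    finally show ?case by simp
  qed
  have tele: "norm (Y (n + k) - Y n) \<le> y (n + k) - y n" for n k
  proof (induction k)
    case (Suc k)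
    have "norm (Y (n + Suc k) - Y n) \<le> norm (Y (Suc (n + k)) - Y (n + k)) + norm (Y (n + k) - Y n)"
      using norm_triangle_ineq[of "Y (Suc (n + k)) - Y (n + k)" "Y (n + k) - Y n"] by simp
    then show ?case using Suc step[of "n + k"] by simp
  qed simp
  have "incseq y"
  proof (rule incseq_SucI)
    show "y n \<le> y (Suc n)" for n using step[of n] norm_ge_zero order_trans diff_ge_0_iff_ge by metis
  qed
  then have "convergent y"
    using y_bd by (intro Bseq_monoseq_convergent) (auto simp: monoseq_def incseq_def intro!: BseqI'[of _ 1])
  then have "Cauchy y" by (simp add: Cauchy_convergent_iff)
  have "Cauchy Y"
  proof (rule CauchyI')
    fix e :: real assume "0 < e"
    then obtain M where M: "\<And>m n. m \<ge> M \<Longrightarrow> n \<ge> M \<Longrightarrow> dist (y m) (y n) < e"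
      using \<open>Cauchy y\<close> unfolding Cauchy_def by blast
    have "norm (Y m - Y n) < e" if "m \<ge> M" "n > m" for m n
    proof -
      obtain k where k: "n = m + k" using \<open>n > m\<close> less_imp_add_positive by blast
      have "norm (Y n - Y m) \<le> y n - y m" using tele[of m k] by (simp add: k)
      also have "\<dots> \<le> dist (y n) (y m)" by (simp add: dist_real_def)
      also have "\<dots> < e" using that by (intro M) auto
      finally show ?thesis by (simp add: norm_minus_commute)
    qed
    then show "\<exists>M. \<forall>m\<ge>M. \<forall>n>m. dist (Y m) (Y n) < e" unfolding dist_norm by blast
  qed
  then obtain L where L: "Y \<longlonglongrightarrow> L" by (auto simp: Cauchy_convergent_iff convergent_def)
  have "L \<in> D \<and> adj L = L" using D_selfadjoint_limit[OF _ _ L] YD by blast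
  moreover have "norm L \<le> 1"
  proof (rule LIMSEQ_le_const2)
    show "(\<lambda>n. norm (Y n)) \<longlonglongrightarrow> norm L" by (intro tendsto_intros L)
    show "\<exists>N. \<forall>n\<ge>N. norm (Y n) \<le> 1" using nY y_bd order_trans by blast
  qed
  moreover have "2 *\<^sub>R L = B + (L o\<^sub>L L)"
  proof (rule LIMSEQ_unique)
    show "(\<lambda>n. 2 *\<^sub>R Y (Suc n)) \<longlonglongrightarrow> 2 *\<^sub>R L" by (intro tendsto_intros LIMSEQ_Suc L)
    have "(\<lambda>n. B + (Y n o\<^sub>L Y n)) \<longlonglongrightarrow> B + (L o\<^sub>L L)"
      by (intro tendsto_add tendsto_const bounded_bilinear.tendsto[OF bounded_bilinear_blinfun_compose] L)
    then show "(\<lambda>n. 2 *\<^sub>R Y (Suc n)) \<longlonglongrightarrow> B + (L o\<^sub>L L)" by (simp add: YS)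
  qed
  ultimately show ?thesis using that by blast
qed

definition projection :: "('a \<Rightarrow>\<^sub>L 'a) \<Rightarrow> bool" where
  "projection p \<longleftrightarrow> p \<in> D \<and> adj p = p \<and> p o\<^sub>L p = p"

lemma projection_apply: "projection p \<Longrightarrow> blinfun_apply p (blinfun_apply p x) = blinfun_apply p x"
  unfolding projection_def by (metis blinfun_apply_blinfun_compose)

lemma D_commute_apply: "A \<in> D \<Longrightarrow> B \<in> D \<Longrightarrow> blinfun_apply A (blinfun_apply B x) = blinfun_apply B (blinfun_apply A x)"
  using D_commute[of A B] by (metis blinfun_apply_blinfun_compose)

text \<open>\<open>C = 1 - Y\<close> is the modulus \<open>|A|\<close>. On the closed range of \<open>C + A\<close> the operator \<open>A\<close> agrees with
  \<open>C \<ge> 0\<close>, on the orthogonal complement it agrees with \<open>- C\<close>.\<close>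

lemma sign_projection_aux:
  assumes A: "A \<in> D" "adj A = A" "norm A \<le> 1"
  obtains p where "projection p" "\<And>x. Re (cinner (A (blinfun_apply p x)) (blinfun_apply p x)) \<ge> 0"
    "\<And>x. Re (cinner (A (x - blinfun_apply p x)) (x - blinfun_apply p x)) \<le> 0"
proof -
  define B where "B = id_blinfun - (A o\<^sub>L A)"
  have AB: "A \<in> BH" by (rule D_BH[OF A(1)])
  have nB: "norm B \<le> 1"
  proof (rule norm_blinfun_bound)
    fix x
    have "Re (cinner x (A (A x))) = (norm (A x))\<^sup>2"
      by (metis A(2) AB Re_cinner_self cinner_adj)
    then have "(norm (B x))\<^sup>2 = (norm x)\<^sup>2 - 2 * (norm (A x))\<^sup>2 + (norm (A (A x)))\<^sup>2"
      by (simp add: B_def apply_simps norm_diff_sq)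
    also have "norm (A (A x)) \<le> norm (A x)"
      using norm_blinfun[of A "A x"] A(3) mult_right_mono[OF A(3), of "norm (A x)"] by simp
    then have "(norm (A (A x)))\<^sup>2 \<le> (norm (A x))\<^sup>2" by (intro power_mono) auto
    then have "(norm x)\<^sup>2 - 2 * (norm (A x))\<^sup>2 + (norm (A (A x)))\<^sup>2 \<le> (norm x)\<^sup>2"
      using zero_le_power2[of "norm (A x)"] by linarith
    finally have "norm (B x) \<le> norm x" by (rule power2_le_imp_le) (rule norm_ge_zero)
    then show "norm (B x) \<le> 1 * norm x" by (simp only: mult_1_left)
  qed simp
  have BD: "B \<in> D" "adj B = B"
    using A by (simp_all add: B_def D_diff D_id D_comp adj_diff adj_id adj_comp AB)
  obtain Y where Y: "Y \<in> D" "adj Y = Y" "norm Y \<le> 1" "2 *\<^sub>R Y = B + (Y o\<^sub>L Y)"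
    by (rule square_root[OF BD nB])
  define C where "C = id_blinfun - Y"
  have CD: "C \<in> D" by (simp add: C_def D_diff D_id Y)
  have C2: "C (C x) = A (A x)" for x
  proof -
    have "2 *\<^sub>R Y x = B x + Y (Y x)" using arg_cong[OF Y(4), of "\<lambda>T. blinfun_apply T x"] by (simp add: apply_simps)
    then show ?thesis by (simp add: C_def B_def apply_simps scaleR_2 algebra_simps)
  qed
  have Cpos: "Re (cinner (C x) x) \<ge> 0" for x
  proof -
    have "Re (cinner (Y x) x) \<le> norm (Y x) * norm x"
      using complex_Re_le_cmod norm_cinner_le order_trans by blast
    also have "\<dots> \<le> (1 * norm x) * norm x"
      using norm_blinfun[of Y x] mult_right_mono[OF Y(3), of "norm x"] by (intro mult_right_mono) auto
    finally show ?thesis by (simp add: C_def apply_simps cinner_diff_left Re_cinner_self power2_eq_square)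
  qed
  define Q where "Q = C + A"
  have QD: "Q \<in> D" by (simp add: Q_def D_add CD A)
  have Qadj: "adj Q = Q" by (simp add: Q_def C_def adj_add adj_diff adj_id AB A Y D_BH)
  define M where "M = closure (range (blinfun_apply Q))"
  have csr: "complex_subspace (range (blinfun_apply Q))"
    unfolding complex_subspace_def
  proof (intro conjI ballI allI)
    show "0 \<in> range (blinfun_apply Q)" by (rule range_eqI[of _ _ 0]) simp
    show "x + y \<in> range (blinfun_apply Q)" if "x \<in> range (blinfun_apply Q)" "y \<in> range (blinfun_apply Q)" for x y
      using that by (auto simp: blinfun.add_right[symmetric])
    show "c *\<^sub>C x \<in> range (blinfun_apply Q)" if "x \<in> range (blinfun_apply Q)" for c x
      using that by (auto simp: BH_scaleC[OF D_BH[OF QD], symmetric])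
  qed
  interpret M: closed_subspace M
    by unfold_locales (simp_all add: M_def complex_subspace_closure[OF csr])
  have "proj M \<in> D"
  proof (rule proj_mem[OF M.closed_subspace_axioms])
    fix E x assume E: "E \<in> D" and "x \<in> M"
    then obtain f where f: "\<forall>n. f n \<in> range (blinfun_apply Q)" "f \<longlonglongrightarrow> x"
      unfolding M_def closure_sequential by blast
    have "blinfun_apply E (f n) \<in> range (blinfun_apply Q)" for n
    proof -
      obtain w where "f n = blinfun_apply Q w" using f(1) by blast
      then show ?thesis using D_commute_apply[OF E QD, of w] by simp
    qed
    moreover have "(\<lambda>n. blinfun_apply E (f n)) \<longlonglongrightarrow> E x" by (intro tendsto_intros f(2))
    ultimately show "blinfun_apply E x \<in> M"
      unfolding M_def closure_sequential by (intro exI[of _ "\<lambda>n. blinfun_apply E (f n)"]) simp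
  qed
  then have projection: "projection (proj M)" by (simp add: projection_def M.adj_proj M.proj_idem)
  have onM: "A x = C x" if "x \<in> M" for x
  proof -
    have "closed {x. blinfun_apply A x = blinfun_apply C x}" by (intro closed_Collect_eq continuous_intros)
    moreover have "range (blinfun_apply Q) \<subseteq> {x. blinfun_apply A x = blinfun_apply C x}"
    proof (clarify)
      fix x
      show "A (Q x) = C (Q x)"
        using D_commute_apply[OF A(1) CD, of x] by (simp add: Q_def apply_simps C2 add.commute)
    qed
    ultimately show ?thesis using that closure_minimal[of "range (blinfun_apply Q)"] unfolding M_def by blast
  qed
  have offM: "A x = - C x" if x: "\<And>m. m \<in> M \<Longrightarrow> cinner x m = 0" for x
  proof -
    have "cinner (Q x) w = 0" for w
    proof -
      have "Q w \<in> M" unfolding M_def using closure_subset rangeI by (rule subsetD)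
      then show ?thesis using x by (simp add: cinner_adj[OF D_BH[OF QD]] Qadj)
    qed
    then have "Q x = 0" by (intro cinner_left_eqI) simp
    then show ?thesis by (simp add: Q_def apply_simps eq_neg_iff_add_eq_0 add.commute)
  qed
  show ?thesis
  proof (rule that[OF projection])
    fix x
    show "Re (cinner (A (proj M x)) (proj M x)) \<ge> 0"
      using onM[OF M.proj_in] Cpos by simp
    have "A (x - proj M x) = - C (x - proj M x)" by (rule offM) (rule M.proj_orth)
    then show "Re (cinner (A (x - proj M x)) (x - proj M x)) \<le> 0"
      using Cpos[of "x - proj M x"] by simp
  qed
qed

lemma sign_projection:
  assumes A: "A \<in> D" "adj A = A"
  obtains p where "projection p" "\<And>x. Re (cinner (A (blinfun_apply p x)) (blinfun_apply p x)) \<ge> 0"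
    "\<And>x. Re (cinner (A (x - blinfun_apply p x)) (x - blinfun_apply p x)) \<le> 0"
proof -
  define r where "r = 1 / (norm A + 1)"
  have np: "norm A + 1 > 0" using norm_ge_zero[of A] by linarith
  then have r: "r > 0" by (simp add: r_def)
  have rA: "r *\<^sub>R A \<in> D" "adj (r *\<^sub>R A) = r *\<^sub>R A" "norm (r *\<^sub>R A) \<le> 1"
  proof -
    show "r *\<^sub>R A \<in> D" by (rule D_rscale[OF A(1)])
    show "adj (r *\<^sub>R A) = r *\<^sub>R A" using A by (simp add: scaleR_scaleC adj_cscale D_BH)
    show "norm (r *\<^sub>R A) \<le> 1" using np by (simp add: r_def field_simps)
  qed
  show ?thesis
  proof (rule sign_projection_aux[OF rA])
    fix p assume p: "projection p"
      "\<And>x. Re (cinner ((r *\<^sub>R A) (blinfun_apply p x)) (blinfun_apply p x)) \<ge> 0"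
      "\<And>x. Re (cinner ((r *\<^sub>R A) (x - blinfun_apply p x)) (x - blinfun_apply p x)) \<le> 0"
    have e: "Re (cinner ((r *\<^sub>R A) z) z) = r * Re (cinner (A z) z)" for z
      by (simp add: apply_simps cinner_scaleR_left)
    show thesis
    proof (rule that[OF p(1)])
      fix x
      show "Re (cinner (A (p x)) (p x)) \<ge> 0"
        using p(2)[of x] r unfolding e by (simp only: zero_le_mult_iff) auto
      show "Re (cinner (A (x - p x)) (x - p x)) \<le> 0"
        using p(3)[of x] r unfolding e by (simp only: mult_le_0_iff) auto
    qed
  qed
qed

subsection \<open>Partitions into projections\<close>

definition projection_partition :: "('a \<Rightarrow>\<^sub>L 'a) \<Rightarrow> ('a \<Rightarrow>\<^sub>L 'a) set \<Rightarrow> bool" where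
  "projection_partition q \<P> \<longleftrightarrow> finite \<P> \<and> (\<forall>p\<in>\<P>. projection p \<and> p \<noteq> 0) \<and>
     (\<forall>p\<in>\<P>. \<forall>p'\<in>\<P>. p \<noteq> p' \<longrightarrow> p o\<^sub>L p' = 0) \<and> \<Sum>\<P> = q"

lemma projection_partition_absorb:
  assumes \<P>: "projection_partition q \<P>" and p: "p \<in> \<P>"
  shows "q o\<^sub>L p = p" "p o\<^sub>L q = p"
proof -
  have fin: "finite \<P>" and q: "q = \<Sum>\<P>" using \<P> by (simp_all add: projection_partition_def)
  have "q o\<^sub>L p = (\<Sum>p'\<in>\<P>. p' o\<^sub>L p)"
    unfolding q by (rule blinfun_eqI) (simp add: blinfun.sum_left)
  also have "\<dots> = (\<Sum>p'\<in>\<P>. if p' = p then p else 0)"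
    using \<P> p by (intro sum.cong refl) (auto simp: projection_partition_def projection_def)
  also have "\<dots> = p" using fin p by simp
  finally show "q o\<^sub>L p = p" .
  have "p o\<^sub>L q = (\<Sum>p'\<in>\<P>. p o\<^sub>L p')"
    unfolding q by (rule blinfun_eqI) (simp add: blinfun.sum_left blinfun.sum_right)
  also have "\<dots> = (\<Sum>p'\<in>\<P>. if p' = p then p else 0)"
    using \<P> p by (intro sum.cong refl) (auto simp: projection_partition_def projection_def)
  also have "\<dots> = p" using fin p by simp
  finally show "p o\<^sub>L q = p" .
qed

lemma projection_partition_union:
  assumes p: "projection_partition p \<P>" and q: "projection_partition q \<Q>" and pq: "p o\<^sub>L q = 0" "q o\<^sub>L p = 0"
  shows "projection_partition (p + q) (\<P> \<union> \<Q>)"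
proof -
  have orth: "r o\<^sub>L s = 0 \<and> s o\<^sub>L r = 0" if "r \<in> \<P>" "s \<in> \<Q>" for r s
  proof -
    have "r o\<^sub>L s = (r o\<^sub>L p) o\<^sub>L (q o\<^sub>L s)" using projection_partition_absorb[OF p that(1)] projection_partition_absorb[OF q that(2)] by simp
    also have "\<dots> = (r o\<^sub>L (p o\<^sub>L q)) o\<^sub>L s" by (simp only: comp_assoc)
    finally have 1: "r o\<^sub>L s = 0" by (simp add: pq)
    have "s o\<^sub>L r = (s o\<^sub>L q) o\<^sub>L (p o\<^sub>L r)" using projection_partition_absorb[OF p that(1)] projection_partition_absorb[OF q that(2)] by simp
    also have "\<dots> = (s o\<^sub>L (q o\<^sub>L p)) o\<^sub>L r" by (simp only: comp_assoc)
    finally show ?thesis using 1 by (simp add: pq)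
  qed
  have "r \<notin> \<Q>" if "r \<in> \<P>" for r
  proof
    assume "r \<in> \<Q>"
    then have "r o\<^sub>L r = 0" using orth[OF that] by blast
    moreover have "projection r" "r \<noteq> 0" using p that by (auto simp: projection_partition_def)
    ultimately show False by (simp add: projection_def)
  qed
  then have "\<P> \<inter> \<Q> = {}" by blast
  then have "\<Sum>(\<P> \<union> \<Q>) = p + q"
    using p q by (simp add: projection_partition_def sum.union_disjoint)
  moreover have "\<forall>r\<in>\<P> \<union> \<Q>. \<forall>s\<in>\<P> \<union> \<Q>. r \<noteq> s \<longrightarrow> r o\<^sub>L s = 0"
  proof (intro ballI impI)
    fix r s assume "r \<in> \<P> \<union> \<Q>" "s \<in> \<P> \<union> \<Q>" "r \<noteq> s"
    then show "r o\<^sub>L s = 0" using p q orth[of r s] orth[of s r] by (auto simp: projection_partition_def)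
  qed
  moreover have "finite (\<P> \<union> \<Q>)" "\<forall>r\<in>\<P> \<union> \<Q>. projection r \<and> r \<noteq> 0" using p q by (auto simp: projection_partition_def)
  ultimately show ?thesis by (simp only: projection_partition_def)
qed

lemma projection_partition_empty: "projection_partition 0 {}" by (simp add: projection_partition_def)

lemma projection_partition_single:
  assumes "projection q" shows "\<exists>\<P>. projection_partition q \<P> \<and> \<P> \<subseteq> {q}"
proof (cases "q = 0")
  case True
  then show ?thesis using projection_partition_empty by (intro exI[of _ "{}"]) simp
next
  case False
  then show ?thesis using assms by (intro exI[of _ "{q}"]) (simp add: projection_partition_def)
qed

lemma projection_partition_refine:
  assumes q: "projection_partition q \<P>" and ref: "\<And>p. p \<in> \<P> \<Longrightarrow> \<exists>\<Q>. projection_partition p \<Q> \<and> (\<forall>r\<in>\<Q>. G r)"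
  shows "\<exists>\<Q>. projection_partition q \<Q> \<and> (\<forall>r\<in>\<Q>. G r)"
proof -
  have "\<exists>\<Q>. projection_partition (\<Sum>\<R>) \<Q> \<and> (\<forall>r\<in>\<Q>. G r)" if "finite \<R>" "\<R> \<subseteq> \<P>" for \<R>
    using that
  proof (induction \<R> rule: finite_induct)
    case empty
    show ?case using projection_partition_empty by (intro exI[of _ "{}"]) simp
  next
    case (insert p \<R>)
    then obtain \<Q>\<^sub>1 where 1: "projection_partition (\<Sum>\<R>) \<Q>\<^sub>1" "\<forall>r\<in>\<Q>\<^sub>1. G r" by blast
    obtain \<Q>\<^sub>2 where 2: "projection_partition p \<Q>\<^sub>2" "\<forall>r\<in>\<Q>\<^sub>2. G r" using ref insert.prems by blast
    have o: "p o\<^sub>L r = 0 \<and> r o\<^sub>L p = 0" if "r \<in> \<R>" for r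
      using q insert.prems insert.hyps(2) that unfolding projection_partition_def by (metis insert_subset subsetD)
    have "p o\<^sub>L \<Sum>\<R> = (\<Sum>r\<in>\<R>. p o\<^sub>L r)" "\<Sum>\<R> o\<^sub>L p = (\<Sum>r\<in>\<R>. r o\<^sub>L p)"
      by (rule blinfun_eqI, simp add: blinfun.sum_left blinfun.sum_right)+
    then have "p o\<^sub>L \<Sum>\<R> = 0" "\<Sum>\<R> o\<^sub>L p = 0" using o by simp_all
    from projection_partition_union[OF 2(1) 1(1) this] show ?case
      using insert.hyps 1(2) 2(2) by (intro exI[of _ "\<Q>\<^sub>2 \<union> \<Q>\<^sub>1"]) auto
  qed
  moreover have "finite \<P>" "\<Sum>\<P> = q" using q by (simp_all add: projection_partition_def)
  ultimately show ?thesis by (metis subset_refl)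
qed

definition nearly_scalar :: "('a \<Rightarrow>\<^sub>L 'a) \<Rightarrow> real \<Rightarrow> ('a \<Rightarrow>\<^sub>L 'a) \<Rightarrow> bool" where
  "nearly_scalar A \<epsilon> p \<longleftrightarrow> (\<exists>l::real. \<forall>x. norm (A (blinfun_apply p x) - l *\<^sub>R blinfun_apply p x) \<le> \<epsilon> * norm (blinfun_apply p x))"

text \<open>On the range of \<open>p\<close> the quadratic form of \<open>A - (a + \<epsilon>/2)\<close> is bounded by \<open>\<epsilon>/2\<close>. For a selfadjoint
  operator polarisation turns this into a bound of the norm.\<close>

lemma nearly_scalarI:
  assumes A: "A \<in> D" "adj A = A" and p: "projection p"
    and lo: "\<And>x. a * (norm (blinfun_apply p x))\<^sup>2 \<le> Re (cinner (A (blinfun_apply p x)) (blinfun_apply p x))"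
    and hi: "\<And>x. Re (cinner (A (blinfun_apply p x)) (blinfun_apply p x)) \<le> (a + \<epsilon>) * (norm (blinfun_apply p x))\<^sup>2"
  shows "nearly_scalar A \<epsilon> p"
  unfolding nearly_scalar_def
proof (intro exI allI)
  fix x
  define l where "l = a + \<epsilon> / 2"
  define S where "S = A - l *\<^sub>R id_blinfun"
  have SD: "S \<in> D" by (simp add: S_def D_diff A D_rscale D_id)
  have Sadj: "adj S = S"
    using A by (simp add: S_def adj_diff adj_cscale scaleR_scaleC D_BH adj_id)
  have bd: "\<bar>Re (cinner (S (p z)) (p z))\<bar> \<le> \<epsilon> / 2 * (norm (p z))\<^sup>2" for z
  proof -
    have e: "Re (cinner (S w) w) = Re (cinner (A w) w) - l * (norm w)\<^sup>2" for w
      by (simp add: S_def apply_simps cinner_diff_left cinner_scaleR_left Re_cinner_self)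
    define m where "m = \<epsilon> / 2 * (norm (p z))\<^sup>2"
    have "\<epsilon> * (norm (p z))\<^sup>2 = m + m" by (simp add: m_def)
    moreover have "l * (norm (p z))\<^sup>2 = a * (norm (p z))\<^sup>2 + m" by (simp add: l_def m_def algebra_simps)
    ultimately show ?thesis
      using lo[of z] hi[of z] unfolding e m_def[symmetric] distrib_right abs_le_iff by linarith
  qed
  define z where "z = p x"
  have pz: "p z = z" by (simp add: z_def projection_apply[OF p])
  have pS: "p (S z) = S z"
    using D_commute_apply[of p S z] p SD pz by (simp add: projection_def)
  have pol: "4 * Re (cinner (S z) w) = Re (cinner (S (z + w)) (z + w)) - Re (cinner (S (z - w)) (z - w))" for w
  proof -
    have "Re (cinner (S w) z) = Re (cinner (S z) w)"
      by (simp add: cinner_adj D_BH[OF SD] Sadj Re_cinner_commute[of w])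
    then show ?thesis by (simp add: apply_simps cinner_simps)
  qed
  have key: "4 * Re (cinner (S z) w) \<le> \<epsilon> * ((norm z)\<^sup>2 + (norm w)\<^sup>2)" if "p w = w" for w
  proof -
    have "p (z + w) = z + w" "p (z - w) = z - w" using pz that by (simp_all add: apply_simps)
    then have "\<bar>Re (cinner (S (z + w)) (z + w))\<bar> \<le> \<epsilon> / 2 * (norm (z + w))\<^sup>2"
      "\<bar>Re (cinner (S (z - w)) (z - w))\<bar> \<le> \<epsilon> / 2 * (norm (z - w))\<^sup>2"
      using bd[of "z + w"] bd[of "z - w"] by simp_all
    then have "4 * Re (cinner (S z) w) \<le> \<epsilon> / 2 * (norm (z + w))\<^sup>2 + \<epsilon> / 2 * (norm (z - w))\<^sup>2"
      unfolding pol by linarith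
    then have "4 * Re (cinner (S z) w) \<le> \<epsilon> / 2 * ((norm (z + w))\<^sup>2 + (norm (z - w))\<^sup>2)"
      by (simp only: distrib_left)
    also have "\<dots> = \<epsilon> * ((norm z)\<^sup>2 + (norm w)\<^sup>2)" unfolding parallelogram by (simp add: algebra_simps)
    finally show ?thesis .
  qed
  have "norm (S z) \<le> \<epsilon> * norm z"
  proof (cases "S z = 0 \<or> z = 0")
    case True
    have "0 \<le> \<epsilon> * norm z" if "z \<noteq> 0"
    proof -
      have "0 \<le> \<epsilon> / 2 * (norm z)\<^sup>2" using bd[of z] pz abs_ge_zero order_trans by metis
      then show ?thesis using that by (simp add: zero_le_mult_iff)
    qed
    then show ?thesis using True by (cases "z = 0") auto
  next
    case False
    define w where "w = (norm z / norm (S z)) *\<^sub>R S z"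
    have "p w = w" by (simp add: w_def apply_simps pS)
    moreover have "norm w = norm z" using False by (simp add: w_def)
    moreover have "Re (cinner (S z) w) = norm z * norm (S z)"
      using False by (simp add: w_def cinner_scaleR_right Re_cinner_self power2_eq_square)
    ultimately have "4 * (norm z * norm (S z)) \<le> \<epsilon> * (2 * (norm z)\<^sup>2)" using key[of w] by simp
    then have "norm z * (2 * norm (S z)) \<le> norm z * (\<epsilon> * norm z)" by (simp add: power2_eq_square algebra_simps)
    then have "2 * norm (S z) \<le> \<epsilon> * norm z" using False by simp
    then show ?thesis using norm_ge_zero[of "S z"] by linarith
  qed
  then show "norm (A (p x) - l *\<^sub>R p x) \<le> \<epsilon> * norm (p x)" by (simp add: S_def apply_simps z_def)
qed

text \<open>The sign projection of \<open>A - (a + \<epsilon>)\<close> cuts off the part of the spectrum between \<open>a\<close> and \<open>a + \<epsilon>\<close>.\<close>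

lemma interval_partition:
  assumes A: "A \<in> D" "adj A = A" and \<epsilon>: "\<epsilon> > 0" and q: "projection q"
    and lo: "\<And>x. a * (norm (blinfun_apply q x))\<^sup>2 \<le> Re (cinner (A (blinfun_apply q x)) (blinfun_apply q x))"
    and hi: "\<And>x. Re (cinner (A (blinfun_apply q x)) (blinfun_apply q x)) \<le> (a + real n * \<epsilon>) * (norm (blinfun_apply q x))\<^sup>2"
  shows "\<exists>\<P>. projection_partition q \<P> \<and> (\<forall>p\<in>\<P>. nearly_scalar A \<epsilon> p)"
  using q lo hi
proof (induction n arbitrary: q a)
  case 0
  have "nearly_scalar A \<epsilon> q"
  proof (rule nearly_scalarI[OF A 0(1) 0(2)])
    fix x
    have "(a + real 0 * \<epsilon>) * (norm (q x))\<^sup>2 \<le> (a + \<epsilon>) * (norm (q x))\<^sup>2" using \<epsilon> by (intro mult_right_mono) auto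
    then show "Re (cinner (A (q x)) (q x)) \<le> (a + \<epsilon>) * (norm (q x))\<^sup>2" using 0(3)[of x] by linarith
  qed
  then show ?case using projection_partition_single[OF 0(1)] by blast
next
  case (Suc n)
  define S where "S = A - (a + \<epsilon>) *\<^sub>R id_blinfun"
  have "S \<in> D" by (simp add: S_def D_diff D_rscale D_id A)
  moreover have "adj S = S"
    using A by (simp add: S_def adj_diff adj_cscale scaleR_scaleC D_BH adj_id)
  ultimately obtain p where p: "projection p" "\<And>x. Re (cinner (S (blinfun_apply p x)) (blinfun_apply p x)) \<ge> 0"
    "\<And>x. Re (cinner (S (x - blinfun_apply p x)) (x - blinfun_apply p x)) \<le> 0"
    using sign_projection[of S] by blast
  have S: "Re (cinner (S z) z) = Re (cinner (A z) z) - (a + \<epsilon>) * (norm z)\<^sup>2" for z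
    by (simp add: S_def apply_simps cinner_diff_left cinner_scaleR_left Re_cinner_self)
  have pD: "p \<in> D" "adj p = p" "p o\<^sub>L p = p" and qD: "q \<in> D" "adj q = q" "q o\<^sub>L q = q"
    using p(1) Suc.prems(1) by (auto simp: projection_def)
  define r where "r = q o\<^sub>L p"
  define s where "s = q - r"
  have pq: "p o\<^sub>L q = q o\<^sub>L p" by (rule D_commute[OF pD(1) qD(1)])
  have rr: "r o\<^sub>L r = r"
  proof -
    have "r o\<^sub>L r = q o\<^sub>L ((p o\<^sub>L q) o\<^sub>L p)" by (simp only: r_def comp_assoc)
    also have "\<dots> = (q o\<^sub>L q) o\<^sub>L (p o\<^sub>L p)" by (simp only: pq comp_assoc)
    finally show ?thesis by (simp add: pD qD r_def)
  qed
  have qr: "q o\<^sub>L r = r" by (simp add: r_def comp_assoc[symmetric] qD)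
  have rq: "r o\<^sub>L q = r" by (simp only: r_def comp_assoc pq) (simp only: comp_assoc[symmetric] qD)
  have r: "projection r" using rr by (simp add: projection_def r_def D_comp pD qD adj_comp D_BH pq)
  have s: "projection s"
    using r qr rq rr by (simp add: projection_def s_def D_diff qD adj_diff D_BH blinfun_comp_bilin)
  have rs: "r o\<^sub>L s = 0" "s o\<^sub>L r = 0" by (simp_all add: s_def blinfun_comp_bilin qr rq rr)
  have qrx: "q (r x) = r x" and qsx: "q (s x) = s x" and prx: "p (r x) = r x" and psx: "p (s x) = 0" for x
  proof -
    show 1: "q (r x) = r x" using qr by (metis blinfun_apply_blinfun_compose)
    show "q (s x) = s x" using 1 projection_apply[OF Suc.prems(1)] by (simp add: s_def apply_simps)
    have 2: "p (q y) = q (p y)" for y using pq by (metis blinfun_apply_blinfun_compose)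
    show 3: "p (r x) = r x" by (simp add: r_def 2 projection_apply[OF p(1)])
    show "p (s x) = 0" using 3 by (simp add: s_def apply_simps 2) (simp add: r_def)
  qed
  have "\<exists>\<P>. projection_partition r \<P> \<and> (\<forall>p\<in>\<P>. nearly_scalar A \<epsilon> p)"
  proof (rule Suc.IH[OF r, of "a + \<epsilon>"])
    fix x
    show "(a + \<epsilon>) * (norm (r x))\<^sup>2 \<le> Re (cinner (A (r x)) (r x))"
      using p(2)[of "r x"] by (simp add: prx S)
    show "Re (cinner (A (r x)) (r x)) \<le> (a + \<epsilon> + real n * \<epsilon>) * (norm (r x))\<^sup>2"
      using Suc.prems(3)[of "r x"] by (simp add: qrx algebra_simps)
  qed
  then obtain \<P> where \<P>: "projection_partition r \<P>" "\<forall>p\<in>\<P>. nearly_scalar A \<epsilon> p" by blast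
  have "nearly_scalar A \<epsilon> s"
  proof (rule nearly_scalarI[OF A s])
    fix x
    show "a * (norm (s x))\<^sup>2 \<le> Re (cinner (A (s x)) (s x))"
      using Suc.prems(2)[of "s x"] by (simp add: qsx)
    show "Re (cinner (A (s x)) (s x)) \<le> (a + \<epsilon>) * (norm (s x))\<^sup>2"
      using p(3)[of "s x"] by (simp add: psx S)
  qed
  then obtain \<Q> where \<Q>: "projection_partition s \<Q>" "\<forall>p\<in>\<Q>. nearly_scalar A \<epsilon> p" using projection_partition_single[OF s] by blast
  have "projection_partition q (\<P> \<union> \<Q>)" using projection_partition_union[OF \<P>(1) \<Q>(1) rs] by (simp add: s_def)
  then show ?case using \<P>(2) \<Q>(2) by blast
qed

lemma common_partition:
  assumes "finite \<A>" "\<And>A. A \<in> \<A> \<Longrightarrow> A \<in> D \<and> adj A = A" and \<epsilon>: "\<epsilon> > 0"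
  shows "\<exists>\<P>. projection_partition id_blinfun \<P> \<and> (\<forall>p\<in>\<P>. \<forall>A\<in>\<A>. nearly_scalar A \<epsilon> p)"
  using assms(1,2)
proof (induction \<A> rule: finite_induct)
  case empty
  have "projection id_blinfun" by (simp add: projection_def D_id adj_id)
  then show ?case using projection_partition_single by blast
next
  case (insert A \<A>)
  then obtain \<P> where \<P>: "projection_partition id_blinfun \<P>" "\<forall>p\<in>\<P>. \<forall>A\<in>\<A>. nearly_scalar A \<epsilon> p" by blast
  have A: "A \<in> D" "adj A = A" using insert.prems by auto
  show ?case
  proof (rule projection_partition_refine[OF \<P>(1)])
    fix p assume p: "p \<in> \<P>"
    then have projection: "projection p" using \<P>(1) by (simp add: projection_partition_def)
    have bd: "\<bar>Re (cinner (A z) z)\<bar> \<le> norm A * (norm z)\<^sup>2" for z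
    proof -
      have "\<bar>Re (cinner (A z) z)\<bar> \<le> norm (A z) * norm z"
        using abs_Re_le_cmod norm_cinner_le order_trans by blast
      also have "\<dots> \<le> (norm A * norm z) * norm z" by (intro mult_right_mono norm_blinfun) simp
      finally show ?thesis by (simp add: power2_eq_square ac_simps)
    qed
    obtain n :: nat where n: "2 * norm A / \<epsilon> \<le> real n" using real_arch_simple by blast
    have "\<exists>\<Q>. projection_partition p \<Q> \<and> (\<forall>r\<in>\<Q>. nearly_scalar A \<epsilon> r)"
    proof (rule interval_partition[OF A \<epsilon> projection])
      fix x
      show "- norm A * (norm (p x))\<^sup>2 \<le> Re (cinner (A (p x)) (p x))"
        using bd[of "p x"] by (simp add: abs_le_iff)
      have "norm A \<le> - norm A + real n * \<epsilon>" using n \<epsilon> by (simp add: field_simps)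
      then have "norm A * (norm (p x))\<^sup>2 \<le> (- norm A + real n * \<epsilon>) * (norm (p x))\<^sup>2"
        by (intro mult_right_mono) auto
      then show "Re (cinner (A (p x)) (p x)) \<le> (- norm A + real n * \<epsilon>) * (norm (p x))\<^sup>2"
        using bd[of "p x"] by (simp add: abs_le_iff)
    qed
    then obtain \<Q> where \<Q>: "projection_partition p \<Q>" "\<forall>r\<in>\<Q>. nearly_scalar A \<epsilon> r" by blast
    have "nearly_scalar A' \<epsilon> r" if r: "r \<in> \<Q>" and A': "A' \<in> \<A>" for r A'
    proof -
      obtain l where l: "\<And>x. norm (A' (blinfun_apply p x) - l *\<^sub>R blinfun_apply p x) \<le> \<epsilon> * norm (blinfun_apply p x)"
        using \<P>(2) p A' unfolding nearly_scalar_def by blast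
      have "p (r x) = r x" for x using projection_partition_absorb(1)[OF \<Q>(1) r] by (metis blinfun_apply_blinfun_compose)
      then show ?thesis using l unfolding nearly_scalar_def by metis
    qed
    then show "\<exists>\<Q>. projection_partition p \<Q> \<and> (\<forall>r\<in>\<Q>. \<forall>A\<in>insert A \<A>. nearly_scalar A \<epsilon> r)" using \<Q> by blast
  qed
qed


text \<open>If \<open>D\<close> is the algebra of bounded functions acting on an L2 space, the normalised restrictions
  of one function to disjoint sets have this property.\<close>

definition D_orthonormal :: "'a set \<Rightarrow> bool" where
  "D_orthonormal E \<longleftrightarrow> orthonormal E \<and>
     (\<forall>e\<in>E. \<forall>g\<in>E. e \<noteq> g \<longrightarrow> (\<forall>A\<in>D. cinner (blinfun_apply A e) g = 0))"

lemma nearly_scalar_complex: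
  assumes d: "d \<in> D"
    and re: "nearly_scalar ((1/2) *\<^sub>C (d + adj d)) \<epsilon> p"
    and im: "nearly_scalar ((- \<i>/2) *\<^sub>C (d - adj d)) \<epsilon> p"
  shows "\<exists>c. \<forall>x. norm (d (blinfun_apply p x) - c *\<^sub>C blinfun_apply p x) \<le> 2 * \<epsilon> * norm (blinfun_apply p x)"
proof -
  obtain l :: real where l: "\<And>x. norm (((1/2) *\<^sub>C (d + adj d)) (blinfun_apply p x) - l *\<^sub>R blinfun_apply p x)
      \<le> \<epsilon> * norm (blinfun_apply p x)"
    using re unfolding nearly_scalar_def by blast
  obtain m :: real where m: "\<And>x. norm (((- \<i>/2) *\<^sub>C (d - adj d)) (blinfun_apply p x) - m *\<^sub>R blinfun_apply p x)
      \<le> \<epsilon> * norm (blinfun_apply p x)"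
    using im unfolding nearly_scalar_def by blast
  have "norm (d (p x) - (of_real l + \<i> * of_real m) *\<^sub>C p x) \<le> 2 * \<epsilon> * norm (p x)" for x
  proof -
    let ?w = "p x"
    let ?a = "((1/2) *\<^sub>C (d + adj d)) ?w - l *\<^sub>R ?w" and ?b = "((- \<i>/2) *\<^sub>C (d - adj d)) ?w - m *\<^sub>R ?w"
    have "\<i> *\<^sub>C ((- \<i>/2) *\<^sub>C (d - adj d)) ?w = (1/2) *\<^sub>C (d ?w - adj d ?w)"
      by (simp add: apply_simps scaleC_scaleC)
    moreover have "((1/2) *\<^sub>C (d + adj d)) ?w = (1/2) *\<^sub>C (d ?w + adj d ?w)" by (simp add: apply_simps)
    moreover have "(1/2) *\<^sub>C (d ?w + adj d ?w) + (1/2) *\<^sub>C (d ?w - adj d ?w) = d ?w"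
      using scaleC_add_left[of "1/2" "1/2" "d ?w"] by (simp add: scaleC_add_right scaleC_diff_right)
    moreover have "\<i> *\<^sub>C (m *\<^sub>R ?w) = (\<i> * of_real m) *\<^sub>C ?w" by (simp add: scaleR_scaleC scaleC_scaleC)
    ultimately have "d ?w - (of_real l + \<i> * of_real m) *\<^sub>C ?w = ?a + \<i> *\<^sub>C ?b"
      by (simp only: scaleC_diff_right scaleC_add_left scaleC_of_real) (simp add: algebra_simps)
    then have "norm (d ?w - (of_real l + \<i> * of_real m) *\<^sub>C ?w) \<le> norm ?a + norm ?b"
      using norm_triangle_ineq[of ?a "\<i> *\<^sub>C ?b"] by (simp only: norm_scaleC norm_ii mult_1_left)
    also have "\<dots> \<le> \<epsilon> * norm ?w + \<epsilon> * norm ?w" by (rule add_mono[OF l m])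
    finally show ?thesis by simp
  qed
  then show ?thesis by blast
qed

lemma norm_sum_partition:
  assumes \<P>: "projection_partition q \<P>" and v: "\<And>p. p \<in> \<P> \<Longrightarrow> blinfun_apply p (v p) = v p"
  shows "(norm (\<Sum>p\<in>\<P>. v p))\<^sup>2 = (\<Sum>p\<in>\<P>. (norm (v p))\<^sup>2)"
proof (rule norm_sum_Pythagorean)
  show "finite \<P>" using \<P> by (simp add: projection_partition_def)
  show "pairwise (\<lambda>i j. orthogonal (v i) (v j)) \<P>"
  proof (rule pairwiseI)
    fix i j assume ij: "i \<in> \<P>" "j \<in> \<P>" "i \<noteq> j"
    have i: "i \<in> BH" "adj i = i" and z: "i o\<^sub>L j = 0"
      using \<P> ij by (auto simp: projection_partition_def projection_def D_BH)
    have "cinner (v i) (v j) = cinner (blinfun_apply i (v i)) (blinfun_apply j (v j))"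
      using v ij by simp
    also have "\<dots> = cinner (v i) ((i o\<^sub>L j) (v j))" by (simp add: cinner_adj i)
    also have "\<dots> = 0" by (simp add: z)
    finally show "orthogonal (v i) (v j)" by (simp add: orthogonal_def inner_eq_Re_cinner)
  qed
qed

text \<open>Finitely many vectors lie in one cyclic subspace \<open>cyc z\<close>; they are approximated by \<open>d z\<close>
  with \<open>d \<in> D\<close>, and a common partition \<open>\<P>\<close> makes all these \<open>d\<close> nearly scalar on the pieces \<open>p z\<close>.\<close>

lemma step_approximation:
  assumes U: "finite U" and \<eta>: "\<eta> > 0"
  shows "\<exists>E. D_orthonormal E \<and> (\<forall>u\<in>U. \<exists>f. norm (u - (\<Sum>e\<in>E. f e *\<^sub>C e)) \<le> \<eta>)"
proof -
  obtain z where z: "U \<subseteq> cyc z" using finite_cyclic[OF U] by blast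
  have "\<exists>d\<in>D. norm (u - blinfun_apply d z) \<le> \<eta> / 2" if "u \<in> U" for u
  proof -
    have "u \<in> closure ((\<lambda>A. blinfun_apply A z) ` D)" using z that by (auto simp: cyc_def)
    then obtain y where "y \<in> (\<lambda>A. blinfun_apply A z) ` D" "dist y u < \<eta> / 2"
      unfolding closure_approachable using \<eta> half_gt_zero by blast
    then show ?thesis by (auto simp: dist_norm norm_minus_commute intro: less_imp_le)
  qed
  then obtain d where d: "\<And>u. u \<in> U \<Longrightarrow> d u \<in> D" "\<And>u. u \<in> U \<Longrightarrow> norm (u - blinfun_apply (d u) z) \<le> \<eta> / 2"
    by metis
  define re where "re u = (1/2) *\<^sub>C (d u + adj (d u))" for u
  define im where "im u = (- \<i>/2) *\<^sub>C (d u - adj (d u))" for u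
  have sa: "re u \<in> D \<and> adj (re u) = re u \<and> im u \<in> D \<and> adj (im u) = im u" if "u \<in> U" for u
  proof -
    have D: "d u \<in> D" "adj (d u) \<in> D" "d u \<in> BH" using d(1)[OF that] D_adj D_BH by blast+
    then have "re u \<in> D" "im u \<in> D" by (simp_all only: re_def im_def D_cscale D_add D_diff)
    moreover have "adj (re u) = re u"
      by (simp add: re_def adj_cscale adj_add D add.commute)
    moreover have "adj (im u) = (\<i>/2) *\<^sub>C (adj (d u) - d u)"
      by (simp add: im_def adj_cscale adj_diff D del: scaleC_minus_left)
    moreover have "(\<i>/2) *\<^sub>C (adj (d u) - d u) = im u"
      unfolding im_def by (rule blinfun_eqI) (simp add: apply_simps scaleC_diff_right)
    ultimately show ?thesis by simp
  qed
  define \<epsilon> where "\<epsilon> = \<eta> / (4 * (norm z + 1))"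
  have nz: "norm z + 1 > 0" using norm_ge_zero[of z] by linarith
  have \<epsilon>: "\<epsilon> > 0" using \<eta> nz by (simp add: \<epsilon>_def)
  have \<epsilon>z: "2 * \<epsilon> * norm z \<le> \<eta> / 2"
  proof -
    have "2 * \<epsilon> * norm z \<le> 2 * \<epsilon> * (norm z + 1)" using \<epsilon> by (intro mult_left_mono) auto
    also have "\<dots> = \<eta> / 2" using nz by (simp add: \<epsilon>_def field_simps)
    finally show ?thesis .
  qed
  have "\<exists>\<P>. projection_partition id_blinfun \<P> \<and> (\<forall>p\<in>\<P>. \<forall>A\<in>re ` U \<union> im ` U. nearly_scalar A \<epsilon> p)"
    by (rule common_partition) (use U sa \<epsilon> in auto)
  then obtain \<P> where \<P>: "projection_partition id_blinfun \<P>" and ns: "\<And>p A. p \<in> \<P> \<Longrightarrow> A \<in> re ` U \<union> im ` U \<Longrightarrow> nearly_scalar A \<epsilon> p"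
    by blast
  have pjP: "projection p" if "p \<in> \<P>" for p using \<P> that by (simp add: projection_partition_def)
  have fin: "finite \<P>" using \<P> by (simp add: projection_partition_def)
  have zsum: "z = (\<Sum>p\<in>\<P>. blinfun_apply p z)"
  proof -
    have "z = (\<Sum>\<P>) z" using \<P> by (simp add: projection_partition_def)
    then show ?thesis by (simp add: blinfun.sum_left)
  qed
  define S where "S = {p \<in> \<P>. blinfun_apply p z \<noteq> 0}"
  define h where "h p = sgn (blinfun_apply p z)" for p :: "'a \<Rightarrow>\<^sub>L 'a"
  have ph: "blinfun_apply p (h p) = h p" if "p \<in> \<P>" for p
    using projection_apply[OF pjP[OF that], of z] by (simp add: h_def sgn_div_norm apply_simps)
  have h1: "norm (h p) = 1" if "p \<in> S" for p using that by (simp add: S_def h_def norm_sgn)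
  have SP: "S \<subseteq> \<P>" by (auto simp: S_def)
  have Dorth: "cinner (blinfun_apply A (h p)) (h r) = 0" if "p \<in> \<P>" "r \<in> \<P>" "p \<noteq> r" "A \<in> D" for A p r
  proof -
    have r: "r \<in> D" "adj r = r" "r \<in> BH" using pjP[OF that(2)] by (simp_all add: projection_def D_BH)
    have "cinner (A (h p)) (h r) = cinner (A (p (h p))) (r (h r))" using that ph by simp
    also have "\<dots> = cinner (r (A (p (h p)))) (h r)" by (simp add: cinner_adj r)
    also have "r (A (p (h p))) = A ((r o\<^sub>L p) (h p))" using D_commute_apply[OF r(1) that(4)] by simp
    also have "r o\<^sub>L p = 0" using \<P> that by (auto simp: projection_partition_def)
    finally show ?thesis by simp
  qed
  have inj: "inj_on h S"
  proof (rule inj_onI, rule ccontr)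
    fix p r assume pr: "p \<in> S" "r \<in> S" "h p = h r" "p \<noteq> r"
    then have "cinner (id_blinfun (h p)) (h r) = 0" using SP by (intro Dorth D_id) auto
    then show False using pr h1[of r] by (simp add: cinner_self)
  qed
  have "D_orthonormal (h ` S)"
  proof -
    have "cinner (blinfun_apply A e) g = 0" if "e \<in> h ` S" "g \<in> h ` S" "e \<noteq> g" "A \<in> D" for e g A
      using that SP Dorth by blast
    moreover from this[OF _ _ _ D_id] have "cinner e g = 0" if "e \<in> h ` S" "g \<in> h ` S" "e \<noteq> g" for e g
      using that by simp
    moreover have "finite (h ` S)" using fin by (simp add: S_def)
    ultimately show ?thesis unfolding D_orthonormal_def orthonormal_def using h1 by blast
  qed
  moreover have "\<exists>f. norm (u - (\<Sum>e\<in>h ` S. f e *\<^sub>C e)) \<le> \<eta>" if u: "u \<in> U" for u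
  proof -
    have "\<exists>c. \<forall>x. norm (d u (blinfun_apply p x) - c *\<^sub>C blinfun_apply p x) \<le> 2 * \<epsilon> * norm (blinfun_apply p x)"
      if "p \<in> \<P>" for p
      using ns[OF that, of "re u"] ns[OF that, of "im u"] u
      by (intro nearly_scalar_complex d) (simp_all add: re_def im_def)
    then obtain c where c: "\<And>p x. p \<in> \<P> \<Longrightarrow> norm (d u (blinfun_apply p x) - c p *\<^sub>C blinfun_apply p x)
        \<le> 2 * \<epsilon> * norm (blinfun_apply p x)" by metis
    define f where "f e = c (inv_into S h e) * of_real (norm (blinfun_apply (inv_into S h e) z))" for e
    have "(\<Sum>e\<in>h ` S. f e *\<^sub>C e) = (\<Sum>p\<in>S. f (h p) *\<^sub>C h p)" using inj by (simp add: sum.reindex)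
    also have "\<dots> = (\<Sum>p\<in>S. c p *\<^sub>C blinfun_apply p z)"
    proof (intro sum.cong refl)
      fix p assume p: "p \<in> S"
      have "of_real (norm (p z)) *\<^sub>C h p = p z"
        using p by (simp add: S_def h_def sgn_div_norm scaleC_of_real)
      then show "f (h p) *\<^sub>C h p = c p *\<^sub>C p z"
        using inj p by (simp add: f_def scaleC_scaleC[symmetric])
    qed
    also have "\<dots> = (\<Sum>p\<in>\<P>. c p *\<^sub>C blinfun_apply p z)"
      by (rule sum.mono_neutral_left) (use fin in \<open>auto simp: S_def\<close>)
    finally have fc: "(\<Sum>e\<in>h ` S. f e *\<^sub>C e) = (\<Sum>p\<in>\<P>. c p *\<^sub>C blinfun_apply p z)" .
    define v where "v p = d u (blinfun_apply p z) - c p *\<^sub>C blinfun_apply p z" for p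
    have vp: "blinfun_apply p (v p) = v p" if "p \<in> \<P>" for p
    proof -
      have p: "p \<in> D" "p \<in> BH" using pjP[OF that] by (simp_all add: projection_def D_BH)
      show ?thesis
        using D_commute_apply[OF p(1) d(1)[OF u]] projection_apply[OF pjP[OF that]]
        by (simp add: v_def apply_simps BH_scaleC p)
    qed
    have "d u z - (\<Sum>p\<in>\<P>. c p *\<^sub>C blinfun_apply p z) = (\<Sum>p\<in>\<P>. v p)"
    proof -
      have "blinfun_apply (d u) z = blinfun_apply (d u) (\<Sum>p\<in>\<P>. blinfun_apply p z)"
        by (rule arg_cong[OF zsum])
      then show ?thesis unfolding v_def sum_subtractf by (simp only: blinfun.sum_right)
    qed
    then have "(norm (d u z - (\<Sum>p\<in>\<P>. c p *\<^sub>C blinfun_apply p z)))\<^sup>2 = (\<Sum>p\<in>\<P>. (norm (v p))\<^sup>2)"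
      by (simp only: norm_sum_partition[OF \<P> vp])
    also have "\<dots> \<le> (\<Sum>p\<in>\<P>. (2 * \<epsilon> * norm (blinfun_apply p z))\<^sup>2)"
      unfolding v_def by (intro sum_mono power_mono c norm_ge_zero)
    also have "\<dots> = (2 * \<epsilon>)\<^sup>2 * (\<Sum>p\<in>\<P>. (norm (blinfun_apply p z))\<^sup>2)"
      by (simp only: sum_distrib_left power_mult_distrib)
    also have "(\<Sum>p\<in>\<P>. (norm (blinfun_apply p z))\<^sup>2) = (norm z)\<^sup>2"
    proof -
      have "(norm z)\<^sup>2 = (norm (\<Sum>p\<in>\<P>. blinfun_apply p z))\<^sup>2"
        by (rule arg_cong[OF zsum])
      then show ?thesis using norm_sum_partition[OF \<P> projection_apply[OF pjP]] by (simp only:)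
    qed
    also have "(2 * \<epsilon>)\<^sup>2 * (norm z)\<^sup>2 = (2 * \<epsilon> * norm z)\<^sup>2" by (simp add: power_mult_distrib)
    finally have "norm (d u z - (\<Sum>p\<in>\<P>. c p *\<^sub>C blinfun_apply p z)) \<le> 2 * \<epsilon> * norm z"
      by (rule power2_le_imp_le) (use \<epsilon> in simp)
    then have "norm (d u z - (\<Sum>e\<in>h ` S. f e *\<^sub>C e)) \<le> \<eta> / 2" using \<epsilon>z by (simp add: fc)
    then have "norm ((u - d u z) + (d u z - (\<Sum>e\<in>h ` S. f e *\<^sub>C e))) \<le> \<eta> / 2 + \<eta> / 2"
      using d(2)[OF u] by (intro norm_triangle_le add_mono)
    then show ?thesis by (intro exI[of _ f]) simp
  qed
  ultimately show ?thesis by blast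
qed

end

section \<open>Rank one operators in the range\<close>

context schur_projection
begin

lemma step_functional:
  assumes \<eta>: "\<eta> > 0"
  shows "\<exists>E F c. D_orthonormal E \<and> D_orthonormal F \<and> (\<forall>T\<in>BH.
    norm (cinner (\<Phi> T y) x - (\<Sum>e\<in>E. \<Sum>g\<in>F. c e g * cinner (blinfun_apply T e) g)) \<le> \<eta> * norm T)"
proof -
  have "\<eta> / 2 > 0" using \<eta> by simp
  from normal[OF this, of y x] obtain n :: nat and u v where uv: "\<And>T. T \<in> BH \<Longrightarrow>
    norm (cinner (\<Phi> T y) x - (\<Sum>k<n. cinner (blinfun_apply T (u k)) (v k))) \<le> \<eta> / 2 * norm T" by blast
  define K where "K = (\<Sum>k<n. norm (u k) + norm (v k) + 1)"
  have K: "K \<ge> 0" by (simp add: K_def sum_nonneg)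
  define \<delta> where "\<delta> = min 1 (\<eta> / (2 * (K + 1)))"
  have \<delta>: "0 < \<delta>" "\<delta> \<le> 1" using \<eta> K by (simp_all add: \<delta>_def)
  have \<delta>K: "\<delta> * K \<le> \<eta> / 2"
  proof -
    have "\<delta> * K \<le> \<eta> / (2 * (K + 1)) * (K + 1)" using \<eta> K by (intro mult_mono) (auto simp: \<delta>_def)
    also have "\<dots> = \<eta> / 2" using K by (simp add: field_simps)
    finally show ?thesis .
  qed
  obtain E where E: "D_orthonormal E" "\<And>w. w \<in> u ` {..<n} \<Longrightarrow> \<exists>f. norm (w - (\<Sum>e\<in>E. f e *\<^sub>C e)) \<le> \<delta>"
    using step_approximation[of "u ` {..<n}" \<delta>] \<delta> by auto
  obtain F where F: "D_orthonormal F" "\<And>w. w \<in> v ` {..<n} \<Longrightarrow> \<exists>f. norm (w - (\<Sum>e\<in>F. f e *\<^sub>C e)) \<le> \<delta>"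
    using step_approximation[of "v ` {..<n}" \<delta>] \<delta> by auto
  have "\<forall>k<n. \<exists>f. norm (u k - (\<Sum>e\<in>E. f e *\<^sub>C e)) \<le> \<delta>" using E(2) by blast
  then obtain a where a: "\<And>k. k < n \<Longrightarrow> norm (u k - (\<Sum>e\<in>E. a k e *\<^sub>C e)) \<le> \<delta>" by metis
  have "\<forall>k<n. \<exists>f. norm (v k - (\<Sum>e\<in>F. f e *\<^sub>C e)) \<le> \<delta>" using F(2) by blast
  then obtain b where b: "\<And>k. k < n \<Longrightarrow> norm (v k - (\<Sum>e\<in>F. b k e *\<^sub>C e)) \<le> \<delta>" by metis
  define u' where "u' k = (\<Sum>e\<in>E. a k e *\<^sub>C e)" for k
  define v' where "v' k = (\<Sum>e\<in>F. b k e *\<^sub>C e)" for k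
  define c where "c e g = (\<Sum>k<n. a k e * cnj (b k g))" for e g
  have "norm (cinner (\<Phi> T y) x - (\<Sum>e\<in>E. \<Sum>g\<in>F. c e g * cinner (T e) g)) \<le> \<eta> * norm T" if T: "T \<in> BH" for T
  proof -
    have "(\<Sum>k<n. cinner (T (u' k)) (v' k)) = (\<Sum>k<n. \<Sum>e\<in>E. \<Sum>g\<in>F. a k e * cnj (b k g) * cinner (T e) g)"
      by (simp only: u'_def blinfun.sum_right BH_scaleC[OF T] cinner_sum_left cinner_scaleC_left)
         (simp only: v'_def cinner_sum_right cinner_scaleC_right sum_distrib_left mult.assoc)
    also have "\<dots> = (\<Sum>e\<in>E. \<Sum>k<n. \<Sum>g\<in>F. a k e * cnj (b k g) * cinner (T e) g)" by (rule sum.swap)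
    also have "\<dots> = (\<Sum>e\<in>E. \<Sum>g\<in>F. \<Sum>k<n. a k e * cnj (b k g) * cinner (T e) g)"
      by (intro sum.cong refl sum.swap)
    also have "\<dots> = (\<Sum>e\<in>E. \<Sum>g\<in>F. c e g * cinner (T e) g)" by (simp only: c_def sum_distrib_right)
    finally have s: "(\<Sum>k<n. cinner (T (u' k)) (v' k)) = (\<Sum>e\<in>E. \<Sum>g\<in>F. c e g * cinner (T e) g)" .
    have t: "norm (cinner (T (u k)) (v k) - cinner (T (u' k)) (v' k)) \<le> norm T * (\<delta> * (norm (u k) + norm (v k) + 1))"
      if k: "k < n" for k
    proof -
      have du: "norm (u k - u' k) \<le> \<delta>" and dv: "norm (v k - v' k) \<le> \<delta>"
        using a[OF k] b[OF k] by (simp_all add: u'_def v'_def)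
      have nu: "norm (u' k) \<le> norm (u k) + 1"
        using norm_triangle_ineq2[of "u' k" "u k"] du \<delta> by (simp add: norm_minus_commute)
      have "cinner (T (u k)) (v k) - cinner (T (u' k)) (v' k)
        = cinner (T (u k - u' k)) (v k) + cinner (T (u' k)) (v k - v' k)"
        by (simp add: apply_simps cinner_diff_left cinner_diff_right)
      also have "norm \<dots> \<le> norm (T (u k - u' k)) * norm (v k) + norm (T (u' k)) * norm (v k - v' k)"
        by (intro norm_triangle_le add_mono norm_cinner_le)
      also have "\<dots> \<le> (norm T * \<delta>) * norm (v k) + (norm T * (norm (u k) + 1)) * \<delta>"
      proof (intro add_mono mult_mono)
        show "norm (T (u k - u' k)) \<le> norm T * \<delta>"
          using norm_blinfun[of T "u k - u' k"] mult_left_mono[OF du norm_ge_zero[of T]] by linarith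
        show "norm (T (u' k)) \<le> norm T * (norm (u k) + 1)"
          using norm_blinfun[of T "u' k"] mult_left_mono[OF nu norm_ge_zero[of T]] by linarith
      qed (use dv \<delta> in auto)
      finally show ?thesis by (simp add: algebra_simps)
    qed
    have "norm ((\<Sum>k<n. cinner (T (u k)) (v k)) - (\<Sum>k<n. cinner (T (u' k)) (v' k)))
      \<le> (\<Sum>k<n. norm T * (\<delta> * (norm (u k) + norm (v k) + 1)))"
      unfolding sum_subtractf[symmetric] by (intro sum_norm_le t) simp
    also have "\<dots> = norm T * (\<delta> * K)" by (simp only: K_def sum_distrib_left)
    also have "\<dots> \<le> norm T * (\<eta> / 2)" by (intro mult_left_mono \<delta>K) simp
    finally have "norm ((\<Sum>k<n. cinner (T (u k)) (v k)) - (\<Sum>e\<in>E. \<Sum>g\<in>F. c e g * cinner (T e) g)) \<le> \<eta> / 2 * norm T"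
      by (simp only: s mult.commute)
    then have "norm ((cinner (\<Phi> T y) x - (\<Sum>k<n. cinner (T (u k)) (v k)))
      + ((\<Sum>k<n. cinner (T (u k)) (v k)) - (\<Sum>e\<in>E. \<Sum>g\<in>F. c e g * cinner (T e) g))) \<le> \<eta> / 2 * norm T + \<eta> / 2 * norm T"
      using uv[OF T] by (intro norm_triangle_le add_mono)
    then show ?thesis by simp
  qed
  then show ?thesis using E(1) F(1) by blast
qed


text \<open>This replaces a Lebesgue density point of the pattern of \<open>\<Phi>\<close>. If all the averages
  \<open>Re \<langle>\<Phi> (rank_one g e) e, g\<rangle>\<close> stayed below \<open>9/10\<close>, then testing a good step approximation
  \<open>T \<mapsto> \<Sum> c e g \<langle>T e, g\<rangle>\<close> of a \<open>\<Phi>\<close>-invariant functional at \<open>T = \<Sum> cnj (c e g) rank_one g e\<close> would show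
  that the coefficients \<open>c\<close> are small in the Hilbert-Schmidt norm. Then the functional would vanish on
  operators of rank one.\<close>

lemma exists_dense_rank_one:
  assumes T\<^sub>0: "T\<^sub>0 \<in> BH" "\<Phi> T\<^sub>0 \<noteq> 0"
  shows "\<exists>x y. norm x = 1 \<and> norm y = 1 \<and> 9/10 \<le> Re (cinner (\<Phi> (rank_one x y) y) x)"
proof (rule ccontr)
  assume "\<not> ?thesis"
  then have small: "Re (cinner (\<Phi> (rank_one x y) y) x) \<le> 9/10" if "norm x = 1" "norm y = 1" for x y
    using that by force
  obtain a b where ab: "\<Phi> (rank_one a b) \<noteq> 0"
  proof -
    obtain y where y: "\<Phi> T\<^sub>0 y \<noteq> 0" using T\<^sub>0(2) by (metis blinfun_eqI blinfun.zero_left)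
    define x where "x = \<Phi> T\<^sub>0 y"
    have nz: "cinner (\<Phi> T\<^sub>0 y) x \<noteq> 0" using y by (simp add: x_def cinner_self)
    have "closed_subspace (UNIV :: 'a set)" by unfold_locales simp_all
    from finite_rank_approx[OF T\<^sub>0(1) this UNIV_I, of "norm (cinner (\<Phi> T\<^sub>0 y) x) / 2" y x] nz
    obtain B where B: "finite B" "norm (cinner (\<Phi> T\<^sub>0 y) x - cinner (\<Phi> (\<Sum>b\<in>B. rank_one b (adj T\<^sub>0 b)) y) x)
        \<le> norm (cinner (\<Phi> T\<^sub>0 y) x) / 2" by auto
    have "\<exists>b\<in>B. \<Phi> (rank_one b (adj T\<^sub>0 b)) \<noteq> 0"
    proof (rule ccontr)
      assume "\<not> ?thesis"
      then have "\<Phi> (\<Sum>b\<in>B. rank_one b (adj T\<^sub>0 b)) = 0" by (simp add: Phi_sum)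
      then show False using B(2) nz by simp
    qed
    then show ?thesis using that by blast
  qed
  obtain y where y: "\<Phi> (rank_one a b) y \<noteq> 0" using ab by (metis blinfun_eqI blinfun.zero_left)
  define x where "x = \<Phi> (rank_one a b) y"
  define m where "m = norm (cinner (\<Phi> (rank_one a b) y) x)"
  have m: "m > 0" using y by (simp add: m_def x_def cinner_self)
  define N where "N = norm a * norm b"
  have "a \<noteq> 0" "b \<noteq> 0" using ab by auto
  then have N: "N > 0" by (simp add: N_def)
  \<comment> \<open>The estimates below lose a factor \<open>21 N\<close>; this choice leaves \<open>m \<le> m / 2\<close>.\<close>
  define \<eta> where "\<eta> = m / (42 * N)"
  have \<eta>: "\<eta> > 0" using m N by (simp add: \<eta>_def)
  from step_functional[OF this, of y x] obtain E F c where E: "D_orthonormal E" and F: "D_orthonormal F"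
    and s: "\<And>T. T \<in> BH \<Longrightarrow> norm (cinner (\<Phi> T y) x - (\<Sum>e\<in>E. \<Sum>g\<in>F. c e g * cinner (blinfun_apply T e) g)) \<le> \<eta> * norm T"
    by blast
  have oE: "orthonormal E" and oF: "orthonormal F" using E F by (simp_all add: D_orthonormal_def)
  have fin: "finite E" "finite F" using oE oF by (simp_all add: orthonormal_def)
  define S where "S T = (\<Sum>e\<in>E. \<Sum>g\<in>F. c e g * cinner (blinfun_apply T e) g)" for T
  have inv: "norm (S (\<Phi> T) - S T) \<le> 2 * \<eta> * norm T" if T: "T \<in> BH" for T
  proof -
    have 1: "norm (cinner (\<Phi> T y) x - S (\<Phi> T)) \<le> \<eta> * norm (\<Phi> T)"
      using s[OF maps[OF T]] by (simp add: S_def idem T)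
    have "\<eta> * norm (\<Phi> T) \<le> \<eta> * norm T" using \<eta> contractive[OF T] by (intro mult_left_mono) auto
    then have 2: "norm (cinner (\<Phi> T y) x - S (\<Phi> T)) \<le> \<eta> * norm T" using 1 by linarith
    have "norm ((cinner (\<Phi> T y) x - S T) - (cinner (\<Phi> T y) x - S (\<Phi> T))) \<le> \<eta> * norm T + \<eta> * norm T"
      using s[OF T] 2 norm_triangle_ineq4[of "cinner (\<Phi> T y) x - S T" "cinner (\<Phi> T y) x - S (\<Phi> T)"]
      unfolding S_def[symmetric] by linarith
    then show ?thesis by simp
  qed
  define T\<^sub>1 where "T\<^sub>1 = (\<Sum>e\<in>E. \<Sum>g\<in>F. cnj (c e g) *\<^sub>C rank_one g e)"
  have T1: "T\<^sub>1 \<in> BH" unfolding T\<^sub>1_def by (intro BH_sum BH_cscale rank_one_BH)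
  define h where "h = sqrt (\<Sum>e\<in>E. \<Sum>g\<in>F. (norm (c e g))\<^sup>2)"
  have h0: "h \<ge> 0" and h2: "h\<^sup>2 = (\<Sum>e\<in>E. \<Sum>g\<in>F. (norm (c e g))\<^sup>2)" by (simp_all add: h_def sum_nonneg)
  have T1_apply: "T\<^sub>1 z = (\<Sum>g\<in>F. (\<Sum>e\<in>E. cnj (c e g) * cinner z e) *\<^sub>C g)" for z
  proof -
    have "T\<^sub>1 z = (\<Sum>e\<in>E. \<Sum>g\<in>F. (cnj (c e g) * cinner z e) *\<^sub>C g)"
      by (simp add: T\<^sub>1_def blinfun.sum_left apply_simps rank_one_apply scaleC_scaleC)
    also have "\<dots> = (\<Sum>g\<in>F. \<Sum>e\<in>E. (cnj (c e g) * cinner z e) *\<^sub>C g)" by (rule sum.swap)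
    also have "\<dots> = (\<Sum>g\<in>F. (\<Sum>e\<in>E. cnj (c e g) * cinner z e) *\<^sub>C g)"
    proof (intro sum.cong refl)
      fix g show "(\<Sum>e\<in>E. (cnj (c e g) * cinner z e) *\<^sub>C g) = (\<Sum>e\<in>E. cnj (c e g) * cinner z e) *\<^sub>C g"
        using fin(1) by (induction E rule: finite_induct) (simp_all add: scaleC_add_left)
    qed
    finally show ?thesis .
  qed
  have nT1: "norm T\<^sub>1 \<le> h"
  proof (rule norm_blinfun_bound)
    fix z
    have "(norm (T\<^sub>1 z))\<^sup>2 = (\<Sum>g\<in>F. (norm (\<Sum>e\<in>E. cnj (c e g) * cinner z e))\<^sup>2)"
      unfolding T1_apply by (rule norm_sum_orthonormal[OF oF])
    also have "\<dots> \<le> (\<Sum>g\<in>F. (\<Sum>e\<in>E. (norm (c e g))\<^sup>2) * (norm z)\<^sup>2)"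
    proof (rule sum_mono)
      fix g
      have "norm (\<Sum>e\<in>E. cnj (c e g) * cinner z e) \<le> (\<Sum>e\<in>E. norm (c e g) * norm (cinner z e))"
        by (rule order_trans[OF norm_sum]) (simp add: norm_mult)
      then have "(norm (\<Sum>e\<in>E. cnj (c e g) * cinner z e))\<^sup>2 \<le> (\<Sum>e\<in>E. norm (c e g) * norm (cinner z e))\<^sup>2"
        by (rule power_mono) simp
      also have "\<dots> \<le> (\<Sum>e\<in>E. (norm (c e g))\<^sup>2) * (\<Sum>e\<in>E. (norm (cinner z e))\<^sup>2)"
        by (rule Cauchy_Schwarz_ineq_sum)
      also have "\<dots> \<le> (\<Sum>e\<in>E. (norm (c e g))\<^sup>2) * (norm z)\<^sup>2"
        by (intro mult_left_mono bessel[OF oE] sum_nonneg) simp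
      finally show "(norm (\<Sum>e\<in>E. cnj (c e g) * cinner z e))\<^sup>2 \<le> (\<Sum>e\<in>E. (norm (c e g))\<^sup>2) * (norm z)\<^sup>2" .
    qed
    also have "\<dots> = (\<Sum>g\<in>F. \<Sum>e\<in>E. (norm (c e g))\<^sup>2) * (norm z)\<^sup>2" by (simp only: sum_distrib_right)
    also have "(\<Sum>g\<in>F. \<Sum>e\<in>E. (norm (c e g))\<^sup>2) = h\<^sup>2" unfolding h2 by (rule sum.swap)
    also have "h\<^sup>2 * (norm z)\<^sup>2 = (h * norm z)\<^sup>2" by (simp add: power_mult_distrib)
    finally show "norm (T\<^sub>1 z) \<le> h * norm z" by (rule power2_le_imp_le) (simp add: h0)
  qed (rule h0)
  have "S T\<^sub>1 = of_real (h\<^sup>2)"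
  proof -
    have "cinner (T\<^sub>1 e) g = cnj (c e g)" if "e \<in> E" "g \<in> F" for e g
    proof -
      have "cinner (T\<^sub>1 e) g = (\<Sum>e'\<in>E. cnj (c e' g) * cinner e e')"
        unfolding T1_apply by (rule cinner_sum_orthonormal[OF oF that(2)])
      also have "\<dots> = (\<Sum>e'\<in>E. if e' = e then cnj (c e g) else 0)"
        by (intro sum.cong refl) (simp add: cinner_orthonormal[OF oE that(1)])
      also have "\<dots> = cnj (c e g)" using fin(1) that(1) by simp
      finally show ?thesis .
    qed
    then have "S T\<^sub>1 = (\<Sum>e\<in>E. \<Sum>g\<in>F. of_real ((norm (c e g))\<^sup>2))"
      unfolding S_def by (intro sum.cong refl) (simp only: complex_norm_square)
    then show ?thesis by (simp only: h2 of_real_sum)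
  qed
  moreover have "Re (S (\<Phi> T\<^sub>1)) \<le> 9/10 * h\<^sup>2"
  proof -
    have off: "cinner (\<Phi> (rank_one g' e') e) g = 0" if "e \<in> E" "e' \<in> E" "g \<in> F" "g' \<in> F" "e \<noteq> e' \<or> g \<noteq> g'" for e e' g g'
      using that(5)
    proof
      assume ne: "e \<noteq> e'"
      have "rank_one g' e' = rank_one g' e' o\<^sub>L cyc_proj e'" by (simp add: rank_one_comp D_BH cyc_proj_mem cyc_proj_adj)
      then have 1: "\<Phi> (rank_one g' e') = \<Phi> (rank_one g' e') o\<^sub>L cyc_proj e'" using right_module[OF cyc_proj_mem rank_one_BH] by metis
      have "cyc_proj e' e = 0"
      proof (rule cyc_proj_eq_0)
        fix w assume "w \<in> cyc e'"
        then have "cinner w e = 0"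
          by (rule orth_cyc[rotated]) (use E ne that in \<open>auto simp: D_orthonormal_def\<close>)
        then show "cinner e w = 0" by (metis cinner_commute complex_cnj_zero)
      qed
      then show ?thesis by (subst 1) simp
    next
      assume ne: "g \<noteq> g'"
      have "rank_one g' e' = cyc_proj g' o\<^sub>L rank_one g' e'" by (simp add: comp_rank_one D_BH cyc_proj_mem)
      then have 1: "\<Phi> (rank_one g' e') = cyc_proj g' o\<^sub>L \<Phi> (rank_one g' e')" using left_module[OF cyc_proj_mem rank_one_BH] by metis
      have "cyc_proj g' g = 0"
      proof (rule cyc_proj_eq_0)
        fix w assume "w \<in> cyc g'"
        then have "cinner w g = 0"
          by (rule orth_cyc[rotated]) (use F ne that in \<open>auto simp: D_orthonormal_def\<close>)
        then show "cinner g w = 0" by (metis cinner_commute complex_cnj_zero)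
      qed
      then show ?thesis by (subst 1) (simp add: cyc_proj_adjoint)
    qed
    have T1e: "cinner (\<Phi> T\<^sub>1 e) g = cnj (c e g) * cinner (\<Phi> (rank_one g e) e) g" if eg: "e \<in> E" "g \<in> F" for e g
    proof -
      have "\<Phi> T\<^sub>1 = (\<Sum>e'\<in>E. \<Sum>g'\<in>F. cnj (c e' g') *\<^sub>C \<Phi> (rank_one g' e'))"
        unfolding T\<^sub>1_def by (simp add: Phi_sum cscale)
      then have "cinner (\<Phi> T\<^sub>1 e) g = (\<Sum>e'\<in>E. \<Sum>g'\<in>F. cnj (c e' g') * cinner (\<Phi> (rank_one g' e') e) g)"
        by (simp add: blinfun.sum_left cinner_sum_left apply_simps cinner_scaleC_left)
      also have "\<dots> = (\<Sum>e'\<in>E. \<Sum>g'\<in>F. if g' = g then (if e' = e then cnj (c e g) * cinner (\<Phi> (rank_one g e) e) g else 0) else 0)"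
        by (intro sum.cong refl) (use off eg in auto)
      also have "\<dots> = cnj (c e g) * cinner (\<Phi> (rank_one g e) e) g" using fin eg by simp
      finally show ?thesis .
    qed
    have "S (\<Phi> T\<^sub>1) = (\<Sum>e\<in>E. \<Sum>g\<in>F. of_real ((norm (c e g))\<^sup>2) * cinner (\<Phi> (rank_one g e) e) g)"
      unfolding S_def by (intro sum.cong refl) (simp only: T1e complex_norm_square mult.assoc)
    then have "Re (S (\<Phi> T\<^sub>1)) = (\<Sum>e\<in>E. \<Sum>g\<in>F. (norm (c e g))\<^sup>2 * Re (cinner (\<Phi> (rank_one g e) e) g))"
      by simp
    also have "\<dots> \<le> (\<Sum>e\<in>E. \<Sum>g\<in>F. (norm (c e g))\<^sup>2 * (9/10))"
      using oE oF by (intro sum_mono mult_left_mono small) (auto simp: orthonormal_def)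
    also have "\<dots> = 9/10 * h\<^sup>2" unfolding h2 by (simp only: sum_distrib_right[symmetric] mult.commute)
    finally show ?thesis .
  qed
  ultimately have "h\<^sup>2 / 10 \<le> Re (S T\<^sub>1 - S (\<Phi> T\<^sub>1))" by simp
  also have "\<dots> \<le> norm (S (\<Phi> T\<^sub>1) - S T\<^sub>1)" using complex_Re_le_cmod by (metis norm_minus_commute)
  also have "\<dots> \<le> 2 * \<eta> * norm T\<^sub>1" by (rule inv[OF T1])
  also have "\<dots> \<le> 2 * \<eta> * h" using \<eta> nT1 by (intro mult_left_mono) auto
  finally have "h * h \<le> h * (20 * \<eta>)" by (simp add: power2_eq_square mult.commute mult.left_commute)
  then have h: "h \<le> 20 * \<eta>" using \<eta> h0 by (cases "h = 0") (auto simp: mult_le_cancel_left)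
  have "S (rank_one a b) = cinner a (T\<^sub>1 b)"
  proof -
    have "cinner a (T\<^sub>1 b) = (\<Sum>g\<in>F. \<Sum>e\<in>E. c e g * cinner e b * cinner a g)"
      unfolding T1_apply cinner_sum_right cinner_scaleC_right cnj_sum sum_distrib_right
      by (intro sum.cong refl) (simp add: cinner_commute[symmetric])
    also have "\<dots> = (\<Sum>e\<in>E. \<Sum>g\<in>F. c e g * cinner e b * cinner a g)" by (rule sum.swap)
    also have "\<dots> = S (rank_one a b)"
      unfolding S_def by (simp add: rank_one_apply cinner_scaleC_left mult.assoc)
    finally show ?thesis by (rule sym)
  qed
  then have "norm (S (rank_one a b)) \<le> norm a * norm (T\<^sub>1 b)" by (simp add: norm_cinner_le)
  also have "\<dots> \<le> norm a * (h * norm b)"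
    using norm_blinfun[of T\<^sub>1 b] mult_right_mono[OF nT1 norm_ge_zero[of b]] by (intro mult_left_mono) auto
  also have "\<dots> = h * N" by (simp add: N_def)
  also have "\<dots> \<le> 20 * \<eta> * N" using h N by (intro mult_right_mono) auto
  finally have 1: "norm (S (rank_one a b)) \<le> 20 * \<eta> * N" .
  have "norm (cinner (\<Phi> (rank_one a b) y) x - S (rank_one a b)) \<le> \<eta> * N"
    using s[OF rank_one_BH, of a b] norm_rank_one_le[of a b] \<eta> unfolding S_def[symmetric] N_def
    by (elim order_trans) (simp add: mult_left_mono)
  then have "norm ((cinner (\<Phi> (rank_one a b) y) x - S (rank_one a b)) + S (rank_one a b)) \<le> \<eta> * N + 20 * \<eta> * N"
    using 1 by (intro norm_triangle_le add_mono)
  then have "m \<le> 21 * (\<eta> * N)" by (simp add: m_def mult.commute)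
  also have "\<eta> * N = m / 42" using N by (simp add: \<eta>_def)
  finally show False using m by simp
qed

text \<open>Write \<open>V = \<Phi> (rank_one x y)\<close> and split \<open>V z\<close>, for a unit vector \<open>z\<close> orthogonal to \<open>w\<close>, along \<open>V w\<close>. The component orthogonal to
  \<open>V w\<close> has norm at most \<open>1 - \<parallel>V w\<parallel> \<le> 1/10\<close> by the trace bound; the other one is small since
  \<open>\<parallel>V\<^sup>*\<parallel> \<le> 1\<close>.\<close>

lemma singular_gap:
  assumes xy: "norm x \<le> 1" "norm y \<le> 1" and w: "norm w = 1" "9/10 \<le> norm (\<Phi> (rank_one x y) w)"
    and z: "cinner z w = 0"
  shows "norm (\<Phi> (rank_one x y) z) \<le> 1/2 * norm z"
proof -
  define V where "V = \<Phi> (rank_one x y)"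
  have VB: "V \<in> BH" by (simp add: V_def maps)
  have nV: "norm V \<le> 1"
  proof -
    have "norm V \<le> norm x * norm y"
      unfolding V_def using contractive[OF rank_one_BH] norm_rank_one_le order_trans by blast
    also have "\<dots> \<le> 1 * 1" using xy by (intro mult_mono) auto
    finally show ?thesis by simp
  qed
  have unit: "norm (V z) \<le> 1/2" if z1: "norm z = 1" and zw: "cinner z w = 0" for z
  proof -
    define h where "h = norm (V w)"
    have h: "h \<ge> 9/10" using w by (simp add: h_def V_def)
    define x' where "x' = (1/h) *\<^sub>R V w"
    have x'1: "norm x' = 1" using h by (simp add: x'_def h_def[symmetric])
    have Vw: "cinner (V w) x' = of_real h"
      using h by (simp add: x'_def cinner_scaleR_right cinner_self h_def[symmetric] power2_eq_square)
    define \<beta> where "\<beta> = cinner (V z) x'"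
    define t where "t = V z - \<beta> *\<^sub>C x'"
    have x'x': "cinner x' x' = 1" by (simp add: cinner_self x'1)
    have tx': "cinner t x' = 0"
      by (simp add: t_def cinner_diff_left cinner_scaleC_left \<beta>_def x'x')
    then have x't: "cinner x' t = 0" by (metis cinner_commute complex_cnj_zero)
    have Vz: "V z = \<beta> *\<^sub>C x' + t" by (simp add: t_def)
    have wz: "cinner w z = 0" using zw by (metis cinner_commute complex_cnj_zero)
    have t: "norm t \<le> 1/10"
    proof (cases "t = 0")
      case False
      have "cinner x' (sgn t) = 0" by (simp add: sgn_div_norm cinner_scaleR_right x't)
      then have "norm (cinner (V w) x' + cinner (V z) (sgn t)) \<le> 1"
        unfolding V_def using False by (intro trace_bound xy w z1 wz x'1) (simp add: norm_sgn)
      moreover have "cinner (V z) (sgn t) = of_real (norm t)"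
        using False by (simp add: Vz cinner_add_left cinner_scaleC_left sgn_div_norm cinner_scaleR_right
            x't cinner_self power2_eq_square)
      ultimately have "norm (complex_of_real (h + norm t)) \<le> 1" by (simp add: Vw)
      then have "h + norm t \<le> 1" unfolding norm_of_real using h by simp
      then show ?thesis using h by linarith
    qed simp
    have \<beta>: "(norm \<beta>)\<^sup>2 \<le> 19/100"
    proof -
      have ne: "w \<noteq> z" using wz w by (auto simp: cinner_self)
      have "orthonormal {w, z}" using w z1 wz zw by (auto simp: orthonormal_def)
      from bessel[OF this, of "adj V x'"] have
        "(norm (cinner (adj V x') w))\<^sup>2 + (norm (cinner (adj V x') z))\<^sup>2 \<le> (norm (adj V x'))\<^sup>2"
        using ne by simp
      moreover have "norm (cinner (adj V x') w) = h"
      proof -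
        have "cinner (adj V x') w = cnj (cinner (V w) x')"
          unfolding cinner_adj'[OF VB] by (rule cinner_commute)
        then show ?thesis using h by (simp add: Vw)
      qed
      moreover have "norm (cinner (adj V x') z) = norm \<beta>"
        unfolding \<beta>_def cinner_adj'[OF VB] by (subst cinner_commute) simp
      moreover have "(norm (adj V x'))\<^sup>2 \<le> 1"
        using norm_blinfun[of "adj V" x'] nV by (simp add: norm_adj VB x'1 power_le_one)
      moreover have "(9/10)\<^sup>2 \<le> h\<^sup>2" using h by (intro power_mono) auto
      moreover have "(9/10::real)\<^sup>2 = 81/100" by (simp add: power2_eq_square)
      ultimately show ?thesis by simp
    qed
    have "(norm (V z))\<^sup>2 = (norm \<beta>)\<^sup>2 + (norm t)\<^sup>2"
      unfolding Vz by (subst pythagoras) (simp_all add: cinner_scaleC_left x't norm_scaleC x'1)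
    also have "(norm t)\<^sup>2 \<le> (1/10)\<^sup>2" using t by (intro power_mono) auto
    then have "(norm \<beta>)\<^sup>2 + (norm t)\<^sup>2 \<le> (1/2)\<^sup>2" using \<beta> by (simp add: power2_eq_square)
    finally show ?thesis by (rule power2_le_imp_le) simp
  qed
  show ?thesis
  proof (cases "z = 0")
    case False
    have "cinner (sgn z) w = 0" by (simp add: sgn_div_norm cinner_scaleR_left z)
    then have "norm (V (sgn z)) \<le> 1/2" using False by (intro unit) (simp_all add: norm_sgn)
    moreover have "V (sgn z) = (1 / norm z) *\<^sub>R V z" by (simp add: sgn_div_norm apply_simps inverse_eq_divide)
    ultimately show ?thesis using False by (simp add: V_def field_simps)
  qed simp
qed

end

text \<open>Along a maximising sequence \<open>w n\<close> the vectors \<open>(\<sigma>\<^sup>2 - V\<^sup>* V) (w n)\<close> tend to \<open>0\<close>. The gap bounds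
  \<open>\<sigma>\<^sup>2 - V\<^sup>* V\<close> from below on the orthogonal complement of \<open>y\<close>, so a subsequence of \<open>w\<close> converges.\<close>

lemma top_singular_vector:
  fixes V :: "'a::complex_hilbert_space \<Rightarrow>\<^sub>L 'a"
  assumes V: "V \<in> BH" and y: "norm y = 1" and \<kappa>: "0 \<le> \<kappa>" "\<kappa> < norm V"
    and gap: "\<And>z. cinner z y = 0 \<Longrightarrow> norm (V z) \<le> \<kappa> * norm z"
  shows "\<exists>v. norm v = 1 \<and> adj V (V v) = (norm V)\<^sup>2 *\<^sub>R v"
proof -
  define \<sigma> where "\<sigma> = norm V"
  have \<sigma>: "\<sigma> > 0" using \<kappa> unfolding \<sigma>_def by linarith
  have "\<exists>x. norm x = 1 \<and> norm (V x) > \<sigma> - \<sigma> / Suc (Suc n)" for n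
  proof (rule ccontr)
    define r where "r = \<sigma> - \<sigma> / Suc (Suc n)"
    have r: "0 \<le> r" "r < \<sigma>" using \<sigma> by (simp_all add: r_def field_simps)
    assume "\<not> ?thesis"
    then have le: "norm (V x) \<le> r" if "norm x = 1" for x using that by (force simp: r_def)
    have "norm V \<le> r"
    proof (rule norm_blinfun_bound[OF r(1)])
      fix x
      show "norm (V x) \<le> r * norm x"
      proof (cases "x = 0")
        case False
        have "V (sgn x) = (1 / norm x) *\<^sub>R V x" by (simp add: sgn_div_norm apply_simps inverse_eq_divide)
        then show ?thesis using le[of "sgn x"] False by (simp add: norm_sgn field_simps)
      qed simp
    qed
    then show False using r by (simp add: \<sigma>_def)
  qed
  then obtain w where w: "\<And>n. norm (w n) = 1" "\<And>n. norm (V (w n)) > \<sigma> - \<sigma> / Suc (Suc n)" by metis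
  have Vle: "norm (V (w n)) \<le> \<sigma>" for n using norm_blinfun[of V "w n"] by (simp add: w \<sigma>_def)
  define B where "B = \<sigma>\<^sup>2 *\<^sub>R id_blinfun - (adj V o\<^sub>L V)"
  have BB: "B \<in> BH" by (simp add: B_def V)
  have Bq: "Re (cinner (B z) z) = \<sigma>\<^sup>2 * (norm z)\<^sup>2 - (norm (V z))\<^sup>2" for z
    by (simp add: B_def apply_simps cinner_diff_left cinner_scaleR_left Re_cinner_self cinner_adj' V)
  have Bn: "(norm (B z))\<^sup>2 \<le> \<sigma>\<^sup>2 * (\<sigma>\<^sup>2 * (norm z)\<^sup>2 - (norm (V z))\<^sup>2)" for z
  proof -
    have "norm (adj V (V z)) \<le> \<sigma> * norm (V z)"
      using norm_blinfun[of "adj V" "V z"] by (simp add: norm_adj V \<sigma>_def)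
    then have "(norm (adj V (V z)))\<^sup>2 \<le> \<sigma>\<^sup>2 * (norm (V z))\<^sup>2"
      using power_mono[of "norm (adj V (V z))" "\<sigma> * norm (V z)" 2] by (simp add: power_mult_distrib)
    moreover have "Re (cinner z (adj V (V z))) = (norm (V z))\<^sup>2"
      by (simp add: cinner_adj[symmetric] V Re_cinner_self)
    then have "(norm (B z))\<^sup>2 = (\<sigma>\<^sup>2)\<^sup>2 * (norm z)\<^sup>2 - 2 * (\<sigma>\<^sup>2 * (norm (V z))\<^sup>2) + (norm (adj V (V z)))\<^sup>2"
      by (simp add: B_def apply_simps norm_diff_sq cinner_scaleR_left power_mult_distrib)
    moreover have "\<sigma>\<^sup>2 * (\<sigma>\<^sup>2 * (norm z)\<^sup>2 - (norm (V z))\<^sup>2) = (\<sigma>\<^sup>2)\<^sup>2 * (norm z)\<^sup>2 - \<sigma>\<^sup>2 * (norm (V z))\<^sup>2"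
      by (simp add: power2_eq_square algebra_simps)
    ultimately show ?thesis by linarith
  qed
  have Vlim: "(\<lambda>n. norm (V (w n))) \<longlonglongrightarrow> \<sigma>"
  proof (rule tendsto_sandwich)
    have "(\<lambda>n. \<sigma> / real (Suc (Suc n))) \<longlonglongrightarrow> 0"
      using LIMSEQ_Suc[OF LIMSEQ_Suc[OF lim_const_over_n[of \<sigma>]]] .
    from tendsto_diff[OF tendsto_const[of \<sigma>] this]
    show "(\<lambda>n. \<sigma> - \<sigma> / real (Suc (Suc n))) \<longlonglongrightarrow> \<sigma>" by simp
    show "\<forall>\<^sub>F n in sequentially. \<sigma> - \<sigma> / real (Suc (Suc n)) \<le> norm (V (w n))"
      using w(2) by (intro always_eventually allI less_imp_le)
    show "\<forall>\<^sub>F n in sequentially. norm (V (w n)) \<le> \<sigma>" using Vle by simp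
    show "(\<lambda>n. \<sigma>) \<longlonglongrightarrow> \<sigma>" by simp
  qed
  have "(\<lambda>n. \<sigma>\<^sup>2 * (\<sigma>\<^sup>2 - (norm (V (w n)))\<^sup>2)) \<longlonglongrightarrow> \<sigma>\<^sup>2 * (\<sigma>\<^sup>2 - \<sigma>\<^sup>2)"
    by (intro tendsto_intros Vlim)
  then have lim0: "(\<lambda>n. \<sigma>\<^sup>2 * (\<sigma>\<^sup>2 - (norm (V (w n)))\<^sup>2)) \<longlonglongrightarrow> 0" by simp
  have "(\<lambda>n. (norm (B (w n)))\<^sup>2) \<longlonglongrightarrow> 0"
    by (rule tendsto_sandwich[OF _ _ tendsto_const lim0]) (use Bn[of "w n" for n] w in auto)
  then have "(\<lambda>n. sqrt ((norm (B (w n)))\<^sup>2)) \<longlonglongrightarrow> sqrt 0" by (rule tendsto_real_sqrt)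
  then have Bw: "(\<lambda>n. B (w n)) \<longlonglongrightarrow> 0" by (simp add: tendsto_norm_zero_iff)
  define \<alpha> where "\<alpha> n = cinner (w n) y" for n
  have "bounded (range \<alpha>)"
    using norm_cinner_le[of "w n" y for n] by (intro boundedI[of _ 1]) (auto simp: \<alpha>_def w y)
  then obtain r l where r: "strict_mono (r :: nat \<Rightarrow> nat)" and l: "(\<alpha> \<circ> r) \<longlonglongrightarrow> l"
    using bounded_imp_convergent_subsequence[of \<alpha>] by blast
  define z where "z n = w (r n) - \<alpha> (r n) *\<^sub>C y" for n
  have zy: "cinner (z n) y = 0" for n
    by (simp add: z_def cinner_diff_left cinner_scaleC_left cinner_self y \<alpha>_def)
  have Bz: "(\<lambda>n. B (z n)) \<longlonglongrightarrow> 0 - l *\<^sub>C B y"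
  proof -
    have "(\<lambda>n. B (w (r n)) - \<alpha> (r n) *\<^sub>C B y) \<longlonglongrightarrow> 0 - l *\<^sub>C B y"
      using LIMSEQ_subseq_LIMSEQ[OF Bw r] l by (intro tendsto_intros) (simp_all add: o_def)
    then show ?thesis by (simp add: z_def apply_simps BH_scaleC[OF BB])
  qed
  define g where "g = \<sigma>\<^sup>2 - \<kappa>\<^sup>2"
  have g: "g > 0" using \<kappa> by (simp add: g_def \<sigma>_def power_strict_mono)
  have lower: "g * norm u \<le> norm (B u)" if "cinner u y = 0" for u
  proof (cases "u = 0")
    case False
    have "(norm (V u))\<^sup>2 \<le> (\<kappa> * norm u)\<^sup>2" using gap[OF that] by (intro power_mono) auto
    then have "g * (norm u)\<^sup>2 \<le> Re (cinner (B u) u)" by (simp add: Bq g_def power_mult_distrib algebra_simps)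
    also have "\<dots> \<le> norm (B u) * norm u" using complex_Re_le_cmod norm_cinner_le order_trans by blast
    finally show ?thesis using False by (simp add: power2_eq_square)
  qed simp
  have "Cauchy z"
  proof (rule metric_CauchyI)
    fix e :: real assume e: "e > 0"
    have "Cauchy (\<lambda>n. B (z n))" by (rule LIMSEQ_imp_Cauchy[OF Bz])
    from metric_CauchyD[OF this, of "g * e"] obtain M where
      M: "\<And>m n. m \<ge> M \<Longrightarrow> n \<ge> M \<Longrightarrow> dist (B (z m)) (B (z n)) < g * e" using g e by auto
    have "dist (z m) (z n) < e" if "m \<ge> M" "n \<ge> M" for m n
    proof -
      have "g * norm (z m - z n) \<le> norm (B (z m - z n))" by (rule lower) (simp add: cinner_diff_left zy)
      also have "\<dots> < g * e" using M[OF that] by (simp add: dist_norm apply_simps)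
      finally show ?thesis using g by (simp add: dist_norm)
    qed
    then show "\<exists>M. \<forall>m\<ge>M. \<forall>n\<ge>M. dist (z m) (z n) < e" by blast
  qed
  then obtain z' where z': "z \<longlonglongrightarrow> z'" by (auto simp: Cauchy_convergent_iff convergent_def)
  define v where "v = z' + l *\<^sub>C y"
  have wv: "(\<lambda>n. w (r n)) \<longlonglongrightarrow> v"
  proof -
    have "(\<lambda>n. z n + \<alpha> (r n) *\<^sub>C y) \<longlonglongrightarrow> z' + l *\<^sub>C y"
      using l by (intro tendsto_intros z') (simp add: o_def)
    then show ?thesis by (simp add: z_def v_def)
  qed
  have "norm v = 1"
  proof -
    have "(\<lambda>n. norm (w (r n))) \<longlonglongrightarrow> norm v" by (intro tendsto_intros wv)
    then show ?thesis by (simp add: w LIMSEQ_const_iff)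
  qed
  moreover have "B v = 0"
  proof (rule LIMSEQ_unique)
    show "(\<lambda>n. B (w (r n))) \<longlonglongrightarrow> B v" by (intro tendsto_intros wv)
    show "(\<lambda>n. B (w (r n))) \<longlonglongrightarrow> 0" using LIMSEQ_subseq_LIMSEQ[OF Bw r] by (simp add: o_def)
  qed
  then have "adj V (V v) = \<sigma>\<^sup>2 *\<^sub>R v" by (simp add: B_def apply_simps)
  ultimately show ?thesis unfolding \<sigma>_def by blast
qed

text \<open>At an operator with a simple, isolated top singular value the operator norm is differentiable,
  with derivative \<open>Re \<langle>N v, V v\<rangle> / \<parallel>V\<parallel>\<close> in the direction of \<open>N\<close>.\<close>

lemma norm_decrease:
  fixes V :: "'a::complex_hilbert_space \<Rightarrow>\<^sub>L 'a"
  assumes V: "V \<in> BH" and N: "N \<in> BH" and v: "norm v = 1" and top: "adj V (V v) = (norm V)\<^sup>2 *\<^sub>R v"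
    and \<kappa>: "0 \<le> \<kappa>" "\<kappa> < norm V" and gap: "\<And>z. cinner z v = 0 \<Longrightarrow> norm (V z) \<le> \<kappa> * norm z"
    and pos: "Re (cinner (N v) (V v)) > 0"
  shows "\<exists>s>0. norm (V - s *\<^sub>R N) < norm V"
proof -
  define \<sigma> where "\<sigma> = norm V"
  define n where "n = norm N"
  define \<delta> where "\<delta> = Re (cinner (N v) (V v))"
  define C where "C = n * \<sigma>"
  define g where "g = \<sigma>\<^sup>2 - \<kappa>\<^sup>2"
  define M where "M = n\<^sup>2 + 8 * C\<^sup>2 / g"
  have \<delta>: "\<delta> > 0" using pos by (simp add: \<delta>_def)
  have \<sigma>: "\<sigma> > 0" using \<kappa> unfolding \<sigma>_def by linarith
  have g: "g > 0" using \<kappa> by (simp add: g_def \<sigma>_def power_strict_mono)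
  have n: "n > 0" using pos by (auto simp: n_def)
  have C: "C \<ge> 0" using n \<sigma> by (simp add: C_def)
  have M: "M > 0" using n g by (simp add: M_def add_pos_nonneg)
  \<comment> \<open>The first bound on \<open>s\<close> keeps half of the gap \<open>g\<close>, the second one lets the first order term win.\<close>
  define s where "s = min (g / (4 * \<delta>)) (\<delta> / M)"
  have s: "s > 0" using g \<delta> M by (simp add: s_def)
  have s1: "2 * s * \<delta> \<le> g / 2"
  proof -
    have "s * (4 * \<delta>) \<le> g / (4 * \<delta>) * (4 * \<delta>)" using \<delta> by (intro mult_right_mono) (auto simp: s_def)
    also have "\<dots> = g" using \<delta> by simp
    finally show ?thesis by simp
  qed
  have s2: "s * M \<le> \<delta>"
  proof -
    have "s * M \<le> \<delta> / M * M" using M by (intro mult_right_mono) (auto simp: s_def)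
    then show ?thesis using M by simp
  qed
  have vv: "cinner v v = 1" by (simp add: cinner_self v)
  have key: "(norm ((V - s *\<^sub>R N) x))\<^sup>2 \<le> (\<sigma>\<^sup>2 - s * \<delta>) * (norm x)\<^sup>2" for x
  proof -
    define \<alpha> where "\<alpha> = cinner x v"
    define z where "z = x - \<alpha> *\<^sub>C v"
    define X where "X = norm x"
    define h where "h = norm z"
    have x: "x = \<alpha> *\<^sub>C v + z" by (simp add: z_def)
    have zv: "cinner z v = 0" by (simp add: z_def cinner_diff_left cinner_scaleC_left vv \<alpha>_def)
    then have vz: "cinner v z = 0" by (metis cinner_commute complex_cnj_zero)
    have nx: "X\<^sup>2 = (norm \<alpha>)\<^sup>2 + h\<^sup>2"
    proof -
      have "X\<^sup>2 = (norm (\<alpha> *\<^sub>C v + z))\<^sup>2" unfolding X_def by (rule arg_cong[OF x])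
      also have "\<dots> = (norm (\<alpha> *\<^sub>C v))\<^sup>2 + h\<^sup>2"
        unfolding h_def by (rule pythagoras) (simp add: cinner_scaleC_left vz)
      finally show ?thesis by (simp add: norm_scaleC v)
    qed
    have \<alpha>X: "norm \<alpha> \<le> X" using norm_cinner_le[of x v] by (simp add: \<alpha>_def v X_def)
    have Vx: "V x = \<alpha> *\<^sub>C V v + V z"
    proof -
      have "V x = V (\<alpha> *\<^sub>C v + z)" by (rule arg_cong[OF x])
      then show ?thesis by (simp add: blinfun.add_right BH_scaleC[OF V])
    qed
    have Nx: "N x = \<alpha> *\<^sub>C N v + N z"
    proof -
      have "N x = N (\<alpha> *\<^sub>C v + z)" by (rule arg_cong[OF x])
      then show ?thesis by (simp add: blinfun.add_right BH_scaleC[OF N])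
    qed
    have "cinner (V v) (V z) = cinner (adj V (V v)) z" by (simp only: cinner_adj'[OF V])
    also have "\<dots> = 0" unfolding top by (simp add: cinner_scaleR_left vz)
    finally have VvVz: "cinner (V v) (V z) = 0" .
    have nVv: "(norm (V v))\<^sup>2 = \<sigma>\<^sup>2"
    proof -
      have "cinner (V v) (V v) = cinner (adj V (V v)) v" by (simp only: cinner_adj'[OF V])
      then have "complex_of_real ((norm (V v))\<^sup>2) = complex_of_real (\<sigma>\<^sup>2)"
        unfolding top cinner_scaleR_left vv cinner_self \<sigma>_def by (simp add: v)
      then show ?thesis by (simp only: of_real_eq_iff)
    qed
    have "(norm (V x))\<^sup>2 = (norm (\<alpha> *\<^sub>C V v))\<^sup>2 + (norm (V z))\<^sup>2"
      unfolding Vx by (rule pythagoras) (simp add: cinner_scaleC_left VvVz)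
    also have "(norm (\<alpha> *\<^sub>C V v))\<^sup>2 = \<sigma>\<^sup>2 * (norm \<alpha>)\<^sup>2" by (simp add: norm_scaleC power_mult_distrib nVv)
    also have "(norm (V z))\<^sup>2 \<le> (\<kappa> * h)\<^sup>2" using gap[OF zv] unfolding h_def by (intro power_mono) auto
    finally have 1: "(norm (V x))\<^sup>2 \<le> \<sigma>\<^sup>2 * (norm \<alpha>)\<^sup>2 + \<kappa>\<^sup>2 * h\<^sup>2" by (simp add: power_mult_distrib)
    have 2: "Re (cinner (N x) (V x)) \<ge> (norm \<alpha>)\<^sup>2 * \<delta> - 2 * (C * (h * X))"
    proof -
      have e: "cinner (N x) (V x) = of_real ((norm \<alpha>)\<^sup>2) * cinner (N v) (V v)
        + (cinner (\<alpha> *\<^sub>C N v) (V z) + cinner (N z) (V x))"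
        unfolding complex_norm_square
        by (subst Nx, subst cinner_add_left, subst (1) Vx)
           (simp add: cinner_add_right cinner_scaleC_left cinner_scaleC_right algebra_simps)
      have bV: "norm (V w) \<le> \<sigma> * norm w" and bN: "norm (N w) \<le> n * norm w" for w
        by (simp_all add: \<sigma>_def n_def norm_blinfun)
      have "norm (cinner (\<alpha> *\<^sub>C N v) (V z)) \<le> norm (\<alpha> *\<^sub>C N v) * norm (V z)" by (rule norm_cinner_le)
      also have "\<dots> \<le> (X * n) * (\<sigma> * h)"
      proof (intro mult_mono)
        show "norm (\<alpha> *\<^sub>C N v) \<le> X * n"
          unfolding norm_scaleC using bN[of v] by (intro mult_mono \<alpha>X) (auto simp: v X_def)
      qed (use bV[of z] n in \<open>auto simp: h_def X_def\<close>)
      finally have 3: "norm (cinner (\<alpha> *\<^sub>C N v) (V z)) \<le> C * (h * X)" by (simp add: C_def ac_simps)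
      have "norm (cinner (N z) (V x)) \<le> norm (N z) * norm (V x)" by (rule norm_cinner_le)
      also have "\<dots> \<le> (n * h) * (\<sigma> * X)"
        using bN[of z] bV[of x] n by (intro mult_mono) (auto simp: h_def X_def)
      finally have 4: "norm (cinner (N z) (V x)) \<le> C * (h * X)" by (simp add: C_def ac_simps)
      have "\<bar>Re (cinner (\<alpha> *\<^sub>C N v) (V z))\<bar> \<le> C * (h * X)" "\<bar>Re (cinner (N z) (V x))\<bar> \<le> C * (h * X)"
        using 3 4 abs_Re_le_cmod order_trans by blast+
      moreover have "Re (cinner (N x) (V x)) = (norm \<alpha>)\<^sup>2 * \<delta> + (Re (cinner (\<alpha> *\<^sub>C N v) (V z)) + Re (cinner (N z) (V x)))"
        unfolding e \<delta>_def by simp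
      ultimately show ?thesis by linarith
    qed
    have 3: "(norm (N x))\<^sup>2 \<le> n\<^sup>2 * X\<^sup>2"
      using power_mono[OF norm_blinfun[of N x], of 2] by (simp add: n_def X_def power_mult_distrib)
    have "(norm ((V - s *\<^sub>R N) x))\<^sup>2 = (norm (V x))\<^sup>2 - 2 * s * Re (cinner (N x) (V x)) + s\<^sup>2 * (norm (N x))\<^sup>2"
      by (simp add: apply_simps norm_diff_sq cinner_scaleR_right power_mult_distrib Re_cinner_commute[of "V x"])
    also have "\<dots> \<le> (\<sigma>\<^sup>2 * (norm \<alpha>)\<^sup>2 + \<kappa>\<^sup>2 * h\<^sup>2) - 2 * s * ((norm \<alpha>)\<^sup>2 * \<delta> - 2 * (C * (h * X))) + s\<^sup>2 * (n\<^sup>2 * X\<^sup>2)"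
      using s by (intro add_mono diff_mono 1 mult_left_mono 2 3) auto
    also have "\<dots> = (\<sigma>\<^sup>2 - 2 * s * \<delta> + s\<^sup>2 * n\<^sup>2) * X\<^sup>2 - g * h\<^sup>2 + 2 * s * \<delta> * h\<^sup>2 + 4 * s * C * h * X"
      unfolding nx g_def by (simp add: algebra_simps)
    also have "\<dots> \<le> (\<sigma>\<^sup>2 - 2 * s * \<delta> + s\<^sup>2 * n\<^sup>2) * X\<^sup>2 - g * h\<^sup>2 + g / 2 * h\<^sup>2 + (g / 2 * h\<^sup>2 + 8 * s\<^sup>2 * C\<^sup>2 / g * X\<^sup>2)"
    proof (intro add_mono order_refl mult_right_mono s1)
      have "0 \<le> (g * h - 4 * s * C * X)\<^sup>2 / (2 * g)" using g by simp
      also have "\<dots> = g / 2 * h\<^sup>2 + 8 * s\<^sup>2 * C\<^sup>2 / g * X\<^sup>2 - 4 * s * C * h * X"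
        using g by (simp add: power2_eq_square field_simps)
      finally show "4 * s * C * h * X \<le> g / 2 * h\<^sup>2 + 8 * s\<^sup>2 * C\<^sup>2 / g * X\<^sup>2" by simp
    qed simp
    also have "\<dots> = (\<sigma>\<^sup>2 - 2 * (s * \<delta>) + s * (s * M)) * X\<^sup>2"
      using g by (simp add: M_def power2_eq_square field_simps)
    also have "\<dots> \<le> (\<sigma>\<^sup>2 - 2 * (s * \<delta>) + s * \<delta>) * X\<^sup>2"
      using s s2 by (intro mult_right_mono add_left_mono mult_left_mono) auto
    finally show ?thesis by (simp add: X_def algebra_simps)
  qed
  have nn: "0 \<le> \<sigma>\<^sup>2 - s * \<delta>"
    using order_trans[OF zero_le_power2 key[of v]] by (simp add: v)
  have "norm (V - s *\<^sub>R N) \<le> sqrt (\<sigma>\<^sup>2 - s * \<delta>)"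
  proof (rule norm_blinfun_bound)
    fix x
    have "sqrt ((norm ((V - s *\<^sub>R N) x))\<^sup>2) \<le> sqrt ((\<sigma>\<^sup>2 - s * \<delta>) * (norm x)\<^sup>2)"
      by (rule real_sqrt_le_mono[OF key])
    then show "norm ((V - s *\<^sub>R N) x) \<le> sqrt (\<sigma>\<^sup>2 - s * \<delta>) * norm x" by (simp add: real_sqrt_mult)
  qed (use nn in simp)
  also have "\<dots> < sqrt (\<sigma>\<^sup>2)" using s \<delta> by (intro real_sqrt_less_mono) simp
  also have "\<dots> = norm V" using \<sigma> by (simp add: \<sigma>_def)
  finally show ?thesis using s by blast
qed

context schur_projection
begin

text \<open>Let \<open>V = \<Phi> (rank_one x y)\<close> for \<open>x\<close> and \<open>y\<close> as in \<open>exists_dense_rank_one\<close>, with top singular vectors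
  \<open>v\<close> and \<open>u\<close>. Since \<open>\<Phi>\<close> maps \<open>V - s N\<close> to \<open>V\<close> whenever \<open>\<Phi> N = 0\<close>, the norm cannot decrease in the direction of
  \<open>N = rank_one u v - \<Phi> (rank_one u v)\<close>. So \<open>Re \<langle>N v, u\<rangle> \<le> 0\<close>, that is, the contraction is attained
  on \<open>rank_one u v\<close>.\<close>

lemma exists_rank_one:
  assumes "T \<in> BH" "\<Phi> T \<noteq> 0"
  shows "\<exists>u v. u \<noteq> 0 \<and> v \<noteq> 0 \<and> rank_one u v \<in> R"
proof -
  obtain x y where xy: "norm x = 1" "norm y = 1" and ge: "9/10 \<le> Re (cinner (\<Phi> (rank_one x y) y) x)"
    using exists_dense_rank_one[OF assms] by blast
  define V where "V = \<Phi> (rank_one x y)"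
  have VB: "V \<in> BH" and VR: "V \<in> R" by (simp_all add: V_def maps Phi_R)
  have Vy: "9/10 \<le> norm (V y)"
    using ge complex_Re_le_cmod[of "cinner (V y) x"] norm_cinner_le[of "V y" x] by (simp add: xy V_def)
  then have nV: "9/10 \<le> norm V" using norm_blinfun[of V y] by (simp add: xy)
  have gap: "norm (V z) \<le> 1/2 * norm z" if "norm w = 1" "9/10 \<le> norm (V w)" "cinner z w = 0" for w z
    using singular_gap[of x y w z] that xy by (simp add: V_def)
  obtain v where v: "norm v = 1" "adj V (V v) = (norm V)\<^sup>2 *\<^sub>R v"
    using top_singular_vector[OF VB xy(2), of "1/2"] gap[OF xy(2) Vy] nV by auto
  have nVv: "norm (V v) = norm V"
  proof -
    have "cinner (V v) (V v) = cinner (adj V (V v)) v" by (simp only: cinner_adj'[OF VB])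
    then have "complex_of_real ((norm (V v))\<^sup>2) = complex_of_real ((norm V)\<^sup>2)"
      unfolding v(2) by (simp add: cinner_scaleR_left cinner_self v(1))
    then show ?thesis by (simp only: of_real_eq_iff power2_eq_iff_nonneg norm_ge_zero)
  qed
  define u where "u = sgn (V v)"
  have u1: "norm u = 1" using nVv nV by (auto simp: u_def norm_sgn)
  have "V \<noteq> 0" using nV by auto
  then have Vv: "V v = norm V *\<^sub>R u" by (simp add: u_def sgn_div_norm nVv)
  define N where "N = rank_one u v - \<Phi> (rank_one u v)"
  have NB: "N \<in> BH" and PhiN: "\<Phi> N = 0" by (simp_all add: N_def maps diff idem)
  have "Re (cinner (N v) (V v)) \<le> 0"
  proof (rule ccontr)
    assume "\<not> ?thesis"
    then have "\<exists>s>0. norm (V - s *\<^sub>R N) < norm V"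
      using nV nVv by (intro norm_decrease[OF VB NB v, of "1/2"] gap[OF v(1)]) auto
    then obtain s where s: "norm (V - s *\<^sub>R N) < norm V" by blast
    have "\<Phi> (V - s *\<^sub>R N) = V" by (simp add: diff rscale VB NB PhiN R_fix[OF VR])
    then show False using contractive[of "V - s *\<^sub>R N"] s by (simp add: VB NB)
  qed
  then have "norm V * Re (cinner (N v) u) \<le> 0" by (simp add: Vv cinner_scaleR_right)
  moreover have "norm V > 0" using nV by linarith
  ultimately have "Re (cinner (N v) u) \<le> 0" by (simp add: mult_le_0_iff)
  then have "(norm u)\<^sup>2 * (norm v)\<^sup>2 \<le> Re (cinner (\<Phi> (rank_one u v) v) u)"
    by (simp add: N_def apply_simps rank_one_apply cinner_diff_left cinner_scaleC_left cinner_self u1 v(1))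
  then have "rank_one u v \<in> R" by (rule rank_one_mem_if_attained)
  moreover have "u \<noteq> 0" "v \<noteq> 0" using u1 v(1) by auto
  ultimately show ?thesis by blast
qed

lemma compress:
  assumes p: "projection p"
  shows "schur_projection D (\<lambda>T. p o\<^sub>L \<Phi> T)"
proof
  have pD: "p \<in> D" and pB: "p \<in> BH" and pa: "adj p = p" and pp: "p o\<^sub>L p = p"
    using p by (simp_all add: projection_def D_BH)
  fix T :: "'a \<Rightarrow>\<^sub>L 'a" assume T: "T \<in> BH"
  show "p o\<^sub>L \<Phi> T \<in> BH" by (simp add: pB maps T)
  show "p o\<^sub>L \<Phi> (c *\<^sub>C T) = c *\<^sub>C (p o\<^sub>L \<Phi> T)" for c by (simp add: cscale T comp_scaleC pB)
  show "p o\<^sub>L \<Phi> (p o\<^sub>L \<Phi> T) = p o\<^sub>L \<Phi> T"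
    by (simp add: left_module pD maps T idem comp_assoc[symmetric] pp)
  show "norm (p o\<^sub>L \<Phi> T) \<le> norm T"
  proof -
    have "norm p \<le> 1"
    proof (rule norm_blinfun_bound)
      fix x
      have "(norm (p x))\<^sup>2 = Re (cinner (p x) x)"
        unfolding Re_cinner_self[symmetric]
        by (simp add: cinner_adj pB pa projection_apply[OF p])
      also have "\<dots> \<le> norm (p x) * norm x" using complex_Re_le_cmod norm_cinner_le order_trans by blast
      finally have "norm (p x) * norm (p x) \<le> norm (p x) * norm x" by (simp add: power2_eq_square)
      then show "norm (p x) \<le> 1 * norm x" by (cases "p x = 0") (auto simp: mult_le_cancel_left)
    qed simp
    then have "norm p * norm (\<Phi> T) \<le> 1 * norm T" using contractive[OF T] by (intro mult_mono) auto
    then show ?thesis using norm_blinfun_compose[of p "\<Phi> T"] by linarith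
  qed
  fix S :: "'a \<Rightarrow>\<^sub>L 'a" assume "S \<in> BH"
  then show "p o\<^sub>L \<Phi> (S + T) = (p o\<^sub>L \<Phi> S) + (p o\<^sub>L \<Phi> T)" by (simp add: add T blinfun_comp_bilin)
next
  fix A B T :: "'a \<Rightarrow>\<^sub>L 'a" assume A: "A \<in> D" and B: "B \<in> D" and T: "T \<in> BH"
  have pA: "p o\<^sub>L A = A o\<^sub>L p" using p A by (intro D_commute) (simp_all add: projection_def)
  have "p o\<^sub>L (A o\<^sub>L \<Phi> T o\<^sub>L B) = (p o\<^sub>L A) o\<^sub>L (\<Phi> T o\<^sub>L B)" by (simp only: comp_assoc)
  also have "\<dots> = A o\<^sub>L (p o\<^sub>L \<Phi> T) o\<^sub>L B" by (simp only: pA) (simp only: comp_assoc)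
  finally show "p o\<^sub>L \<Phi> (A o\<^sub>L T o\<^sub>L B) = A o\<^sub>L (p o\<^sub>L \<Phi> T) o\<^sub>L B"
    by (simp only: module[OF A B T])
next
  fix \<eta> :: real and y x :: 'a assume "\<eta> > 0"
  moreover have "cinner ((p o\<^sub>L \<Phi> T) y) x = cinner (\<Phi> T y) (p x)" for T
    using p by (simp add: projection_def cinner_adj D_BH)
  ultimately show "\<exists>(n::nat) u v. \<forall>T\<in>BH. norm (cinner ((p o\<^sub>L \<Phi> T) y) x
      - (\<Sum>k<n. cinner (blinfun_apply T (u k)) (v k))) \<le> \<eta> * norm T"
    using normal[of \<eta> y "p x"] by (simp only:)
qed

section \<open>Averaging over symmetries\<close>

definition symmetries :: "(('a \<Rightarrow>\<^sub>L 'a) \<times> ('a \<Rightarrow>\<^sub>L 'a)) set" where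
  "symmetries = {(U, V). U \<in> D \<and> V \<in> D \<and> adj U = U \<and> adj V = V \<and>
     U o\<^sub>L U = id_blinfun \<and> V o\<^sub>L V = id_blinfun \<and> (\<forall>X\<in>R. U o\<^sub>L X = X o\<^sub>L V)}"

text \<open>When \<open>\<Phi>\<close> restricts matrices to a block diagonal pattern, these are the blocks and, with \<open>q = 0\<close> or
  \<open>p = 0\<close>, the sets of rows or columns that meet no block.\<close>

definition atoms :: "(('a \<Rightarrow>\<^sub>L 'a) \<times> ('a \<Rightarrow>\<^sub>L 'a)) set" where
  "atoms = {(p, q). projection p \<and> projection q \<and> (\<forall>X\<in>R. p o\<^sub>L X = X o\<^sub>L q) \<and> (\<forall>T\<in>BH. p o\<^sub>L T o\<^sub>L q \<in> R)}"

text \<open>The eigenspaces of \<open>V\<close> and \<open>U\<close> split \<open>U T - T V\<close> into two pieces with orthogonal domains and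
  orthogonal ranges. Both pieces vanish when \<open>T\<close> is replaced
  by an operator of the range of \<open>\<Phi>\<close>.\<close>

lemma symmetry_displacement:
  assumes UV: "(U, V) \<in> symmetries" and T: "T \<in> BH" and a: "a \<ge> 0"
    and dist: "\<And>x e. e > 0 \<Longrightarrow> \<exists>X\<in>R. norm (T x - blinfun_apply X x) \<le> a * norm x + e"
  shows "norm (T - (U o\<^sub>L T o\<^sub>L V)) \<le> 2 * a"
proof (rule norm_blinfun_bound)
  have U: "U \<in> BH" "adj U = U" "U o\<^sub>L U = id_blinfun" and V: "V \<in> BH" "adj V = V" "V o\<^sub>L V = id_blinfun"
    and X: "\<And>X. X \<in> R \<Longrightarrow> U o\<^sub>L X = X o\<^sub>L V"
    using UV D_BH unfolding symmetries_def by blast+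
  have UU: "U (U z) = z" and VV: "V (V z) = z" for z
    using U(3) V(3) by (metis blinfun_apply_blinfun_compose blinfun_apply_id_blinfun id_apply)+
  have UX: "U (X z) = X (V z)" if "X \<in> R" for X z
    using X[OF that] by (metis blinfun_apply_blinfun_compose)
  have Un: "norm (U z) = norm z" for z
  proof -
    have "cinner (U z) (U z) = cinner z z" by (simp add: cinner_adj U UU)
    then show ?thesis by (simp only: cinner_self of_real_eq_iff power2_eq_iff_nonneg norm_ge_zero)
  qed
  have Vn: "norm (V z) = norm z" for z
  proof -
    have "cinner (V z) (V z) = cinner z z" by (simp add: cinner_adj V VV)
    then show ?thesis by (simp only: cinner_self of_real_eq_iff power2_eq_iff_nonneg norm_ge_zero)
  qed
  fix y
  define w where "w = V y"
  define p where "p = (1/2) *\<^sub>R (w + V w)"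
  define m where "m = (1/2) *\<^sub>R (w - V w)"
  have w: "w = p + m" by (simp add: p_def m_def scaleR_add_right[symmetric] flip: scaleR_2)
  have Vp: "V p = p" and Vm: "V m = - m" by (simp_all add: p_def m_def apply_simps VV algebra_simps)
  have orth: "cinner b c = 0" if "blinfun_apply W b = b" "blinfun_apply W c = - c" "W \<in> BH" "adj W = W" for b c W
  proof -
    have "cinner b c = cinner (W b) c" by (simp add: that)
    also have "\<dots> = cinner b (W c)" by (simp add: cinner_adj that(3) that(4))
    also have "\<dots> = - cinner b c" by (simp add: that)
    finally show ?thesis by simp
  qed
  define A where "A = U (T p) - T p"
  define B where "B = U (T m) + T m"
  have UA: "U A = - A" and UB: "U B = B" by (simp_all add: A_def B_def apply_simps UU)
  have nA: "norm A \<le> 2 * a * norm p"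
  proof (rule field_le_epsilon)
    fix e :: real assume e: "e > 0"
    then obtain Z where Z: "Z \<in> R" "norm (T p - Z p) \<le> a * norm p + e / 2" using dist[of "e/2" p] by auto
    have "A = U (T p - Z p) - (T p - Z p)" by (simp add: A_def apply_simps UX[OF Z(1)] Vp)
    then have "norm A \<le> norm (U (T p - Z p)) + norm (T p - Z p)" by (simp add: norm_triangle_ineq4)
    then show "norm A \<le> 2 * a * norm p + e" using Z(2) by (simp add: Un)
  qed
  have nB: "norm B \<le> 2 * a * norm m"
  proof (rule field_le_epsilon)
    fix e :: real assume e: "e > 0"
    then obtain Z where Z: "Z \<in> R" "norm (T m - Z m) \<le> a * norm m + e / 2" using dist[of "e/2" m] by auto
    have "B = U (T m - Z m) + (T m - Z m)" by (simp add: B_def apply_simps UX[OF Z(1)] Vm)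
    then have "norm B \<le> norm (U (T m - Z m)) + norm (T m - Z m)" by (simp add: norm_triangle_ineq)
    then show "norm B \<le> 2 * a * norm m + e" using Z(2) by (simp add: Un)
  qed
  have "(T - (U o\<^sub>L T o\<^sub>L V)) y = T (V w) - U (T w)" by (simp add: apply_simps w_def VV)
  also have "\<dots> = - (B + A)" by (subst (1 2) w) (simp add: apply_simps Vp Vm A_def B_def)
  finally have "(norm ((T - (U o\<^sub>L T o\<^sub>L V)) y))\<^sup>2 = (norm (B + A))\<^sup>2" by (simp only: norm_minus_cancel)
  also have "\<dots> = (norm B)\<^sup>2 + (norm A)\<^sup>2" by (rule pythagoras[OF orth[OF UB UA U(1,2)]])
  also have "\<dots> \<le> (2 * a * norm m)\<^sup>2 + (2 * a * norm p)\<^sup>2" by (intro add_mono power_mono nA nB norm_ge_zero)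
  also have "\<dots> = (2 * a)\<^sup>2 * ((norm p)\<^sup>2 + (norm m)\<^sup>2)" by (simp add: power_mult_distrib distrib_left)
  also have "(norm p)\<^sup>2 + (norm m)\<^sup>2 = (norm w)\<^sup>2"
    unfolding w by (rule pythagoras[OF orth[OF Vp Vm V(1,2)], symmetric])
  also have "(2 * a)\<^sup>2 * (norm w)\<^sup>2 = (2 * a * norm y)\<^sup>2" by (simp add: w_def Vn power_mult_distrib)
  finally show "norm ((T - (U o\<^sub>L T o\<^sub>L V)) y) \<le> 2 * a * norm y"
    by (rule power2_le_imp_le) (use a in simp)
qed (use a in simp)

lemma symmetry_fixes_range: "(U, V) \<in> symmetries \<Longrightarrow> X \<in> R \<Longrightarrow> U o\<^sub>L X o\<^sub>L V = X"
  unfolding symmetries_def by (auto simp: comp_assoc)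

lemma symmetries_comp:
  assumes "(U, V) \<in> symmetries" "(U', V') \<in> symmetries"
  shows "(U o\<^sub>L U', V' o\<^sub>L V) \<in> symmetries"
proof -
  have UV: "U \<in> D" "V \<in> D" "adj U = U" "adj V = V" "U o\<^sub>L U = id_blinfun" "V o\<^sub>L V = id_blinfun"
    "U' \<in> D" "V' \<in> D" "adj U' = U'" "adj V' = V'" "U' o\<^sub>L U' = id_blinfun" "V' o\<^sub>L V' = id_blinfun"
    and X: "\<And>X. X \<in> R \<Longrightarrow> U o\<^sub>L X = X o\<^sub>L V" "\<And>X. X \<in> R \<Longrightarrow> U' o\<^sub>L X = X o\<^sub>L V'"
    using assms unfolding symmetries_def by blast+
  have c: "U' o\<^sub>L U = U o\<^sub>L U'" "V' o\<^sub>L V = V o\<^sub>L V'" using UV by (intro D_commute; simp)+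
  have sq: "(S o\<^sub>L S') o\<^sub>L (S o\<^sub>L S') = id_blinfun"
    if "S' o\<^sub>L S = S o\<^sub>L S'" "S o\<^sub>L S = id_blinfun" "S' o\<^sub>L S' = id_blinfun" for S S' :: "'a \<Rightarrow>\<^sub>L 'a"
  proof -
    have "(S o\<^sub>L S') o\<^sub>L (S o\<^sub>L S') = S o\<^sub>L ((S' o\<^sub>L S) o\<^sub>L S')" by (simp only: comp_assoc)
    also have "\<dots> = (S o\<^sub>L S) o\<^sub>L (S' o\<^sub>L S')" by (simp only: that(1) comp_assoc)
    finally show ?thesis by (simp add: that)
  qed
  have "U o\<^sub>L U' o\<^sub>L Z = Z o\<^sub>L (V' o\<^sub>L V)" if "Z \<in> R" for Z
  proof -
    have "U o\<^sub>L U' o\<^sub>L Z = (U o\<^sub>L Z) o\<^sub>L V'" by (simp only: comp_assoc X(2)[OF that])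
    also have "\<dots> = Z o\<^sub>L (V o\<^sub>L V')" by (simp only: comp_assoc X(1)[OF that])
    finally show ?thesis by (simp only: c)
  qed
  then show ?thesis
    unfolding symmetries_def using UV c sq[OF c(1)] sq[OF c(2)[symmetric]]
    by (simp add: D_comp adj_comp D_BH)
qed

lemma atom_symmetry:
  assumes "(p, q) \<in> atoms"
  shows "(2 *\<^sub>R p - id_blinfun, 2 *\<^sub>R q - id_blinfun) \<in> symmetries"
proof -
  have sym: "2 *\<^sub>R r - id_blinfun \<in> D \<and> adj (2 *\<^sub>R r - id_blinfun) = 2 *\<^sub>R r - id_blinfun \<and>
    (2 *\<^sub>R r - id_blinfun) o\<^sub>L (2 *\<^sub>R r - id_blinfun) = id_blinfun" if r: "projection r" for r
  proof (intro conjI)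
    have D: "r \<in> D" "adj r = r" "r o\<^sub>L r = r" using r by (simp_all add: projection_def)
    show "2 *\<^sub>R r - id_blinfun \<in> D" by (intro D_diff D_rscale D D_id)
    show "adj (2 *\<^sub>R r - id_blinfun) = 2 *\<^sub>R r - id_blinfun"
      by (rule adjI) (simp_all add: D D_BH apply_simps cinner_diff_left cinner_diff_right
          cinner_scaleR_left cinner_scaleR_right cinner_adj)
    show "(2 *\<^sub>R r - id_blinfun) o\<^sub>L (2 *\<^sub>R r - id_blinfun) = id_blinfun"
      by (simp add: blinfun_comp_bilin D scaleR_2)
  qed
  show ?thesis
    using assms sym[of p] sym[of q] unfolding atoms_def symmetries_def
    by (simp add: blinfun_comp_bilin)
qed

text \<open>Averaging over the symmetry of an atom turns the row \<open>p Z\<close> into \<open>p Z q = \<Phi> (p Z q) = p (\<Phi> T)\<close>,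
  and keeps rows that have already been corrected.\<close>

lemma corrected_average:
  assumes T: "T \<in> BH" and a: "a \<ge> 0"
    and dist: "\<And>x e. e > 0 \<Longrightarrow> \<exists>X\<in>R. norm (T x - blinfun_apply X x) \<le> a * norm x + e"
    and C: "finite C" "C \<subseteq> atoms"
  shows "\<exists>Z\<in>BH. norm (T - Z) \<le> 2 * a \<and> (\<forall>(p, q)\<in>C. p o\<^sub>L Z = p o\<^sub>L \<Phi> T)"
proof -
  define K where "K = convex hull {U o\<^sub>L T o\<^sub>L V | U V. (U, V) \<in> symmetries}"
  have K1: "Z \<in> BH \<and> norm (T - Z) \<le> 2 * a \<and> \<Phi> Z = \<Phi> T" if "Z \<in> K" for Z
  proof -
    have "K \<subseteq> {Z. Z \<in> BH \<and> norm (T - Z) \<le> 2 * a \<and> \<Phi> Z = \<Phi> T}"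
      unfolding K_def
    proof (rule hull_minimal)
      show "{U o\<^sub>L T o\<^sub>L V | U V. (U, V) \<in> symmetries} \<subseteq> {Z. Z \<in> BH \<and> norm (T - Z) \<le> 2 * a \<and> \<Phi> Z = \<Phi> T}"
      proof clarify
        fix U V assume UV: "(U, V) \<in> symmetries"
        then have D: "U \<in> D" "V \<in> D" by (simp_all add: symmetries_def)
        have "\<Phi> (U o\<^sub>L T o\<^sub>L V) = \<Phi> T"
          using symmetry_fixes_range[OF UV Phi_R[OF T]] by (simp add: module D T)
        then show "U o\<^sub>L T o\<^sub>L V \<in> BH \<and> norm (T - (U o\<^sub>L T o\<^sub>L V)) \<le> 2 * a \<and> \<Phi> (U o\<^sub>L T o\<^sub>L V) = \<Phi> T"
          using symmetry_displacement[OF UV T a dist] by (simp add: D D_BH T)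
      qed
      show "convex {Z. Z \<in> BH \<and> norm (T - Z) \<le> 2 * a \<and> \<Phi> Z = \<Phi> T}"
      proof (rule convexI, clarify, intro conjI)
        fix Z W and s t :: real
        assume Z: "Z \<in> BH" "norm (T - Z) \<le> 2 * a" "\<Phi> Z = \<Phi> T"
          and W: "W \<in> BH" "norm (T - W) \<le> 2 * a" "\<Phi> W = \<Phi> T" and st: "0 \<le> s" "0 \<le> t" "s + t = 1"
        show "s *\<^sub>R Z + t *\<^sub>R W \<in> BH" by (simp add: Z W)
        show "\<Phi> (s *\<^sub>R Z + t *\<^sub>R W) = \<Phi> T"
          by (simp add: add rscale Z W scaleR_add_left[symmetric] st)
        have "s *\<^sub>R Z + t *\<^sub>R W \<in> cball T (2 * a)"
          by (rule convexD[OF convex_cball]) (use Z W st in \<open>simp_all add: dist_norm\<close>)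
        then show "norm (T - (s *\<^sub>R Z + t *\<^sub>R W)) \<le> 2 * a" by (simp add: dist_norm)
      qed
    qed
    then show ?thesis using that by blast
  qed
  have K2: "U o\<^sub>L Z o\<^sub>L V \<in> K" if UV: "(U, V) \<in> symmetries" and Z: "Z \<in> K" for U V Z
  proof -
    have "K \<subseteq> {Z. U o\<^sub>L Z o\<^sub>L V \<in> K}"
      unfolding K_def
    proof (rule hull_minimal)
      show "{U o\<^sub>L T o\<^sub>L V | U V. (U, V) \<in> symmetries} \<subseteq>
        {Z. U o\<^sub>L Z o\<^sub>L V \<in> convex hull {U o\<^sub>L T o\<^sub>L V | U V. (U, V) \<in> symmetries}}"
      proof clarify
        fix U' V' assume "(U', V') \<in> symmetries"
        from symmetries_comp[OF UV this]
        have "(U o\<^sub>L U') o\<^sub>L T o\<^sub>L (V' o\<^sub>L V) \<in> {U o\<^sub>L T o\<^sub>L V | U V. (U, V) \<in> symmetries}" by blast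
        moreover have "U o\<^sub>L (U' o\<^sub>L T o\<^sub>L V') o\<^sub>L V = (U o\<^sub>L U') o\<^sub>L T o\<^sub>L (V' o\<^sub>L V)" by (simp only: comp_assoc)
        ultimately show "U o\<^sub>L (U' o\<^sub>L T o\<^sub>L V') o\<^sub>L V \<in> convex hull {U o\<^sub>L T o\<^sub>L V | U V. (U, V) \<in> symmetries}"
          by (simp only: hull_inc)
      qed
      show "convex {Z. U o\<^sub>L Z o\<^sub>L V \<in> convex hull {U o\<^sub>L T o\<^sub>L V | U V. (U, V) \<in> symmetries}}"
      proof (rule convexI, clarify)
        fix Z W and s t :: real
        assume "U o\<^sub>L Z o\<^sub>L V \<in> convex hull {U o\<^sub>L T o\<^sub>L V | U V. (U, V) \<in> symmetries}"
          "U o\<^sub>L W o\<^sub>L V \<in> convex hull {U o\<^sub>L T o\<^sub>L V | U V. (U, V) \<in> symmetries}"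
          "0 \<le> s" "0 \<le> t" "s + t = 1"
        from convexD[OF convex_convex_hull this]
        show "U o\<^sub>L (s *\<^sub>R Z + t *\<^sub>R W) o\<^sub>L V \<in> convex hull {U o\<^sub>L T o\<^sub>L V | U V. (U, V) \<in> symmetries}"
          by (simp only: blinfun_comp_bilin)
      qed
    qed
    then show ?thesis using Z by blast
  qed
  have "\<exists>Z\<in>K. \<forall>(p, q)\<in>C. p o\<^sub>L Z = p o\<^sub>L \<Phi> T"
    using C
  proof (induction C rule: finite_induct)
    case empty
    have "(id_blinfun, id_blinfun) \<in> symmetries" by (simp add: symmetries_def D_id adj_id)
    then have "id_blinfun o\<^sub>L T o\<^sub>L id_blinfun \<in> K" unfolding K_def by (intro hull_inc) blast
    then show ?case by blast
  next
    case (insert pq C)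
    then obtain Z where Z: "Z \<in> K" and ZC: "\<And>p q. (p, q) \<in> C \<Longrightarrow> p o\<^sub>L Z = p o\<^sub>L \<Phi> T" by blast
    obtain p q where pq: "pq = (p, q)" by (cases pq)
    have at: "(p, q) \<in> atoms" using insert.prems pq by blast
    have p: "p \<in> D" "p o\<^sub>L p = p" and q: "q \<in> D" and pX: "\<And>X. X \<in> R \<Longrightarrow> p o\<^sub>L X = X o\<^sub>L q"
      and pTq: "\<And>T. T \<in> BH \<Longrightarrow> p o\<^sub>L T o\<^sub>L q \<in> R"
      using at unfolding atoms_def projection_def by blast+
    define U where "U = 2 *\<^sub>R p - id_blinfun"
    define V where "V = 2 *\<^sub>R q - id_blinfun"
    have UV: "(U, V) \<in> symmetries" unfolding U_def V_def by (rule atom_symmetry[OF at])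
    define W where "W = (1/2) *\<^sub>R Z + (1/2) *\<^sub>R (U o\<^sub>L Z o\<^sub>L V)"
    have ZB: "Z \<in> BH" and ZT: "\<Phi> Z = \<Phi> T" using K1[OF Z] by simp_all
    have WK: "W \<in> K"
      unfolding W_def by (rule convexD[OF _ Z K2[OF UV Z]]) (simp_all add: K_def)
    have XR: "\<Phi> T \<in> R" by (rule Phi_R[OF T])
    have "p o\<^sub>L W = p o\<^sub>L \<Phi> T"
    proof -
      have pU: "p o\<^sub>L U = p" by (simp add: U_def blinfun_comp_bilin p scaleR_2)
      have "p o\<^sub>L (U o\<^sub>L Z o\<^sub>L V) = (p o\<^sub>L U) o\<^sub>L Z o\<^sub>L V" by (simp only: comp_assoc)
      then have "p o\<^sub>L W = (1/2) *\<^sub>R (p o\<^sub>L Z) + (1/2) *\<^sub>R (p o\<^sub>L Z o\<^sub>L V)"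
        by (simp add: W_def blinfun_comp_bilin pU)
      also have "p o\<^sub>L Z o\<^sub>L V = 2 *\<^sub>R (p o\<^sub>L Z o\<^sub>L q) - (p o\<^sub>L Z)" by (simp add: V_def blinfun_comp_bilin)
      also have "(1/2) *\<^sub>R (p o\<^sub>L Z) + (1/2) *\<^sub>R (2 *\<^sub>R (p o\<^sub>L Z o\<^sub>L q) - (p o\<^sub>L Z)) = p o\<^sub>L Z o\<^sub>L q"
        by (simp add: scaleR_diff_right)
      also have "\<dots> = \<Phi> (p o\<^sub>L Z o\<^sub>L q)" using R_fix[OF pTq[OF ZB]] by simp
      also have "\<dots> = p o\<^sub>L \<Phi> T o\<^sub>L q" by (simp add: module p q ZB ZT)
      also have "\<dots> = p o\<^sub>L (p o\<^sub>L \<Phi> T)" by (simp only: pX[OF XR, symmetric] comp_assoc)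
      finally show ?thesis by (simp add: comp_assoc[symmetric] p)
    qed
    moreover have "r o\<^sub>L W = r o\<^sub>L \<Phi> T" if r: "(r, s) \<in> C" for r s
    proof -
      have rD: "r \<in> D" using r insert.prems unfolding atoms_def projection_def by blast
      have "U \<in> D" using UV by (simp add: symmetries_def)
      then have rU: "r o\<^sub>L U = U o\<^sub>L r" by (rule D_commute[OF rD])
      have "r o\<^sub>L (U o\<^sub>L Z o\<^sub>L V) = (r o\<^sub>L U) o\<^sub>L Z o\<^sub>L V" by (simp only: comp_assoc)
      also have "\<dots> = U o\<^sub>L (r o\<^sub>L Z) o\<^sub>L V" by (simp only: rU comp_assoc)
      also have "\<dots> = (U o\<^sub>L r) o\<^sub>L \<Phi> T o\<^sub>L V" by (simp only: ZC[OF r] comp_assoc)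
      also have "\<dots> = r o\<^sub>L (U o\<^sub>L \<Phi> T o\<^sub>L V)" by (simp only: rU[symmetric] comp_assoc)
      also have "\<dots> = r o\<^sub>L \<Phi> T" by (simp only: symmetry_fixes_range[OF UV XR])
      finally have "r o\<^sub>L W = (1/2) *\<^sub>R (r o\<^sub>L \<Phi> T) + (1/2) *\<^sub>R (r o\<^sub>L \<Phi> T)"
        by (simp add: W_def blinfun_comp_bilin ZC[OF r])
      then show ?thesis by (simp add: scaleR_add_left[symmetric])
    qed
    ultimately show ?case using WK pq by (intro bexI[of _ W]) auto
  qed
  then show ?thesis using K1 by blast
qed

text \<open>If the closed span were smaller, its complement would be the range of a nonzero
  projection \<open>p \<in> D\<close>. If \<open>p \<Phi> \<noteq> 0\<close>, its range
  contains an operator of rank one and hence meets an atom; if \<open>p \<Phi> = 0\<close>, then \<open>(p, 0)\<close> is an atom.\<close>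

lemma atoms_total: "closure (span (\<Union>(p, q)\<in>atoms. range (blinfun_apply p))) = UNIV"
proof -
  define S where "S = (\<Union>(p, q)\<in>atoms. range (blinfun_apply p))"
  define M where "M = closure (span S)"
  have pD: "p \<in> D" "projection p" if "(p, q) \<in> atoms" for p q using that by (simp_all add: atoms_def projection_def)
  have "c *\<^sub>C x \<in> span S" if "x \<in> span S" for c x
    using that
  proof (induction rule: span_induct_alt)
    case base
    show ?case by (simp add: span_zero)
  next
    case (step r x y)
    then obtain p q z where "(p, q) \<in> atoms" "x = blinfun_apply p z" by (auto simp: S_def)
    then have "c *\<^sub>C x = p (c *\<^sub>C z)" using pD BH_scaleC D_BH by metis
    then have "c *\<^sub>C x \<in> S" using \<open>(p, q) \<in> atoms\<close> by (auto simp: S_def)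
    then have "r *\<^sub>R (c *\<^sub>C x) + c *\<^sub>C y \<in> span S" by (intro span_add span_scale step(2)) (simp add: span_base)
    then show ?case by (simp add: scaleC_add_right scaleR_scaleC scaleC_scaleC mult.commute)
  qed
  then have "complex_subspace (span S)" by (simp add: complex_subspace_def span_zero span_add)
  then interpret M: closed_subspace M by unfold_locales (simp_all add: M_def complex_subspace_closure)
  have inv_span: "blinfun_apply A x \<in> span S" if A: "A \<in> D" and "x \<in> span S" for A x
    using that(2)
  proof (induction rule: span_induct_alt)
    case base
    show ?case by (simp add: span_zero)
  next
    case (step r x y)
    then obtain p q z where pq: "(p, q) \<in> atoms" "x = blinfun_apply p z" by (auto simp: S_def)
    then have "A x = p (A z)" using D_commute_apply[OF A pD(1)] by simp
    then have "A x \<in> S" using pq by (auto simp: S_def)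
    then have "r *\<^sub>R A x + A y \<in> span S" by (intro span_add span_scale step(2)) (simp add: span_base)
    then show ?case by (simp add: apply_simps)
  qed
  have "proj M \<in> D"
  proof (rule proj_mem[OF M.closed_subspace_axioms])
    fix A x assume A: "A \<in> D" and "x \<in> M"
    then obtain f where f: "\<forall>n. f n \<in> span S" "f \<longlonglongrightarrow> x" unfolding M_def closure_sequential by blast
    have "(\<lambda>n. blinfun_apply A (f n)) \<longlonglongrightarrow> A x" by (intro tendsto_intros f(2))
    then show "blinfun_apply A x \<in> M"
      unfolding M_def closure_sequential using f(1) inv_span[OF A]
      by (intro exI[of _ "\<lambda>n. blinfun_apply A (f n)"]) simp
  qed
  define r where "r = id_blinfun - proj M"
  have r: "projection r"
    using \<open>proj M \<in> D\<close> by (simp add: projection_def r_def D_diff D_id adj_diff adj_id D_BH M.adj_proj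
        blinfun_comp_bilin M.proj_idem)
  have rM: "r x = 0" if "x \<in> M" for x using that by (simp add: r_def apply_simps M.proj_id)
  have inM: "x \<in> M" if "(p, q) \<in> atoms" "blinfun_apply p x = x" for p q x
  proof -
    have "x \<in> S" using that unfolding S_def by (metis (mono_tags, lifting) UN_I case_prod_conv rangeI)
    then show ?thesis unfolding M_def using closure_subset span_base by blast
  qed
  have rX: "r o\<^sub>L X = 0" if X: "X \<in> R" for X
  proof (rule ccontr)
    assume ne: "r o\<^sub>L X \<noteq> 0"
    interpret C: schur_projection D "\<lambda>T. r o\<^sub>L \<Phi> T" by (rule compress[OF r])
    have rD: "r \<in> D" "r o\<^sub>L r = r" using r by (simp_all add: projection_def)
    obtain u v where uv: "u \<noteq> 0" "v \<noteq> 0" "rank_one u v \<in> C.R"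
      using C.exists_rank_one[OF R_BH[OF X]] ne by (auto simp: R_fix[OF X])
    then have e: "r o\<^sub>L \<Phi> (rank_one u v) = rank_one u v" by (simp add: C.R_def)
    then have "\<Phi> (rank_one u v) = \<Phi> (r o\<^sub>L \<Phi> (rank_one u v))" by simp
    also have "\<dots> = r o\<^sub>L \<Phi> (\<Phi> (rank_one u v))" by (rule left_module[OF rD(1) maps[OF rank_one_BH]])
    also have "\<dots> = rank_one u v" by (simp only: idem[OF rank_one_BH] e)
    finally have uvR: "rank_one u v \<in> R" by (simp add: R_def)
    have "rank_one (r u) v = rank_one u v"
      using e rD by (metis comp_assoc comp_rank_one D_BH)
    then have "rank_one (r u - u) v = 0" by (simp add: rank_one_diff_left)
    then have ru: "r u = u" using uv(2) by (simp add: rank_one_eq_0_iff)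
    obtain p q where "(p, q) \<in> atoms" "p u = u"
    proof (rule rectangle[OF uvR uv(1,2)])
      fix p q assume "p \<in> D" "q \<in> D" "adj p = p" "p o\<^sub>L p = p" "adj q = q" "q o\<^sub>L q = q" "blinfun_apply p u = u"
        and pX: "\<And>X. X \<in> R \<Longrightarrow> p o\<^sub>L X = X o\<^sub>L q" and pTq: "\<And>T. T \<in> BH \<Longrightarrow> p o\<^sub>L T o\<^sub>L q \<in> R"
      then show thesis by (intro that[of p q]) (simp_all add: atoms_def projection_def)
    qed
    then have "u \<in> M" by (rule inM)
    then show False using rM ru uv(1) by metis
  qed
  have "projection 0" using adjI[of 0 0] by (simp add: projection_def D_zero)
  moreover have "r o\<^sub>L T o\<^sub>L 0 \<in> R" for T
  proof -
    have "r o\<^sub>L T o\<^sub>L 0 = 0" by (rule blinfun_eqI) simp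
    then show ?thesis by simp
  qed
  moreover have "X o\<^sub>L 0 = 0" for X :: "'a \<Rightarrow>\<^sub>L 'a" by (rule blinfun_eqI) simp
  ultimately have at: "(r, 0) \<in> atoms" using r rX by (simp add: atoms_def)
  have "x \<in> M" for x
  proof -
    have "r x \<in> M" by (rule inM[OF at]) (rule projection_apply[OF r])
    then have "r (r x) = 0" by (rule rM)
    then have "r x = 0" using projection_apply[OF r] by simp
    then have "proj M x = x" by (simp add: r_def apply_simps)
    then show ?thesis by (simp add: M.proj_id_iff)
  qed
  then show ?thesis unfolding M_def S_def by blast
qed

text \<open>Testing against vectors in the span of the ranges of finitely many atoms cannot distinguish \<open>\<Phi> T\<close>
  from the corrected averages \<open>Z\<close>, which stay within \<open>2 a\<close> of \<open>T\<close>.\<close>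

theorem perp_bound:
  assumes T: "T \<in> BH" and a: "a \<ge> 0"
    and dist: "\<And>x e. e > 0 \<Longrightarrow> \<exists>X\<in>R. norm (T x - blinfun_apply X x) \<le> a * norm x + e"
  shows "norm (T - \<Phi> T) \<le> 2 * a"
proof (rule norm_blinfun_bound)
  fix y
  have weak: "norm (cinner ((T - \<Phi> T) y) x) \<le> 2 * a * norm y * norm x" for x
  proof (rule field_le_epsilon)
    fix e :: real assume e: "e > 0"
    define L where "L = (2 * a + 2 * norm T) * norm y + 1"
    have L: "L > 0" using a by (simp add: L_def add_nonneg_pos)
    have "x \<in> closure (span (\<Union>(p, q)\<in>atoms. range (blinfun_apply p)))" by (simp add: atoms_total)
    then obtain m where m: "m \<in> span (\<Union>(p, q)\<in>atoms. range (blinfun_apply p))" "dist m x < e / L"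
      unfolding closure_approachable using e L by (meson divide_pos_pos)
    obtain t c where t: "finite t" "t \<subseteq> (\<Union>(p, q)\<in>atoms. range (blinfun_apply p))" "m = (\<Sum>b\<in>t. c b *\<^sub>R b)"
      using m(1) unfolding span_explicit by blast
    have "\<forall>b\<in>t. \<exists>pq. pq \<in> atoms \<and> b \<in> range (blinfun_apply (fst pq))" using t(2) by fastforce
    then obtain f where f: "\<And>b. b \<in> t \<Longrightarrow> f b \<in> atoms" "\<And>b. b \<in> t \<Longrightarrow> b \<in> range (blinfun_apply (fst (f b)))"
      by metis
    have "finite (f ` t)" "f ` t \<subseteq> atoms" using t(1) f(1) by auto
    from corrected_average[OF T a dist this] obtain Z where Z: "Z \<in> BH" "norm (T - Z) \<le> 2 * a"
      and Zf: "\<And>p q. (p, q) \<in> f ` t \<Longrightarrow> p o\<^sub>L Z = p o\<^sub>L \<Phi> T" by blast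
    have "cinner ((Z - \<Phi> T) y) b = 0" if b: "b \<in> t" for b
    proof -
      obtain p q where pq: "f b = (p, q)" by (cases "f b")
      then have projection: "projection p" using f(1)[OF b] by (simp add: atoms_def)
      then have p: "p \<in> BH" "adj p = p" by (simp_all add: projection_def D_BH)
      obtain z where z: "b = p z" using f(2)[OF b] pq by auto
      have "p o\<^sub>L Z = p o\<^sub>L \<Phi> T" using Zf b pq by (metis imageI)
      then have "p (Z y) = p (\<Phi> T y)" by (metis blinfun_apply_blinfun_compose)
      then have "p ((Z - \<Phi> T) y) = 0" by (simp add: apply_simps)
      then have "cinner (p ((Z - \<Phi> T) y)) z = 0" by simp
      then show ?thesis by (simp add: cinner_adj p z)
    qed
    then have m0: "cinner ((Z - \<Phi> T) y) m = 0"
      by (simp add: t(3) cinner_sum_right cinner_scaleR_right)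
    have "cinner ((T - \<Phi> T) y) x = cinner ((T - Z) y) x + cinner ((Z - \<Phi> T) y) (x - m)"
      by (simp add: cinner_diff_right m0) (simp add: apply_simps cinner_diff_left)
    also have "norm \<dots> \<le> norm ((T - Z) y) * norm x + norm ((Z - \<Phi> T) y) * norm (x - m)"
      by (intro norm_triangle_le add_mono norm_cinner_le)
    also have "\<dots> \<le> (2 * a * norm y) * norm x + L * (e / L)"
    proof (intro add_mono mult_mono)
      show "norm ((T - Z) y) \<le> 2 * a * norm y"
        using norm_blinfun[of "T - Z" y] mult_right_mono[OF Z(2) norm_ge_zero[of y]] by linarith
      have "norm (Z - \<Phi> T) \<le> norm (T - \<Phi> T) + norm (T - Z)"
        using norm_triangle_ineq4[of "T - \<Phi> T" "T - Z"] by simp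
      also have "\<dots> \<le> (norm T + norm T) + 2 * a"
        using norm_triangle_ineq4[of T "\<Phi> T"] contractive[OF T] Z(2) by linarith
      finally have "norm (Z - \<Phi> T) * norm y \<le> (2 * a + 2 * norm T) * norm y" by (intro mult_right_mono) auto
      then show "norm ((Z - \<Phi> T) y) \<le> L" using norm_blinfun[of "Z - \<Phi> T" y] unfolding L_def by linarith
      show "norm (x - m) \<le> e / L" using m(2) by (simp add: dist_norm norm_minus_commute)
    qed (use L a in auto)
    also have "L * (e / L) = e" using L by simp
    finally show "norm (cinner ((T - \<Phi> T) y) x) \<le> 2 * a * norm y * norm x + e" .
  qed
  have "norm ((T - \<Phi> T) y) * norm ((T - \<Phi> T) y) \<le> 2 * a * norm y * norm ((T - \<Phi> T) y)"
    using weak[of "(T - \<Phi> T) y"] by (simp add: cinner_self power2_eq_square norm_mult)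
  then show "norm ((T - \<Phi> T) y) \<le> 2 * a * norm y"
    by (cases "(T - \<Phi> T) y = 0") (use a in \<open>auto simp: mult_le_cancel_right\<close>)
qed (use a in simp)

end

section \<open>Weak* continuous functionals\<close>

text \<open>The functionals on \<open>BH\<close> in the norm closure of the functionals of finite rank.\<close>

definition approximable :: "(('a::complex_hilbert_space \<Rightarrow>\<^sub>L 'a) \<Rightarrow> complex) \<Rightarrow> bool" where
  "approximable f \<longleftrightarrow> (\<forall>\<eta>>0. \<exists>(n::nat) u v. \<forall>T\<in>BH.
     norm (f T - (\<Sum>k<n. cinner (blinfun_apply T (u k)) (v k))) \<le> \<eta> * norm T)"

definition linear_on_BH :: "(('a::complex_hilbert_space \<Rightarrow>\<^sub>L 'a) \<Rightarrow> complex) \<Rightarrow> bool" where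
  "linear_on_BH f \<longleftrightarrow> (\<forall>S\<in>BH. \<forall>T\<in>BH. f (S + T) = f S + f T) \<and> (\<forall>c. \<forall>T\<in>BH. f (c *\<^sub>C T) = c * f T)"

lemma approximable_zero: "approximable (\<lambda>T. 0)"
  unfolding approximable_def
proof (intro allI impI)
  fix \<eta> :: real assume "\<eta> > 0"
  then show "\<exists>(n::nat) u v. \<forall>T\<in>BH. norm (0 - (\<Sum>k<n. cinner (blinfun_apply T (u k)) (v k))) \<le> \<eta> * norm T"
    by (intro exI[of _ 0]) simp
qed

lemma approximable_add:
  assumes "approximable f" "approximable g"
  shows "approximable (\<lambda>T. f T + g T)"
  unfolding approximable_def
proof (intro allI impI)
  fix \<eta> :: real assume "\<eta> > 0"
  then have \<eta>: "\<eta> / 2 > 0" by simp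
  obtain n :: nat and u v where f: "\<And>T. T \<in> BH \<Longrightarrow>
      norm (f T - (\<Sum>k<n. cinner (blinfun_apply T (u k)) (v k))) \<le> \<eta> / 2 * norm T"
    using assms(1) \<eta> unfolding approximable_def by blast
  obtain m :: nat and u' v' where g: "\<And>T. T \<in> BH \<Longrightarrow>
      norm (g T - (\<Sum>k<m. cinner (blinfun_apply T (u' k)) (v' k))) \<le> \<eta> / 2 * norm T"
    using assms(2) \<eta> unfolding approximable_def by blast
  define x where "x k = (if k < n then u k else u' (k - n))" for k
  define y where "y k = (if k < n then v k else v' (k - n))" for k
  have "norm (f T + g T - (\<Sum>k<n + m. cinner (blinfun_apply T (x k)) (y k))) \<le> \<eta> * norm T" if T: "T \<in> BH" for T
  proof -
    have split: "(\<Sum>k<n + j. h k) = (\<Sum>k<n. h k) + (\<Sum>k<j. h (n + k))" for h :: "nat \<Rightarrow> complex" and j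
      by (induction j) simp_all
    have "(\<Sum>k<n + m. cinner (T (x k)) (y k)) = (\<Sum>k<n. cinner (T (u k)) (v k)) + (\<Sum>k<m. cinner (T (u' k)) (v' k))"
      unfolding split by (simp add: x_def y_def)
    then have "f T + g T - (\<Sum>k<n + m. cinner (T (x k)) (y k))
      = (f T - (\<Sum>k<n. cinner (T (u k)) (v k))) + (g T - (\<Sum>k<m. cinner (T (u' k)) (v' k)))" by simp
    also have "norm \<dots> \<le> \<eta> / 2 * norm T + \<eta> / 2 * norm T"
      by (intro norm_triangle_le add_mono f g T)
    finally show ?thesis by simp
  qed
  then show "\<exists>(n::nat) u v. \<forall>T\<in>BH. norm (f T + g T - (\<Sum>k<n. cinner (blinfun_apply T (u k)) (v k))) \<le> \<eta> * norm T"
    by (intro exI[of _ "n + m"] exI[of _ x] exI[of _ y] ballI)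
qed

lemma approximable_scale:
  assumes "approximable f"
  shows "approximable (\<lambda>T. a * f T)"
  unfolding approximable_def
proof (intro allI impI)
  fix \<eta> :: real assume \<eta>: "\<eta> > 0"
  have a: "norm a + 1 > 0" using norm_ge_zero[of a] by linarith
  then have "\<eta> / (norm a + 1) > 0" using \<eta> by simp
  then obtain n :: nat and u v where f: "\<And>T. T \<in> BH \<Longrightarrow>
      norm (f T - (\<Sum>k<n. cinner (blinfun_apply T (u k)) (v k))) \<le> \<eta> / (norm a + 1) * norm T"
    using assms unfolding approximable_def by blast
  have "norm (a * f T - (\<Sum>k<n. cinner (blinfun_apply T (u k)) (cnj a *\<^sub>C v k))) \<le> \<eta> * norm T" if T: "T \<in> BH" for T
  proof -
    have "a * f T - (\<Sum>k<n. cinner (T (u k)) (cnj a *\<^sub>C v k)) = a * (f T - (\<Sum>k<n. cinner (T (u k)) (v k)))"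
      by (simp add: cinner_scaleC_right right_diff_distrib sum_distrib_left)
    also have "norm \<dots> \<le> norm a * (\<eta> / (norm a + 1) * norm T)"
      unfolding norm_mult by (intro mult_left_mono f T) simp
    also have "\<dots> \<le> (norm a + 1) * (\<eta> / (norm a + 1) * norm T)"
      using \<eta> a by (intro mult_right_mono) auto
    also have "\<dots> = \<eta> * norm T" using a by simp
    finally show ?thesis .
  qed
  then show "\<exists>(n::nat) u v. \<forall>T\<in>BH. norm (a * f T - (\<Sum>k<n. cinner (blinfun_apply T (u k)) (v k))) \<le> \<eta> * norm T"
    by (intro exI[of _ n] exI[of _ u] exI[of _ "\<lambda>k. cnj a *\<^sub>C v k"] ballI)
qed

lemma approximable_sum:
  "(\<And>i. i \<in> I \<Longrightarrow> approximable (f i)) \<Longrightarrow> approximable (\<lambda>T. \<Sum>i\<in>I. f i T)"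
  by (induction I rule: infinite_finite_induct) (simp_all add: approximable_zero approximable_add)

lemma predual_functional_properties:
  assumes f: "f \<in> predual_functionals"
  shows "linear_on_BH f" "approximable f"
proof -
  obtain x y :: "nat \<Rightarrow> 'a" where fxy: "f = (\<lambda>T. \<Sum>n. cinner (blinfun_apply T (x n)) (y n))"
    and sx: "summable (\<lambda>n. (norm (x n))\<^sup>2)" and sy: "summable (\<lambda>n. (norm (y n))\<^sup>2)"
    using f unfolding predual_functionals_def by blast
  define t where "t n = (norm (x n))\<^sup>2 + (norm (y n))\<^sup>2" for n
  have st: "summable t" unfolding t_def by (rule summable_add[OF sx sy])
  have le: "norm (cinner (blinfun_apply T (x n)) (y n)) \<le> norm T * t n" for T :: "'a \<Rightarrow>\<^sub>L 'a" and n
  proof -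
    have "norm (cinner (T (x n)) (y n)) \<le> norm (T (x n)) * norm (y n)" by (rule norm_cinner_le)
    also have "\<dots> \<le> (norm T * norm (x n)) * norm (y n)" by (intro mult_right_mono norm_blinfun) simp
    also have "\<dots> = norm T * (norm (x n) * norm (y n))" by simp
    also have "\<dots> \<le> norm T * t n"
    proof (rule mult_left_mono)
      have "0 \<le> (norm (x n) - norm (y n))\<^sup>2" by simp
      then have "2 * (norm (x n) * norm (y n)) \<le> t n" by (simp add: t_def power2_diff)
      moreover have "0 \<le> norm (x n) * norm (y n)" by simp
      ultimately show "norm (x n) * norm (y n) \<le> t n" by linarith
    qed simp
    finally show ?thesis .
  qed
  have sn: "summable (\<lambda>n. norm (cinner (blinfun_apply T (x n)) (y n)))" for T :: "'a \<Rightarrow>\<^sub>L 'a"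
    by (rule summable_comparison_test'[OF summable_mult[OF st, of "norm T"], of 0]) (use le[of T] in simp)
  then have s: "summable (\<lambda>n. cinner (blinfun_apply T (x n)) (y n))" for T :: "'a \<Rightarrow>\<^sub>L 'a"
    by (rule summable_norm_cancel)
  show "linear_on_BH f"
    unfolding linear_on_BH_def fxy
    by (simp add: apply_simps cinner_add_left cinner_scaleC_left suminf_add s suminf_mult)
  show "approximable f"
    unfolding approximable_def
  proof (intro allI impI)
    fix \<eta> :: real assume "\<eta> > 0"
    from suminf_exist_split[OF this st] obtain N where N: "norm (\<Sum>i. t (i + N)) < \<eta>" by blast
    have t0: "t n \<ge> 0" for n by (simp add: t_def)
    have "norm (f T - (\<Sum>k<N. cinner (blinfun_apply T (x k)) (y k))) \<le> \<eta> * norm T" for T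
    proof -
      have "f T - (\<Sum>k<N. cinner (T (x k)) (y k)) = (\<Sum>n. cinner (T (x (n + N))) (y (n + N)))"
        unfolding fxy using suminf_split_initial_segment[OF s[of T], of N] by simp
      also have "norm \<dots> \<le> (\<Sum>n. norm (cinner (T (x (n + N))) (y (n + N))))"
        using summable_ignore_initial_segment[OF sn[of T], of N] by (rule summable_norm)
      also have "\<dots> \<le> (\<Sum>n. norm T * t (n + N))"
        using summable_ignore_initial_segment[OF sn[of T], of N]
          summable_ignore_initial_segment[OF summable_mult[OF st, of "norm T"], of N]
        by (intro suminf_le le)
      also have "\<dots> = norm T * (\<Sum>n. t (n + N))"
        by (rule suminf_mult[OF summable_ignore_initial_segment[OF st]])
      also have "\<dots> \<le> norm T * \<eta>" using N by (intro mult_left_mono) auto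
      finally show ?thesis by (simp add: mult.commute)
    qed
    then show "\<exists>(n::nat) u v. \<forall>T\<in>BH. norm (f T - (\<Sum>k<n. cinner (blinfun_apply T (u k)) (v k))) \<le> \<eta> * norm T"
      by (intro exI[of _ N] exI[of _ x] exI[of _ y] ballI)
  qed
qed

lemma coefficient_predual: "(\<lambda>T. cinner (blinfun_apply T y) x) \<in> predual_functionals"
proof -
  define a where "a n = (if n = (0::nat) then y else 0)" for n
  define b where "b n = (if n = (0::nat) then x else 0)" for n
  have "(\<Sum>n. cinner (blinfun_apply T (a n)) (b n)) = cinner (blinfun_apply T y) x" for T
  proof -
    have "(\<Sum>n. cinner (T (a n)) (b n)) = (\<Sum>n\<in>{0}. cinner (T (a n)) (b n))"
      by (rule suminf_finite) (simp_all add: a_def)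
    then show ?thesis by (simp add: a_def b_def)
  qed
  moreover have "summable (\<lambda>n. (norm (a n))\<^sup>2)" "summable (\<lambda>n. (norm (b n))\<^sup>2)"
    by (rule summable_finite[of "{0}"], simp_all add: a_def b_def)+
  ultimately show ?thesis
    unfolding predual_functionals_def by (intro CollectI exI[of _ a] exI[of _ b]) (auto intro!: ext)
qed

lemma weak_star_nbhd:
  assumes "openin weak_star W" "T \<in> W"
  shows "\<exists>F \<epsilon>. finite F \<and> F \<subseteq> predual_functionals \<and> \<epsilon> > 0 \<and>
    (\<forall>S\<in>BH. (\<forall>f\<in>F. norm (f S - f T) < \<epsilon>) \<longrightarrow> S \<in> W)"
proof -
  have "generate_topology_on {{T \<in> BH. f T \<in> U} | f U. f \<in> predual_functionals \<and> open U} W"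
    using assms(1) unfolding weak_star_def openin_topology_generated_by_iff .
  then show ?thesis
    using assms(2)
  proof (induction arbitrary: T rule: generate_topology_on.induct)
    case (Int A B)
    then have T: "T \<in> A" "T \<in> B" by blast+
    from Int.IH(1)[OF T(1)] obtain F \<epsilon> where F: "finite F" "F \<subseteq> predual_functionals" "\<epsilon> > 0"
      "\<forall>S\<in>BH. (\<forall>f\<in>F. norm (f S - f T) < \<epsilon>) \<longrightarrow> S \<in> A" by blast
    from Int.IH(2)[OF T(2)] obtain G \<delta> where G: "finite G" "G \<subseteq> predual_functionals" "\<delta> > 0"
      "\<forall>S\<in>BH. (\<forall>f\<in>G. norm (f S - f T) < \<delta>) \<longrightarrow> S \<in> B" by blast
    show ?case
      by (intro exI[of _ "F \<union> G"] exI[of _ "min \<epsilon> \<delta>"] conjI ballI impI) (use F G in auto)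
  next
    case (UN K)
    then obtain k where k: "k \<in> K" "T \<in> k" by blast
    from UN.IH[OF this] k(1) show ?case by blast
  next
    case (Basis s)
    then obtain f U where fU: "s = {T \<in> BH. f T \<in> U}" "f \<in> predual_functionals" "open U" by blast
    then have "f T \<in> U" using Basis.prems by blast
    then obtain \<epsilon> where \<epsilon>: "\<epsilon> > 0" "ball (f T) \<epsilon> \<subseteq> U" using fU(3) by (meson openE)
    show ?case
    proof (intro exI[of _ "{f}"] exI[of _ \<epsilon>] conjI ballI impI)
      fix S assume "S \<in> BH" "\<forall>g\<in>{f}. norm (g S - g T) < \<epsilon>"
      moreover from this have "f S \<in> ball (f T) \<epsilon>" by (simp add: dist_norm norm_minus_commute)
      ultimately show "S \<in> s" using \<epsilon>(2) fU(1) by blast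
    qed (use fU \<epsilon> in auto)
  qed simp
qed

lemma linear_combination_if_kernels:
  assumes "finite F" "\<And>f. f \<in> F \<Longrightarrow> linear_on_BH f" "linear_on_BH g"
    and "\<And>S. S \<in> BH \<Longrightarrow> (\<And>f. f \<in> F \<Longrightarrow> f S = 0) \<Longrightarrow> g S = 0"
  shows "\<exists>a. \<forall>S\<in>BH. g S = (\<Sum>f\<in>F. a f * f S)"
  using assms
proof (induction F arbitrary: g rule: finite_induct)
  case empty
  then show ?case by simp
next
  case (insert h F)
  have h: "linear_on_BH h" and F: "\<And>f. f \<in> F \<Longrightarrow> linear_on_BH f" using insert.prems by blast+
  show ?case
  proof (cases "\<exists>S\<in>BH. (\<forall>f\<in>F. f S = 0) \<and> h S \<noteq> 0")
    case True
    then obtain S\<^sub>0 where S0: "S\<^sub>0 \<in> BH" "\<And>f. f \<in> F \<Longrightarrow> f S\<^sub>0 = 0" "h S\<^sub>0 \<noteq> 0" by blast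
    define b where "b = g S\<^sub>0 / h S\<^sub>0"
    define g' where "g' S = g S - b * h S" for S
    have "linear_on_BH g'"
      using insert.prems(2) h unfolding linear_on_BH_def g'_def by (simp add: algebra_simps)
    moreover have "g' S = 0" if S: "S \<in> BH" "\<And>f. f \<in> F \<Longrightarrow> f S = 0" for S
    proof -
      define c where "c = h S / h S\<^sub>0"
      have lin: "f (S + (- c) *\<^sub>C S\<^sub>0) = f S - c * f S\<^sub>0" if "linear_on_BH f" for f
        using that S(1) S0(1) unfolding linear_on_BH_def by (simp del: scaleC_minus_left)
      have "g (S + (- c) *\<^sub>C S\<^sub>0) = 0"
      proof (rule insert.prems(3))
        show "S + (- c) *\<^sub>C S\<^sub>0 \<in> BH" using S(1) S0(1) by (intro BH_add BH_cscale)
        fix f assume "f \<in> insert h F"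
        then show "f (S + (- c) *\<^sub>C S\<^sub>0) = 0"
        proof
          assume "f = h"
          then have "f (S + (- c) *\<^sub>C S\<^sub>0) = h S - c * h S\<^sub>0" by (simp only: lin[OF h])
          then show ?thesis using S0(3) by (simp only: c_def) simp
        next
          assume f: "f \<in> F"
          then show ?thesis unfolding lin[OF F[OF f]] by (simp add: S(2)[OF f] S0(2)[OF f])
        qed
      qed
      then have "g S = c * g S\<^sub>0" unfolding lin[OF insert.prems(2)] by simp
      then show ?thesis by (simp add: g'_def b_def c_def)
    qed
    ultimately obtain a where a: "\<And>S. S \<in> BH \<Longrightarrow> g' S = (\<Sum>f\<in>F. a f * f S)"
      using insert.IH[OF F] by blast
    have "g S = (\<Sum>f\<in>insert h F. (a(h := b)) f * f S)" if S: "S \<in> BH" for S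
    proof -
      have "(\<Sum>f\<in>F. (a(h := b)) f * f S) = (\<Sum>f\<in>F. a f * f S)"
        using insert.hyps(2) by (intro sum.cong refl) auto
      moreover have "g S = b * h S + g' S" by (simp add: g'_def)
      ultimately show ?thesis using insert.hyps a[OF S] by simp
    qed
    then show ?thesis by blast
  next
    case False
    then have "g S = 0" if "S \<in> BH" "\<And>f. f \<in> F \<Longrightarrow> f S = 0" for S
      using insert.prems(3)[of S] that by blast
    then obtain a where a: "\<And>S. S \<in> BH \<Longrightarrow> g S = (\<Sum>f\<in>F. a f * f S)"
      using insert.IH[OF F insert.prems(2)] by blast
    have "g S = (\<Sum>f\<in>insert h F. (a(h := 0)) f * f S)" if S: "S \<in> BH" for S
    proof -
      have "(\<Sum>f\<in>F. (a(h := 0)) f * f S) = (\<Sum>f\<in>F. a f * f S)"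
        using insert.hyps(2) by (intro sum.cong refl) auto
      then show ?thesis using insert.hyps a[OF S] by simp
    qed
    then show ?thesis by blast
  qed
qed

text \<open>A weak* continuous functional is bounded on a weak* neighbourhood of \<open>0\<close>, hence vanishes where
  finitely many predual functionals vanish, and so is a linear combination of them.\<close>

lemma approximable_coefficient:
  fixes \<Phi> :: "('a::complex_hilbert_space \<Rightarrow>\<^sub>L 'a) \<Rightarrow> ('a \<Rightarrow>\<^sub>L 'a)"
  assumes cont: "continuous_map weak_star weak_star \<Phi>"
    and add: "\<And>S T. S \<in> BH \<Longrightarrow> T \<in> BH \<Longrightarrow> \<Phi> (S + T) = \<Phi> S + \<Phi> T"
    and scale: "\<And>c T. T \<in> BH \<Longrightarrow> \<Phi> (c *\<^sub>C T) = c *\<^sub>C \<Phi> T"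
  shows "approximable (\<lambda>T. cinner (\<Phi> T y) x)"
proof -
  define g where "g T = cinner (\<Phi> T y) x" for T
  have lin: "linear_on_BH g"
    by (simp add: linear_on_BH_def g_def add scale apply_simps cinner_add_left cinner_scaleC_left)
  define U where "U = {S \<in> BH. cinner (blinfun_apply S y) x \<in> ball 0 1}"
  have "openin weak_star U"
    unfolding weak_star_def U_def
    by (intro topology_generated_by_Basis CollectI exI[of _ "\<lambda>S. cinner (blinfun_apply S y) x"]
        exI[of _ "ball 0 1"] conjI refl coefficient_predual open_ball)
  then have W: "openin weak_star {T \<in> topspace weak_star. \<Phi> T \<in> U}"
    by (rule openin_continuous_map_preimage[OF cont])
  have P0: "\<Phi> 0 = 0" using scale[of 0 0] by simp
  have "0 \<in> {T \<in> topspace weak_star. \<Phi> T \<in> U}" by (simp add: topspace_weak_star P0 U_def)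
  from weak_star_nbhd[OF W this] obtain F \<epsilon> where F: "finite F" "F \<subseteq> predual_functionals" and \<epsilon>: "\<epsilon> > 0"
    and nbhd: "\<forall>S\<in>BH. (\<forall>f\<in>F. norm (f S - f 0) < \<epsilon>) \<longrightarrow> S \<in> {T \<in> topspace weak_star. \<Phi> T \<in> U}"
    by (elim exE conjE)
  have nb: "\<Phi> S \<in> U" if "S \<in> BH" "\<And>f. f \<in> F \<Longrightarrow> norm (f S - f 0) < \<epsilon>" for S
    using nbhd that by simp
  have linF: "linear_on_BH f" if "f \<in> F" for f using F(2) that predual_functional_properties(1) by blast
  have f0: "f 0 = 0" if "linear_on_BH f" for f
  proof -
    have "f (0 *\<^sub>C 0) = 0 * f 0" using that BH_0 unfolding linear_on_BH_def by blast
    then show ?thesis by simp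
  qed
  have "g S = 0" if S: "S \<in> BH" "\<And>f. f \<in> F \<Longrightarrow> f S = 0" for S
  proof (rule ccontr)
    assume ne: "g S \<noteq> 0"
    define c where "c = 1 / g S"
    have "\<Phi> (c *\<^sub>C S) \<in> U"
    proof (rule nb)
      show "c *\<^sub>C S \<in> BH" using S by simp
      fix f assume f: "f \<in> F"
      have "f (c *\<^sub>C S) = c * f S" using linF[OF f] S(1) unfolding linear_on_BH_def by blast
      then show "norm (f (c *\<^sub>C S) - f 0) < \<epsilon>" using \<epsilon> S(2)[OF f] f0[OF linF[OF f]] by simp
    qed
    moreover have "g (c *\<^sub>C S) = c * g S" using lin S(1) unfolding linear_on_BH_def by blast
    ultimately show False using ne by (simp add: U_def g_def c_def)
  qed
  then obtain a where a: "\<And>S. S \<in> BH \<Longrightarrow> g S = (\<Sum>f\<in>F. a f * f S)"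
    using linear_combination_if_kernels[OF F(1) linF lin] by metis
  have "approximable (\<lambda>S. \<Sum>f\<in>F. a f * f S)"
    using F(2) predual_functional_properties(2) by (intro approximable_sum approximable_scale) blast
  then have "approximable g" unfolding approximable_def using a by simp
  then show ?thesis unfolding g_def .
qed

section \<open>The hyperreflexivity constant\<close>

lemma schur_projectionI:
  fixes D :: "('a::complex_hilbert_space \<Rightarrow>\<^sub>L 'a) set"
  assumes D: "masa D" and \<Phi>: "\<Phi> \<in> schur_idempotents D" and norm: "map_norm \<Phi> \<le> 1"
  shows "schur_projection D \<Phi>"
proof -
  have cont: "continuous_map weak_star weak_star \<Phi>"
    and add: "\<And>S T. S \<in> BH \<Longrightarrow> T \<in> BH \<Longrightarrow> \<Phi> (S + T) = \<Phi> S + \<Phi> T"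
    and scale: "\<And>c T. T \<in> BH \<Longrightarrow> \<Phi> (c *\<^sub>C T) = c *\<^sub>C \<Phi> T"
    and mod: "\<And>A B T. A \<in> D \<Longrightarrow> B \<in> D \<Longrightarrow> T \<in> BH \<Longrightarrow> \<Phi> (A o\<^sub>L T o\<^sub>L B) = A o\<^sub>L \<Phi> T o\<^sub>L B"
    and idem: "\<And>T. T \<in> BH \<Longrightarrow> \<Phi> (\<Phi> T) = \<Phi> T"
    using \<Phi> unfolding schur_idempotents_def schur_multiplier_def by blast+
  have maps: "\<Phi> T \<in> BH" if "T \<in> BH" for T
    using continuous_map_image_subset_topspace[OF cont] that by (auto simp: topspace_weak_star)
  have contr: "norm (\<Phi> T) \<le> norm T" if T: "T \<in> BH" for T
  proof (cases "T = 0")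
    case True
    then show ?thesis using scale[of 0 0] by simp
  next
    case False
    define S where "S = complex_of_real (1 / norm T) *\<^sub>C T"
    have S: "S \<in> BH" "norm S \<le> 1" using T False by (simp_all add: S_def norm_scaleC_blinfun norm_divide)
    have "ennreal (norm (\<Phi> S)) \<le> map_norm \<Phi>" unfolding map_norm_def by (rule SUP_upper) (use S in simp)
    then have "ennreal (norm (\<Phi> S)) \<le> 1" using norm by (rule order_trans)
    then have "norm (\<Phi> S) \<le> 1" by (simp add: ennreal_le_1)
    moreover have "norm (\<Phi> S) = norm (\<Phi> T) / norm T"
      unfolding S_def scale[OF T] norm_scaleC_blinfun by (simp add: norm_divide)
    ultimately show ?thesis using False by (simp add: divide_le_eq)
  qed
  show ?thesis
  proof
    fix \<eta> :: real and y x :: 'a assume "\<eta> > 0"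
    then show "\<exists>(n::nat) u v. \<forall>T\<in>BH. norm (cinner (\<Phi> T y) x
        - (\<Sum>k<n. cinner (blinfun_apply T (u k)) (v k))) \<le> \<eta> * norm T"
      using approximable_coefficient[OF cont add scale, of y x] unfolding approximable_def by blast
  qed (use D add scale mod idem maps contr in auto)
qed

theorem proposition3p11:
  fixes D :: "('a::complex_hilbert_space \<Rightarrow>\<^sub>L 'a) set"
    and \<Phi> :: "('a \<Rightarrow>\<^sub>L 'a) \<Rightarrow> ('a \<Rightarrow>\<^sub>L 'a)"
  assumes "separable_space (euclidean :: 'a topology)"
    and "masa D"
    and "\<Phi> \<in> schur_idempotents D"
    and "map_norm \<Phi> \<le> 1"
  shows "\<Phi> \<in> hyperreflexive_idempotents D \<and> hyperreflexivity_constant \<Phi> \<le> 2"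
proof -
  interpret schur_projection D \<Phi> by (rule schur_projectionI[OF assms(2-4)])
  have "ennreal (norm (perp \<Phi> T)) \<le> ennreal 2 * alpha T (Ran \<Phi>)" if T: "T \<in> BH" for T
  proof (cases "alpha T R = \<infinity>")
    case True
    then show ?thesis by (simp add: Ran_eq ennreal_mult_top)
  next
    case False
    then obtain a where a: "a \<ge> 0" "alpha T R = ennreal a" by (cases "alpha T R") auto
    have unit: "\<exists>X\<in>R. norm (T x - blinfun_apply X x) < a + e" if x: "norm x = 1" and e: "e > 0" for x e
    proof -
      have "(INF X\<in>R. ennreal (norm (T x - blinfun_apply X x))) \<le> alpha T R"
        unfolding alpha_def by (rule SUP_upper) (simp add: x)
      also have "\<dots> < ennreal (a + e)" using a e by (simp add: ennreal_lessI)
      finally obtain X where "X \<in> R" "ennreal (norm (T x - blinfun_apply X x)) < ennreal (a + e)"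
        unfolding INF_less_iff by blast
      then show ?thesis by (auto simp: ennreal_less_iff)
    qed
    have "norm (T - \<Phi> T) \<le> 2 * a"
    proof (rule perp_bound[OF T a(1)])
      fix x :: 'a and e :: real assume e: "e > 0"
      show "\<exists>X\<in>R. norm (T x - blinfun_apply X x) \<le> a * norm x + e"
      proof (cases "x = 0")
        case True
        then show ?thesis using e by (intro bexI[of _ 0]) simp_all
      next
        case False
        then obtain X where X: "X \<in> R" "norm (T (sgn x) - blinfun_apply X (sgn x)) < a + e / norm x"
          using unit[of "sgn x" "e / norm x"] e by (auto simp: norm_sgn)
        have "T (sgn x) - X (sgn x) = (1 / norm x) *\<^sub>R (T x - X x)"
          by (simp add: sgn_div_norm apply_simps scaleR_diff_right inverse_eq_divide)
        then have "norm (T x - X x) / norm x < a + e / norm x" using X(2) by simp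
        then have "norm (T x - X x) < a * norm x + e" using False by (simp add: field_simps)
        then show ?thesis using X(1) by (intro bexI[of _ X]) simp_all
      qed
    qed
    then have "ennreal (norm (perp \<Phi> T)) \<le> ennreal (2 * a)" by (simp add: perp_def ennreal_leI)
    also have "\<dots> = ennreal 2 * alpha T (Ran \<Phi>)" using a by (simp add: Ran_eq ennreal_mult)
    finally show ?thesis .
  qed
  then have two: "2 \<in> hyperreflexivity_bounds \<Phi>" by (simp add: hyperreflexivity_bounds_def)
  moreover have "bdd_below (hyperreflexivity_bounds \<Phi>)"
    by (rule bdd_belowI[of _ 0]) (simp add: hyperreflexivity_bounds_def)
  ultimately have "hyperreflexivity_constant \<Phi> \<le> 2"
    unfolding hyperreflexivity_constant_def by (intro cInf_lower)
  then show ?thesis using two assms(3) by (auto simp: hyperreflexive_idempotents_def)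
qed

end
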